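(* Let $s>\tfrac12$ and let $u(x,t)=e^{-itL_{maxwell}}u_0$ be the solution of $iu_t=L_{maxwell}u$, $t\in\mathbb{R}$, $u(x,0)=u_0(x)$, where $u_0\in(I-\mathcal{P})L^2(\mathbb{R}^3,\mathbb{C}^6)$. There exists a constant $C=C_s>0$ such that $$\int_{\mathbb{R}}\int_{\mathbb{R}^3}(1+|x|^2)^{-s}|u(x,t)|^2\,dx\,dt\le C\|u_0\|_{L^2}^2.$$
   Context: $L_{maxwell}\binom{E}{B}=\begin{pmatrix}0&-D\times\\ D\times&0\end{pmatrix}\binom{E}{B}$ for $\mathbb{C}^3$-valued $E,B$ on $\mathbb{R}^3$, $D=\frac1i\nabla_x$; it is the self-adjoint operator in $L^2(\mathbb{R}^3,\mathbb{C}^6)$ with Fourier symbol $\begin{pmatrix}0&-\gamma(\xi)\\ \gamma(\xi)&0\end{pmatrix}$, $\gamma(\xi)v=\xi\times v$. $\mathcal{P}$ is the orthogonal projection onto $\ker(L_{maxwell})=\{f:\hat f(\xi)\in\operatorname{span}\{(0,\xi),(\xi,0)\},\ \xi\ne0\}$. *)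

theory Defs
  imports "HOL-Analysis.Analysis"
begin

text \<open>Fields (E,B) with values in C^3 x C^3 (= C^6); space variable x in R^3.\<close>
type_synonym field6 = "(complex^3) \<times> (complex^3)"

definition L2fun :: "(real^3 \<Rightarrow> complex) \<Rightarrow> bool" where
  "L2fun f \<longleftrightarrow> f \<in> borel_measurable lborel \<and> integrable lborel (\<lambda>x. (cmod (f x))^2)"

definition FT1 :: "(real^3 \<Rightarrow> complex) \<Rightarrow> real^3 \<Rightarrow> complex" where
  "FT1 \<phi> x = (\<integral>\<xi>. exp (- \<i> * complex_of_real (x \<bullet> \<xi>)) * \<phi> \<xi> \<partial>lborel)"

text \<open>g is (a representative of) the L^2 (Plancherel) Fourier transform of f,
  characterized by duality against all test functions in L^1 \<inter> L^2.\<close>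
definition is_FT :: "(real^3 \<Rightarrow> complex) \<Rightarrow> (real^3 \<Rightarrow> complex) \<Rightarrow> bool" where
  "is_FT f g \<longleftrightarrow> L2fun f \<and> L2fun g \<and>
     (\<forall>\<phi>. integrable lborel \<phi> \<and> integrable lborel (\<lambda>\<xi>. (cmod (\<phi> \<xi>))^2) \<longrightarrow>
        (\<integral>\<xi>. g \<xi> * \<phi> \<xi> \<partial>lborel) = (\<integral>x. f x * FT1 \<phi> x \<partial>lborel))"

definition is_FT6 :: "(real^3 \<Rightarrow> field6) \<Rightarrow> (real^3 \<Rightarrow> field6) \<Rightarrow> bool" where
  "is_FT6 F G \<longleftrightarrow> (\<forall>i. is_FT (\<lambda>x. fst (F x) $ i) (\<lambda>\<xi>. fst (G \<xi>) $ i) \<and>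
                        is_FT (\<lambda>x. snd (F x) $ i) (\<lambda>\<xi>. snd (G \<xi>) $ i))"

definition ccross :: "real^3 \<Rightarrow> complex^3 \<Rightarrow> complex^3" where
  "ccross \<xi> v = vector [of_real (\<xi>$2) * v$3 - of_real (\<xi>$3) * v$2,
                        of_real (\<xi>$3) * v$1 - of_real (\<xi>$1) * v$3,
                        of_real (\<xi>$1) * v$2 - of_real (\<xi>$2) * v$1]"

definition maxwell_symbol :: "real^3 \<Rightarrow> field6 \<Rightarrow> field6" where
  "maxwell_symbol \<xi> w = (- ccross \<xi> (snd w), ccross \<xi> (fst w))"

definition cscale6 :: "complex \<Rightarrow> field6 \<Rightarrow> field6" where
  "cscale6 c w = (c *s fst w, c *s snd w)"

definition cinner6 :: "field6 \<Rightarrow> field6 \<Rightarrow> complex" where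
  "cinner6 w z = (\<Sum>i\<in>UNIV. fst w $ i * cnj (fst z $ i)) + (\<Sum>i\<in>UNIV. snd w $ i * cnj (snd z $ i))"

text \<open>v(xi,t) = exp(-i t M(xi)) u0hat(xi): the unique solution of the Fourier-side
  equation i d/dt v = M(xi) v with v(xi,0) = u0hat(xi).\<close>
definition maxwell_fourier_flow :: "(real^3 \<Rightarrow> field6) \<Rightarrow> (real^3 \<Rightarrow> real \<Rightarrow> field6) \<Rightarrow> bool" where
  "maxwell_fourier_flow u0hat v \<longleftrightarrow>
     (\<forall>\<xi>. v \<xi> 0 = u0hat \<xi> \<and>
        (\<forall>t. ((\<lambda>\<tau>. v \<xi> \<tau>) has_vector_derivative
               cscale6 (- \<i>) (maxwell_symbol \<xi> (v \<xi> t))) (at t)))"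

definition in_ker_maxwell :: "(real^3 \<Rightarrow> field6) \<Rightarrow> bool" where
  "in_ker_maxwell f \<longleftrightarrow> (\<exists>fhat. is_FT6 f fhat \<and>
     (AE \<xi> in lborel. \<exists>a b::complex.
        fhat \<xi> = (\<chi> i. a * of_real (\<xi>$i), \<chi> i. b * of_real (\<xi>$i))))"

definition in_range_I_minus_P :: "(real^3 \<Rightarrow> field6) \<Rightarrow> bool" where
  "in_range_I_minus_P u0 \<longleftrightarrow> (\<exists>g. is_FT6 u0 g) \<and>
     (\<forall>f. in_ker_maxwell f \<longrightarrow> (\<integral>x. cinner6 (u0 x) (f x) \<partial>lborel) = 0)"

end

theory Submission
  imports Defs "HOL-Probability.Characteristic_Functions"
begin

text \<open>
  In physical space the flow is the Maxwell system E_t = curl B, B_t = - curl E, and orthogonality to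
  the kernel means div E = div B = 0. The Poynting vector P = E x B then satisfies
  d/dt P_i = - sum_j d_j T_ij with the stress tensor T_ij = (|E|^2 + |B|^2)/2 delta_ij - E_i E_j - B_i B_j.
  Testing this with the bounded radial field X(x) = x p(x), where y = 1 + |x|^2 and
  p = 2s y^(-1/2) - y^(-s), gives d/dt (P . X) = T : DX up to a divergence. The profile p is decreasing
  in |x| and satisfies p + |x|^2 q >= (2s - 1) y^(-s), where d_j p = x_j q; hence
  T : DX >= (2s - 1) y^(-s) (|E|^2 + |B|^2)/2, while |P . X| <= s (|E|^2 + |B|^2). Integration over
  [-T, T] x R^3 and conservation of energy give the estimate.
  To have classical solutions, u0hat is truncated to bounded frequencies and values; Plancherel's theorem
  and Fatou's lemma remove the truncation.
\<close>

section \<open>Translations in Lebesgue space\<close>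

text \<open>The statement defines the transform by duality with test functions in L1 and L2, and
  ties \<open>u\<close> to the data only through its transform at each single time; neither joint
  measurability nor differentiability of \<open>u\<close> is given. Plancherel's theorem is
  therefore derived for this very notion, by Gaussian summation. The truncation is the indicator of
  a set of frequencies read off from the data at time 0, so it commutes with the flow.

  The two terms of p have separate tasks. With r = |x|, the radial derivative of -r y^(-s) is (2s -
  1) y^(-s) - 2s y^(-s-1): its first term is the desired weight, positive because s > 1/2. The
  radial derivative 2s y^(-3/2) of 2s r y^(-1/2) absorbs the second term, since s + 1 > 3/2, and
  that field stays bounded by 2s.

  In physical space the system has real coefficients, so real and imaginary parts are estimated
  separately. The constant 8s/(2s - 1) is 2s/(2s - 1) from the multiplier, doubled for the two end
  times and doubled again when the truncation is removed.\<close>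

lemma
  fixes f :: "'a::euclidean_space \<Rightarrow> 'b::{banach, second_countable_topology}"
  assumes c: "c \<noteq> 0" and f: "integrable lborel f"
  shows lborel_integrable_affine: "integrable lborel (\<lambda>x. f (t + c *\<^sub>R x))"
    and lborel_integral_affine: "(\<integral>x. f x \<partial>lborel) = \<bar>c\<bar> ^ DIM('a) *\<^sub>R (\<integral>x. f (t + c *\<^sub>R x) \<partial>lborel)"
proof -
  have [measurable]: "f \<in> borel_measurable borel" using f by auto
  have L: "lborel = density (distr lborel borel (\<lambda>x::'a. t + c *\<^sub>R x)) (\<lambda>_. \<bar>c\<bar> ^ DIM('a))"
    using lborel_affine[OF c, of t] by simp
  have "integrable (density (distr lborel borel (\<lambda>x::'a. t + c *\<^sub>R x)) (\<lambda>_. \<bar>c\<bar> ^ DIM('a))) f"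
    using f by (subst L[symmetric])
  then have *: "integrable lborel (\<lambda>x. \<bar>c\<bar> ^ DIM('a) *\<^sub>R f (t + c *\<^sub>R x))"
    by (subst (asm) integrable_density) (auto simp: integrable_distr_eq)
  from integrable_scaleR_right[OF this, of "inverse (\<bar>c\<bar> ^ DIM('a))"]
  show i: "integrable lborel (\<lambda>x. f (t + c *\<^sub>R x))"
    using c by simp
  have "(\<integral>x. f x \<partial>lborel) = (\<integral>x. f x \<partial>(density (distr lborel borel (\<lambda>x::'a. t + c *\<^sub>R x)) (\<lambda>_. \<bar>c\<bar> ^ DIM('a))))"
    by (subst L[symmetric]) simp
  also have "\<dots> = \<bar>c\<bar> ^ DIM('a) *\<^sub>R (\<integral>x. f (t + c *\<^sub>R x) \<partial>lborel)"
    using i by (subst integral_density) (auto simp: integral_distr)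
  finally show "(\<integral>x. f x \<partial>lborel) = \<bar>c\<bar> ^ DIM('a) *\<^sub>R (\<integral>x. f (t + c *\<^sub>R x) \<partial>lborel)" .
qed

lemma
  fixes f :: "'a::euclidean_space \<Rightarrow> 'b::{banach, second_countable_topology}"
  assumes f: "integrable lborel f"
  shows lborel_integrable_translate: "integrable lborel (\<lambda>x. f (x + t))"
    and lborel_integral_translate: "(\<integral>x. f (x + t) \<partial>lborel) = (\<integral>x. f x \<partial>lborel)"
  using lborel_integrable_affine[OF _ f, of 1 t] lborel_integral_affine[OF _ f, of 1 t]
  by (simp_all add: add.commute)

text \<open>Indicators satisfy |a - b| = a + b - 2ab, so only the product of the shifted and the
  unshifted indicator has to converge. Openness gives this pointwise on \<open>U\<close>, and off
  \<open>U\<close> the product vanishes; the measure of the boundary of \<open>U\<close> does not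
  matter.\<close>

lemma open_translation_L1_continuous:
  fixes U :: "'a::euclidean_space set"
  assumes U: "open U" "emeasure lborel U < \<infinity>" and h: "h \<longlonglongrightarrow> 0"
  shows "(\<lambda>n. \<integral>x. \<bar>indicator U (x + h n) - indicator U x\<bar> \<partial>lborel) \<longlonglongrightarrow> (0::real)"
proof -
  have [measurable]: "U \<in> sets borel" using U by auto
  have iU: "integrable lborel (indicator U :: 'a \<Rightarrow> real)" using U by simp
  have iUh: "integrable lborel (\<lambda>x. indicator U (x + h n) :: real)" for n
    by (rule lborel_integrable_translate[OF iU])
  have iP: "integrable lborel (\<lambda>x. indicator U (x + h n) * indicator U x :: real)" for n
    by (rule Bochner_Integration.integrable_bound[OF iU]) (auto simp: indicator_def)
  have lim: "(\<lambda>n. \<integral>x. indicator U (x + h n) * indicator U x \<partial>lborel) \<longlonglongrightarrow> (\<integral>x. indicator U x \<partial>lborel :: real)"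
  proof (rule integral_dominated_convergence[OF _ _ iU])
    show "AE x in lborel. (\<lambda>n. indicator U (x + h n) * indicator U x :: real) \<longlonglongrightarrow> indicator U x"
    proof (rule AE_I2)
      fix x
      show "(\<lambda>n. indicator U (x + h n) * indicator U x :: real) \<longlonglongrightarrow> indicator U x"
      proof (cases "x \<in> U")
        case True
        have "(\<lambda>n. x + h n) \<longlonglongrightarrow> x + 0" by (intro tendsto_intros h)
        then have "eventually (\<lambda>n. x + h n \<in> U) sequentially"
          using True U(1) by (simp add: topological_tendstoD)
        then show ?thesis
          using True by (intro tendsto_eventually) (auto elim: eventually_mono)
      qed simp
    qed
  qed (auto simp: indicator_def)
  have "(\<integral>x. \<bar>indicator U (x + h n) - indicator U x\<bar> \<partial>lborel)
      = 2 * (\<integral>x. indicator U x \<partial>lborel) - 2 * (\<integral>x. indicator U (x + h n) * indicator U x \<partial>lborel :: real)" for n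
  proof -
    have "(\<integral>x. \<bar>indicator U (x + h n) - indicator U x\<bar> \<partial>lborel)
        = (\<integral>x. indicator U (x + h n) + indicator U x - 2 * (indicator U (x + h n) * indicator U x) \<partial>lborel :: real)"
      by (intro Bochner_Integration.integral_cong) (auto simp: indicator_def)
    also have "\<dots> = (\<integral>x. indicator U (x + h n) \<partial>lborel) + (\<integral>x. indicator U x \<partial>lborel)
        - 2 * (\<integral>x. indicator U (x + h n) * indicator U x \<partial>lborel :: real)"
      using iU iUh[of n] iP[of n] by simp
    also have "(\<integral>x. indicator U (x + h n) \<partial>lborel :: real) = (\<integral>x. indicator U x \<partial>lborel)"
      by (rule lborel_integral_translate[OF iU])
    finally show ?thesis by simp
  qed
  moreover have "(\<lambda>n. 2 * (\<integral>x. indicator U x \<partial>lborel) - 2 * (\<integral>x. indicator U (x + h n) * indicator U x \<partial>lborel :: real))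
    \<longlonglongrightarrow> 2 * (\<integral>x. indicator U x \<partial>lborel) - 2 * (\<integral>x. indicator U x \<partial>lborel)"
    by (intro tendsto_intros lim)
  ultimately show ?thesis by simp
qed

text \<open>Outer regularity reduces this to open sets. The excess \<open>U - A\<close> is charged
  twice, once shifted and once not, so measure below r/4 leaves r/2 for the open set.\<close>

lemma set_translation_L1_continuous:
  fixes A :: "'a::euclidean_space set"
  assumes A: "A \<in> sets lborel" "emeasure lborel A < \<infinity>" and h: "h \<longlonglongrightarrow> 0"
  shows "(\<lambda>n. \<integral>x. \<bar>indicator A (x + h n) - indicator A x\<bar> \<partial>lborel) \<longlonglongrightarrow> (0::real)"
proof (rule LIMSEQ_I)
  fix r :: real assume r: "0 < r"
  have [measurable]: "A \<in> sets borel" using A by auto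
  have "A \<in> sets lebesgue" using A by auto
  from sets_lebesgue_outer_open[OF this, of "r/4"] r
  obtain U where U: "open U" "A \<subseteq> U" "emeasure lebesgue (U - A) < ennreal (r/4)" by auto
  have [measurable]: "U \<in> sets borel" using U by auto
  have D: "emeasure lborel (U - A) < ennreal (r/4)" using U(3) by (subst (asm) emeasure_completion) auto
  have "emeasure lborel U \<le> emeasure lborel (U - A) + emeasure lborel A"
    using U by (subst plus_emeasure) (auto intro!: emeasure_mono)
  also have "\<dots> < \<infinity>" using D A
    by (metis ennreal_add_eq_top ennreal_less_top infinity_ennreal_def less_top order_less_trans)
  finally have Ufin: "emeasure lborel U < \<infinity>" .
  let ?D = "\<lambda>x. indicator (U - A) x :: real"
  have iD: "integrable lborel ?D"
    using less_trans[OF D ennreal_less_top] by simp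
  have mD: "(\<integral>x. ?D x \<partial>lborel) < r/4"
  proof -
    have "emeasure lborel (U - A) \<noteq> top" using less_trans[OF D ennreal_less_top] by auto
    from D[unfolded emeasure_eq_ennreal_measure[OF this]] r show ?thesis
      by (simp add: ennreal_less_iff)
  qed
  from LIMSEQ_D[OF open_translation_L1_continuous[OF U(1) Ufin h], of "r/2"] r
  obtain N where N: "\<And>n. n \<ge> N \<Longrightarrow> (\<integral>x. \<bar>indicator U (x + h n) - indicator U x :: real\<bar> \<partial>lborel) < r/2"
    by fastforce
  show "\<exists>no. \<forall>n\<ge>no. norm ((\<integral>x. \<bar>indicator A (x + h n) - indicator A x\<bar> \<partial>lborel) - (0::real)) < r"
  proof (intro exI allI impI)
    fix n assume n: "N \<le> n"
    have iU: "integrable lborel (indicator U :: 'a \<Rightarrow> real)" using Ufin by simp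
    have iA: "integrable lborel (indicator A :: 'a \<Rightarrow> real)" using A by simp
    note i = iU iA iD iU[THEN lborel_integrable_translate] iA[THEN lborel_integrable_translate] iD[THEN lborel_integrable_translate]
    have "(\<integral>x. \<bar>indicator A (x + h n) - indicator A x :: real\<bar> \<partial>lborel)
      \<le> (\<integral>x. \<bar>indicator U (x + h n) - indicator U x\<bar> + (?D (x + h n) + ?D x) \<partial>lborel)"
    proof (rule integral_mono)
      show "\<bar>indicator A (x + h n) - indicator A x :: real\<bar> \<le> \<bar>indicator U (x + h n) - indicator U x\<bar> + (?D (x + h n) + ?D x)" for x
        using U(2) by (auto simp: indicator_def)
    qed (use i in auto)
    also have "\<dots> = (\<integral>x. \<bar>indicator U (x + h n) - indicator U x :: real\<bar> \<partial>lborel) + ((\<integral>x. ?D (x + h n) \<partial>lborel) + (\<integral>x. ?D x \<partial>lborel))"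
    proof -
      have a: "integrable lborel (\<lambda>x. \<bar>indicator U (x + h n) - indicator U x :: real\<bar>)" using i by auto
      show ?thesis
        by (subst Bochner_Integration.integral_add[OF a], use i in \<open>auto simp del: integral_indicator\<close>)
    qed
    also have "(\<integral>x. ?D (x + h n) \<partial>lborel) = (\<integral>x. ?D x \<partial>lborel)" by (rule lborel_integral_translate[OF iD])
    finally show "norm ((\<integral>x. \<bar>indicator A (x + h n) - indicator A x\<bar> \<partial>lborel) - (0::real)) < r"
      using N[OF n] mD by simp
  qed
qed

lemma L1_translation_le:
  fixes f :: "'a::euclidean_space \<Rightarrow> 'b::{banach, second_countable_topology}"
  assumes i: "integrable lborel f"
  shows "(\<integral>x. norm (f (x + h) - f x) \<partial>lborel) \<le> 2 * (\<integral>x. norm (f x) \<partial>lborel)"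
proof -
  note it = lborel_integrable_translate[OF i, of h]
  have "(\<integral>x. norm (f (x + h) - f x) \<partial>lborel) \<le> (\<integral>x. norm (f (x + h)) + norm (f x) \<partial>lborel)"
    by (rule integral_mono) (use it i in \<open>auto intro: norm_triangle_ineq4\<close>)
  also have "\<dots> = (\<integral>x. norm (f (x + h)) \<partial>lborel) + (\<integral>x. norm (f x) \<partial>lborel)"
    using it i by simp
  also have "(\<integral>x. norm (f (x + h)) \<partial>lborel) = (\<integral>x. norm (f x) \<partial>lborel)"
    using lborel_integral_translate[OF integrable_norm[OF i], of h] by simp
  finally show ?thesis by simp
qed

text \<open>A density argument, run through \<open>integrable_induct\<close>. The limit case is a
  three-term estimate in which translation invariance makes the shifted error equal to the unshifted
  one.\<close>

lemma L1_translation_continuous: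
  fixes f :: "'a::euclidean_space \<Rightarrow> 'b::{banach, second_countable_topology}"
  assumes f: "integrable lborel f" and h: "h \<longlonglongrightarrow> 0"
  shows "(\<lambda>n. \<integral>x. norm (f (x + h n) - f x) \<partial>lborel) \<longlonglongrightarrow> 0"
  using f
proof (induction rule: integrable_induct)
  case (base A c)
  have "(\<integral>x. norm (indicator A (x + h n) *\<^sub>R c - indicator A x *\<^sub>R c) \<partial>lborel)
     = (\<integral>x. \<bar>indicator A (x + h n) - indicator A x\<bar> \<partial>lborel) * norm c" for n
    by (simp add: scaleR_left_diff_distrib[symmetric])
  moreover have "(\<lambda>n. (\<integral>x. \<bar>indicator A (x + h n) - indicator A x\<bar> \<partial>lborel) * norm c) \<longlonglongrightarrow> 0 * norm c"
    by (intro tendsto_intros set_translation_L1_continuous base h)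
  ultimately show ?case by simp
next
  case (add f g)
  note i = add.hyps add.hyps[THEN lborel_integrable_translate]
  have lim: "(\<lambda>n. (\<integral>x. norm (f (x + h n) - f x) \<partial>lborel) + (\<integral>x. norm (g (x + h n) - g x) \<partial>lborel)) \<longlonglongrightarrow> 0"
    using tendsto_add[OF add.IH] by simp
  have "(\<integral>x. norm (f (x + h n) + g (x + h n) - (f x + g x)) \<partial>lborel)
     \<le> (\<integral>x. norm (f (x + h n) - f x) \<partial>lborel) + (\<integral>x. norm (g (x + h n) - g x) \<partial>lborel)" for n
  proof (subst Bochner_Integration.integral_add[symmetric])
    show "(\<integral>x. norm (f (x + h n) + g (x + h n) - (f x + g x)) \<partial>lborel)
        \<le> (\<integral>x. norm (f (x + h n) - f x) + norm (g (x + h n) - g x) \<partial>lborel)"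
      by (rule integral_mono) (use i in \<open>auto simp: norm_diff_triangle_ineq\<close>)
  qed (use i in auto)
  then show ?case
    by (intro tendsto_sandwich[OF _ _ tendsto_const lim]) auto
next
  case (lim f s)
  \<comment> \<open>The induction rule supplies approximants with
    \<open>norm (s i x) \<le> 2 * norm (f x)\<close>; adding \<open>norm (f x)\<close> for the
    difference gives the factor 3.\<close>
  have conv: "(\<lambda>i. \<integral>x. norm (s i x - f x) \<partial>lborel) \<longlonglongrightarrow> (\<integral>x. 0 \<partial>(lborel::'a measure))"
  proof (rule integral_dominated_convergence[where w="\<lambda>x. 3 * norm (f x)"])
    show "AE x in lborel. (\<lambda>i. norm (s i x - f x)) \<longlonglongrightarrow> 0"
      using lim.hyps(2) by (intro AE_I2) (auto simp: tendsto_norm_zero_iff LIM_zero_iff)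
    show "AE x in lborel. norm (norm (s i x - f x)) \<le> 3 * norm (f x)" for i
    proof (rule AE_I2)
      fix x :: 'a
      show "norm (norm (s i x - f x)) \<le> 3 * norm (f x)"
        using lim.hyps(3)[of x i] norm_triangle_ineq4[of "s i x" "f x"] by simp
    qed
  qed (use lim.hyps(1,4) in auto)
  show ?case
  proof (rule LIMSEQ_I)
    fix r :: real assume r: "0 < r"
    obtain i where i: "(\<integral>x. norm (s i x - f x) \<partial>lborel) < r/3"
      using LIMSEQ_D[OF conv, of "r/3"] r by fastforce
    obtain N where N: "\<And>n. n \<ge> N \<Longrightarrow> (\<integral>x. norm (s i (x + h n) - s i x) \<partial>lborel) < r/3"
      using LIMSEQ_D[OF lim.IH[of i], of "r/3"] r by fastforce
    show "\<exists>no. \<forall>n\<ge>no. norm ((\<integral>x. norm (f (x + h n) - f x) \<partial>lborel) - 0) < r"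
    proof (intro exI allI impI)
      fix n assume n: "N \<le> n"
      note I = lim.hyps(1)[of i] lim.hyps(4) lim.hyps(1)[of i, THEN lborel_integrable_translate] lim.hyps(4)[THEN lborel_integrable_translate]
      let ?d = "\<lambda>x. norm (s i x - f x)"
      have di: "integrable lborel ?d" using I by auto
      have "(\<integral>x. norm (f (x + h n) - f x) \<partial>lborel) \<le> (\<integral>x. norm (s i (x + h n) - s i x) + (?d (x + h n) + ?d x) \<partial>lborel)"
      proof (rule integral_mono)
        fix x
        have eq: "f (x + h n) - f x = (s i (x + h n) - s i x) + ((s i x - f x) - (s i (x + h n) - f (x + h n)))"
          by simp
        show "norm (f (x + h n) - f x) \<le> norm (s i (x + h n) - s i x) + (?d (x + h n) + ?d x)"
          unfolding eq using norm_triangle_ineq[of "s i (x + h n) - s i x" "(s i x - f x) - (s i (x + h n) - f (x + h n))"]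
            norm_triangle_ineq4[of "s i x - f x" "s i (x + h n) - f (x + h n)"] by linarith
      qed (use I in auto)
      also have "\<dots> = (\<integral>x. norm (s i (x + h n) - s i x) \<partial>lborel) + ((\<integral>x. ?d (x + h n) \<partial>lborel) + (\<integral>x. ?d x \<partial>lborel))"
        using I di di[THEN lborel_integrable_translate] by simp
      also have "(\<integral>x. ?d (x + h n) \<partial>lborel) = (\<integral>x. ?d x \<partial>lborel)" by (rule lborel_integral_translate[OF di])
      finally show "norm ((\<integral>x. norm (f (x + h n) - f x) \<partial>lborel) - 0) < r"
        using N[OF n] i by simp
    qed
  qed
qed

section \<open>Gaussian regularization\<close>

text \<open>Reduces Gaussian integrals over a Euclidean space to the line, where moments and
  characteristic function of the normal law are known.\<close>

lemma
  fixes g :: "'a::euclidean_space \<Rightarrow> real \<Rightarrow> 'b::{real_normed_field, banach, second_countable_topology}"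
  assumes g: "\<And>b. b \<in> Basis \<Longrightarrow> integrable lborel (g b)"
  shows lborel_integrable_prod_Basis: "integrable lborel (\<lambda>x. \<Prod>b\<in>Basis. g b (x \<bullet> b))"
    and lborel_integral_prod_Basis: "(\<integral>x. (\<Prod>b\<in>Basis. g b (x \<bullet> b)) \<partial>lborel) = (\<Prod>b\<in>Basis. \<integral>y. g b y \<partial>lborel)"
proof -
  interpret product_sigma_finite "\<lambda>_::'a. lborel :: real measure" ..
  have [measurable]: "b \<in> Basis \<Longrightarrow> g b \<in> borel_measurable borel" for b using g[of b] by auto
  have m: "(\<lambda>x. \<Prod>b\<in>Basis. g b (x \<bullet> b)) \<in> borel_measurable borel" by measurable
  have eq: "(\<Prod>b\<in>Basis. g b ((\<Sum>c\<in>Basis. f c *\<^sub>R c) \<bullet> b)) = (\<Prod>b\<in>Basis. g b (f b))" for f :: "'a \<Rightarrow> real"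
    by (intro prod.cong refl arg_cong2[where f=g]) (simp add: inner_sum_left inner_Basis if_distrib cong: if_cong)
  show "integrable lborel (\<lambda>x. \<Prod>b\<in>Basis. g b (x \<bullet> b))"
    apply (subst lborel_eq)
    apply (subst integrable_distr_eq)
      apply measurable
    unfolding eq by (rule product_integrable_prod) (auto intro: g)
  show "(\<integral>x. (\<Prod>b\<in>Basis. g b (x \<bullet> b)) \<partial>lborel) = (\<Prod>b\<in>Basis. \<integral>y. g b y \<partial>lborel)"
    apply (subst lborel_eq)
    apply (subst integral_distr)
      apply measurable
    unfolding eq by (rule product_integral_prod) (auto intro: g)
qed

text \<open>Written as a product over the basis, not in closed form, so that its mass and its
  transform factor into one-dimensional integrals.\<close>

definition gauss :: "'a::euclidean_space \<Rightarrow> real" where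
  "gauss z = (\<Prod>b\<in>Basis. std_normal_density (z \<bullet> b))"

lemma norm_sq_Basis: "(norm (z::'a::euclidean_space))\<^sup>2 = (\<Sum>b\<in>Basis. (z \<bullet> b)\<^sup>2)"
  by (subst power2_norm_eq_inner, subst euclidean_inner) (simp add: power2_eq_square)

lemma gauss_eq: "gauss (z::'a::euclidean_space) = exp (- (norm z)\<^sup>2 / 2) / sqrt (2 * pi) ^ DIM('a)"
  by (simp add: gauss_def std_normal_density_def norm_sq_Basis prod_dividef exp_sum
        sum_negf[symmetric] sum_divide_distrib)

lemma gauss_pos: "gauss z > 0"
  by (simp add: gauss_eq)

lemma gauss_nonneg[simp]: "0 \<le> gauss z" "\<bar>gauss z\<bar> = gauss z"
  using gauss_pos[of z] by simp_all

lemma borel_measurable_gauss[measurable]: "gauss \<in> borel_measurable borel"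
  unfolding gauss_eq[abs_def] by measurable

lemma has_bochner_integral_gauss: "has_bochner_integral lborel (gauss :: 'a::euclidean_space \<Rightarrow> real) 1"
proof -
  have i: "integrable lborel std_normal_density" "(\<integral>x. std_normal_density x \<partial>lborel) = 1"
    using integrable_std_normal_moment[of 0] integral_std_normal_moment_even[of 0] by simp_all
  show ?thesis
    using lborel_integrable_prod_Basis[of "\<lambda>_::'a. std_normal_density"]
      lborel_integral_prod_Basis[of "\<lambda>_::'a. std_normal_density"] i
    unfolding has_bochner_integral_iff gauss_def[abs_def] by simp
qed

lemmas integrable_gauss = has_bochner_integral_gauss[unfolded has_bochner_integral_iff, THEN conjunct1]
lemmas integral_gauss = has_bochner_integral_gauss[unfolded has_bochner_integral_iff, THEN conjunct2]

text \<open>Each coordinate contributes the characteristic function of the standard normal law,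
  taken at \<open>-(a \<bullet> b)\<close> because of the sign in the Fourier kernel.\<close>

lemma fourier_gauss:
  fixes a :: "'a::euclidean_space"
  shows "(\<integral>z. exp (- \<i> * complex_of_real (a \<bullet> z)) * complex_of_real (gauss z) \<partial>lborel)
    = complex_of_real (exp (- (norm a)\<^sup>2 / 2))"
proof -
  define g where "g = (\<lambda>(b::'a) y. exp (- \<i> * complex_of_real ((a \<bullet> b) * y)) * complex_of_real (std_normal_density y))"
  have i0: "integrable lborel std_normal_density"
    using integrable_std_normal_moment[of 0] by simp
  have ig: "integrable lborel (g b)" for b
    unfolding g_def
    by (rule Bochner_Integration.integrable_bound[OF i0]) (auto simp: norm_mult)
  have vg: "(\<integral>y. g b y \<partial>lborel) = complex_of_real (exp (- ((a \<bullet> b)\<^sup>2) / 2))" for b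
  proof -
    have "char std_normal_distribution (-(a \<bullet> b)) = (\<integral>y. std_normal_density y *\<^sub>R iexp (-(a \<bullet> b) * y) \<partial>lborel)"
      unfolding char_def by (subst integral_density) auto
    also have "\<dots> = (\<integral>y. g b y \<partial>lborel)"
      unfolding g_def by (intro Bochner_Integration.integral_cong) (auto simp: scaleR_conv_of_real mult_ac)
    finally show ?thesis by (simp add: char_std_normal_distribution)
  qed
  have eq: "exp (- \<i> * complex_of_real (a \<bullet> z)) * complex_of_real (gauss z) = (\<Prod>b\<in>Basis. g b (z \<bullet> b))" for z
    by (simp add: g_def gauss_def prod.distrib exp_sum[symmetric] euclidean_inner[of a z] sum_distrib_left sum_negf)
  show ?thesis
    unfolding eq lborel_integral_prod_Basis[OF ig] vg
    by (simp add: norm_sq_Basis exp_sum[symmetric] sum_negf sum_divide_distrib flip: of_real_prod)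
qed

lemma integrable_pair_mult:
  fixes f :: "'a::euclidean_space \<Rightarrow> real" and g :: "'b::euclidean_space \<Rightarrow> real"
  assumes "integrable lborel f" "integrable lborel g"
  shows "integrable (lborel \<Otimes>\<^sub>M lborel) (\<lambda>(x, y). f x * g y)"
proof -
  have [measurable]: "f \<in> borel_measurable borel" "g \<in> borel_measurable borel" using assms by auto
  show ?thesis
    by (rule lborel_pair.Fubini_integrable) (use assms in \<open>auto simp: abs_mult\<close>)
qed

lemma integrable_pair_bound:
  fixes f :: "'a::euclidean_space \<Rightarrow> real" and g :: "'b::euclidean_space \<Rightarrow> real"
    and F :: "'a \<times> 'b \<Rightarrow> 'c::{banach, second_countable_topology}"
  assumes "integrable lborel f" "integrable lborel g" and "F \<in> borel_measurable (lborel \<Otimes>\<^sub>M lborel)"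
    and "\<And>x y. norm (F (x, y)) \<le> f x * g y"
  shows "integrable (lborel \<Otimes>\<^sub>M lborel) F"
  by (rule Bochner_Integration.integrable_bound[OF integrable_pair_mult[OF assms(1,2)]])
     (use assms(3,4) in \<open>auto intro!: AE_I2 order_trans[OF assms(4)]\<close>)

section \<open>The Fourier integral on L1\<close>

lemma norm_cis_inner: "norm (exp (- \<i> * complex_of_real r)) = 1"
  by (simp add: norm_exp_eq_Re)

lemma borel_measurable_cnj[measurable]:
  "f \<in> borel_measurable M \<Longrightarrow> (\<lambda>x. cnj (f x)) \<in> borel_measurable M"
  by (rule borel_measurable_continuous_on[where f=cnj]) (auto intro: continuous_intros)

lemma integrable_FT1:
  assumes "integrable lborel \<phi>"
  shows "integrable lborel (\<lambda>\<xi>. exp (- \<i> * complex_of_real (x \<bullet> \<xi>)) * \<phi> \<xi>)"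
  using assms by (intro Bochner_Integration.integrable_bound[OF assms]) (auto simp: norm_mult norm_cis_inner)

lemma norm_FT1_le:
  assumes "integrable lborel \<phi>"
  shows "cmod (FT1 \<phi> x) \<le> (\<integral>\<xi>. cmod (\<phi> \<xi>) \<partial>lborel)"
  unfolding FT1_def
  by (rule order_trans[OF integral_norm_bound]) (simp add: norm_mult norm_cis_inner)

lemma borel_measurable_FT1[measurable]:
  assumes [measurable]: "\<phi> \<in> borel_measurable borel"
  shows "FT1 \<phi> \<in> borel_measurable borel"
  unfolding FT1_def[abs_def] by measurable

lemma cnj_FT1: "cnj (FT1 \<phi> x) = FT1 (\<lambda>\<xi>. cnj (\<phi> \<xi>)) (- x)"
  unfolding FT1_def by (subst Bochner_Integration.integral_cnj[symmetric]) (simp add: exp_cnj)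

lemma FT1_cmult: "FT1 (\<lambda>\<xi>. c * \<phi> \<xi>) x = c * FT1 \<phi> x"
  unfolding FT1_def by (simp add: mult.left_commute)

text \<open>The kernel is symmetric in the two variables, so Fubini moves the transform from one
  factor to the other. This is the same duality that defines \<open>is_FT\<close>.\<close>

lemma FT1_multiplication:
  assumes f: "integrable lborel f" and g: "integrable lborel g"
  shows "(\<integral>x. FT1 f x * g x \<partial>lborel) = (\<integral>x. f x * FT1 g x \<partial>lborel)"
proof -
  have [measurable]: "f \<in> borel_measurable borel" "g \<in> borel_measurable borel" using f g by auto
  define F where "F = (\<lambda>x \<xi>. exp (- \<i> * complex_of_real (x \<bullet> \<xi>)) * f \<xi> * g x)"
  have "integrable (lborel \<Otimes>\<^sub>M lborel) (case_prod F)"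
    by (rule integrable_pair_bound[OF integrable_norm[OF g] integrable_norm[OF f]])
       (auto simp: F_def norm_mult norm_cis_inner mult.commute)
  from lborel_pair.Fubini_integral[OF this]
  have "(\<integral>\<xi>. (\<integral>x. F x \<xi> \<partial>lborel) \<partial>lborel) = (\<integral>x. (\<integral>\<xi>. F x \<xi> \<partial>lborel) \<partial>lborel)" .
  moreover have "(\<integral>\<xi>. F x \<xi> \<partial>lborel) = FT1 f x * g x" for x
    unfolding F_def FT1_def by simp
  moreover have "(\<integral>x. F x \<xi> \<partial>lborel) = f \<xi> * FT1 g \<xi>" for \<xi>
  proof -
    have "F x \<xi> = f \<xi> * (exp (- \<i> * complex_of_real (\<xi> \<bullet> x)) * g x)" for x
      by (simp add: F_def inner_commute mult_ac)
    then show ?thesis unfolding FT1_def by simp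
  qed
  ultimately show ?thesis by simp
qed

text \<open>Convolution with a Gaussian of width \<open>\<delta>\<close>, in the rescaled variable:
  the weight \<open>gauss z\<close> does not depend on \<open>\<delta>\<close>, which suits
  dominated convergence in \<open>z\<close>.\<close>

definition mollify :: "real \<Rightarrow> (real^3 \<Rightarrow> complex) \<Rightarrow> real^3 \<Rightarrow> complex" where
  "mollify \<delta> \<psi> \<xi> = (\<integral>z. complex_of_real (gauss z) * \<psi> (\<xi> - \<delta> *\<^sub>R z) \<partial>lborel)"

text \<open>The summability factor in physical space; its transform is a multiple of the convolution
  kernel behind \<open>mollify\<close>.\<close>

definition damp :: "real \<Rightarrow> real^3 \<Rightarrow> real" where
  "damp \<delta> x = exp (- (norm (\<delta> *\<^sub>R x))\<^sup>2 / 2)"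

lemma borel_measurable_damp[measurable]: "damp \<delta> \<in> borel_measurable borel"
  unfolding damp_def[abs_def] by measurable

lemma damp_eq_gauss: "damp \<delta> x = sqrt (2 * pi) ^ 3 * gauss (\<delta> *\<^sub>R x)"
  by (simp add: damp_def gauss_eq)

lemma damp_bounds[simp]: "0 < damp \<delta> x" "0 \<le> damp \<delta> x" "damp \<delta> x \<le> 1"
  by (simp_all add: damp_def)

lemma integrable_damp:
  assumes "\<delta> > 0"
  shows "integrable lborel (damp \<delta>)"
  using lborel_integrable_affine[OF _ integrable_gauss, of \<delta> "0::real^3"] assms
  by (simp add: damp_eq_gauss[abs_def])

lemma two_pi_cube: "sqrt (2 * pi) ^ 3 * sqrt (2 * pi) ^ 3 = (2 * pi) ^ 3"
  by (metis power_mult_distrib real_sqrt_mult_self abs_of_nonneg mult_nonneg_nonneg pi_ge_zero zero_le_numeral)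

text \<open>One factor \<open>sqrt (2 * pi) ^ 3\<close> is the normalisation of \<open>gauss\<close>
  inside \<open>damp\<close>, the other arises when the transformed exponential is written as
  \<open>gauss\<close> again.\<close>

lemma FT1_damp:
  assumes "\<delta> > 0"
  shows "FT1 (\<lambda>x. complex_of_real (damp \<delta> x)) a = complex_of_real ((2 * pi) ^ 3 / \<delta> ^ 3 * gauss ((1/\<delta>) *\<^sub>R a))"
proof -
  have i: "integrable lborel (\<lambda>x. complex_of_real (damp \<delta> x))"
    using integrable_damp[OF assms] by simp
  have "FT1 (\<lambda>x. complex_of_real (damp \<delta> x)) a
     = \<bar>1/\<delta>\<bar> ^ DIM(real^3) *\<^sub>R (\<integral>z. exp (- \<i> * complex_of_real (a \<bullet> (0 + (1/\<delta>) *\<^sub>R z))) * complex_of_real (damp \<delta> (0 + (1/\<delta>) *\<^sub>R z)) \<partial>lborel)"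
    unfolding FT1_def using assms
    by (intro lborel_integral_affine integrable_FT1 i) auto
  also have "\<dots> = (1/\<delta>) ^ 3 *\<^sub>R (\<integral>z. sqrt (2 * pi) ^ 3 * (exp (- \<i> * complex_of_real (((1/\<delta>) *\<^sub>R a) \<bullet> z)) * complex_of_real (gauss z)) \<partial>lborel)"
    using assms by (simp add: damp_eq_gauss mult_ac)
  also have "\<dots> = complex_of_real ((1/\<delta>) ^ 3 * (sqrt (2 * pi) ^ 3 * exp (- (norm ((1/\<delta>) *\<^sub>R a))\<^sup>2 / 2)))"
    by (subst integral_mult_right_zero, subst fourier_gauss) (simp add: scaleR_conv_of_real)
  also have "exp (- (norm ((1/\<delta>) *\<^sub>R a))\<^sup>2 / 2) = sqrt (2 * pi) ^ 3 * gauss ((1/\<delta>) *\<^sub>R a)"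
    by (simp add: gauss_eq)
  also have "(1/\<delta>) ^ 3 * (sqrt (2 * pi) ^ 3 * (sqrt (2 * pi) ^ 3 * gauss ((1/\<delta>) *\<^sub>R a)))
    = (2 * pi) ^ 3 / \<delta> ^ 3 * gauss ((1/\<delta>) *\<^sub>R a)"
    unfolding two_pi_cube[symmetric] by (simp add: power_one_over)
  finally show ?thesis .
qed

text \<open>Regularised Fourier inversion. \<open>FT1 \<psi>\<close> need not be integrable; the
  damping makes the double integral absolutely convergent, and Fubini then turns damping in space
  into smoothing in frequency.\<close>

lemma FT1_damp_FT1:
  assumes \<delta>: "\<delta> > 0" and \<psi>: "integrable lborel \<psi>"
  shows "FT1 (\<lambda>x. complex_of_real (damp \<delta> x) * FT1 \<psi> (- x)) \<xi> = (2 * pi) ^ 3 * mollify \<delta> \<psi> \<xi>"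
proof -
  have [measurable]: "\<psi> \<in> borel_measurable borel" using \<psi> by auto
  define F where "F = (\<lambda>x \<eta>. exp (- \<i> * complex_of_real (x \<bullet> (\<xi> - \<eta>))) * complex_of_real (damp \<delta> x) * \<psi> \<eta>)"
  have "integrable (lborel \<Otimes>\<^sub>M lborel) (case_prod F)"
    by (rule integrable_pair_bound[OF integrable_damp[OF \<delta>] integrable_norm[OF \<psi>]])
       (auto simp: F_def norm_mult norm_cis_inner damp_bounds less_imp_le)
  from lborel_pair.Fubini_integral[OF this]
  have fub: "(\<integral>\<eta>. (\<integral>x. F x \<eta> \<partial>lborel) \<partial>lborel) = (\<integral>x. (\<integral>\<eta>. F x \<eta> \<partial>lborel) \<partial>lborel)" .
  have 1: "(\<integral>\<eta>. F x \<eta> \<partial>lborel) = exp (- \<i> * complex_of_real (\<xi> \<bullet> x)) * (complex_of_real (damp \<delta> x) * FT1 \<psi> (- x))" for x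
  proof -
    have "F x \<eta> = exp (- \<i> * complex_of_real (\<xi> \<bullet> x)) * (complex_of_real (damp \<delta> x) * (exp (- \<i> * complex_of_real ((- x) \<bullet> \<eta>)) * \<psi> \<eta>))" for \<eta>
      by (simp add: F_def inner_diff_right exp_diff inner_commute exp_minus field_simps)
    then show ?thesis unfolding FT1_def by simp
  qed
  have 2: "(\<integral>x. F x \<eta> \<partial>lborel) = complex_of_real ((2 * pi) ^ 3 / \<delta> ^ 3 * gauss ((1/\<delta>) *\<^sub>R (\<xi> - \<eta>))) * \<psi> \<eta>" for \<eta>
  proof -
    have "(\<integral>x. F x \<eta> \<partial>lborel) = FT1 (\<lambda>x. complex_of_real (damp \<delta> x)) (\<xi> - \<eta>) * \<psi> \<eta>"
      unfolding F_def FT1_def by (simp add: inner_commute)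
    then show ?thesis by (simp add: FT1_damp[OF \<delta>])
  qed
  have gb: "gauss z \<le> 1 / sqrt (2 * pi) ^ 3" for z :: "real^3"
    by (simp add: gauss_eq divide_right_mono)
  let ?H = "\<lambda>\<eta>. complex_of_real (gauss ((1/\<delta>) *\<^sub>R (\<xi> - \<eta>))) * \<psi> \<eta>"
  have iH: "integrable lborel ?H"
  proof (rule Bochner_Integration.integrable_bound[OF integrable_mult_right[OF integrable_norm[OF \<psi>], of "1 / sqrt (2 * pi) ^ 3"]])
    show "AE \<eta> in lborel. norm (?H \<eta>) \<le> norm (1 / sqrt (2 * pi) ^ 3 * cmod (\<psi> \<eta>))"
      using gb gauss_pos[where 'a="real^3"]
      by (intro AE_I2) (auto simp: norm_mult less_imp_le abs_mult simp del: times_divide_eq_left intro!: mult_right_mono)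
  qed measurable
  have "FT1 (\<lambda>x. complex_of_real (damp \<delta> x) * FT1 \<psi> (- x)) \<xi> = (\<integral>\<eta>. complex_of_real ((2 * pi) ^ 3 / \<delta> ^ 3 * gauss ((1/\<delta>) *\<^sub>R (\<xi> - \<eta>))) * \<psi> \<eta> \<partial>lborel)"
    using fub unfolding 1 2 by (subst FT1_def) simp
  also have "\<dots> = (\<integral>\<eta>. complex_of_real ((2 * pi) ^ 3 / \<delta> ^ 3) * ?H \<eta> \<partial>lborel)"
    by (simp add: mult_ac)
  also have "\<dots> = complex_of_real ((2 * pi) ^ 3 / \<delta> ^ 3) * (\<integral>\<eta>. ?H \<eta> \<partial>lborel)"
    by (rule integral_mult_right_zero)
  \<comment> \<open>Substitution of \<open>\<xi> - \<delta> *\<^sub>R z\<close> for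
    \<open>\<eta>\<close>; its Jacobian \<open>\<delta> ^ 3\<close> cancels the normalisation of the
    kernel.\<close>
  also have "(\<integral>\<eta>. ?H \<eta> \<partial>lborel) = \<delta> ^ 3 *\<^sub>R (\<integral>z. ?H (\<xi> + (-\<delta>) *\<^sub>R z) \<partial>lborel)"
    using lborel_integral_affine[OF _ iH, of "-\<delta>" \<xi>] \<delta> by simp
  also have "(\<integral>z. ?H (\<xi> + (-\<delta>) *\<^sub>R z) \<partial>lborel) = mollify \<delta> \<psi> \<xi>"
    unfolding mollify_def using \<delta> by simp
  finally show ?thesis using \<delta> by (simp add: scaleR_conv_of_real)
qed

section \<open>Square-integrable functions\<close>

definition sqint :: "('a::euclidean_space \<Rightarrow> complex) \<Rightarrow> real" where
  "sqint f = (\<integral>x. (cmod (f x))\<^sup>2 \<partial>lborel)"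

definition sq_integrable :: "('a::euclidean_space \<Rightarrow> complex) \<Rightarrow> bool" where
  "sq_integrable f \<longleftrightarrow> f \<in> borel_measurable borel \<and> integrable lborel (\<lambda>x. (cmod (f x))\<^sup>2)"

lemma L2fun_iff: "L2fun f \<longleftrightarrow> sq_integrable f"
  by (simp add: L2fun_def sq_integrable_def)

lemma sqint_nonneg: "0 \<le> sqint f"
  by (simp add: sqint_def)

lemma sq_integrableD:
  assumes "sq_integrable f"
  shows "f \<in> borel_measurable borel" "integrable lborel (\<lambda>x. (cmod (f x))\<^sup>2)"
  using assms by (auto simp: sq_integrable_def)

lemma two_mult_le_squares: "2 * (a * b) \<le> a\<^sup>2 + (b::real)\<^sup>2"
  using sum_squares_bound[of a b] by simp

lemma abs_mult_le_squares: "\<bar>a * b\<bar> \<le> a\<^sup>2 + (b::real)\<^sup>2"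
  using two_mult_le_squares[of "\<bar>a\<bar>" "\<bar>b\<bar>"] zero_le_power2[of a] zero_le_power2[of b]
  unfolding power2_abs abs_mult by linarith

lemma sq_integrable_mult:
  assumes f: "sq_integrable f" and g: "sq_integrable g"
  shows "integrable lborel (\<lambda>x. f x * g x)"
proof (rule Bochner_Integration.integrable_bound)
  show "integrable lborel (\<lambda>x. (cmod (f x))\<^sup>2 + (cmod (g x))\<^sup>2)"
    using f g by (auto simp: sq_integrable_def)
  show "(\<lambda>x. f x * g x) \<in> borel_measurable lborel"
    using f g by (auto simp: sq_integrable_def)
  show "AE x in lborel. norm (f x * g x) \<le> norm ((cmod (f x))\<^sup>2 + (cmod (g x))\<^sup>2)"
    using abs_mult_le_squares[of "cmod (f x)" "cmod (g x)" for x]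
    by (intro AE_I2) (simp add: norm_mult)
qed

lemma sq_integrable_diff:
  assumes f: "sq_integrable f" and g: "sq_integrable g"
  shows "sq_integrable (\<lambda>x. f x - g x)"
  unfolding sq_integrable_def
proof
  show "(\<lambda>x. f x - g x) \<in> borel_measurable borel"
    using f g by (auto simp: sq_integrable_def)
  have [measurable]: "f \<in> borel_measurable borel" "g \<in> borel_measurable borel"
    using f g by (auto simp: sq_integrable_def)
  show "integrable lborel (\<lambda>x. (cmod (f x - g x))\<^sup>2)"
  proof (rule Bochner_Integration.integrable_bound)
    show "integrable lborel (\<lambda>x. 2 * (cmod (f x))\<^sup>2 + 2 * (cmod (g x))\<^sup>2)"
      using f g by (auto simp: sq_integrable_def)
    show "AE x in lborel. norm ((cmod (f x - g x))\<^sup>2) \<le> norm (2 * (cmod (f x))\<^sup>2 + 2 * (cmod (g x))\<^sup>2)"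
    proof (rule AE_I2)
      fix x
      have "(cmod (f x - g x))\<^sup>2 \<le> (cmod (f x) + cmod (g x))\<^sup>2"
        by (intro power_mono norm_triangle_ineq4) simp
      also have "\<dots> \<le> 2 * (cmod (f x))\<^sup>2 + 2 * (cmod (g x))\<^sup>2"
        using two_mult_le_squares[of "cmod (f x)" "cmod (g x)"] by (simp add: power2_sum)
      finally show "norm ((cmod (f x - g x))\<^sup>2) \<le> norm (2 * (cmod (f x))\<^sup>2 + 2 * (cmod (g x))\<^sup>2)" by simp
    qed
  qed measurable
qed

lemma sq_integrable_cmult:
  assumes "sq_integrable f"
  shows "sq_integrable (\<lambda>x. c * f x)"
  using assms by (auto simp: sq_integrable_def norm_mult power_mult_distrib)

lemma sqint_cmult: "sqint (\<lambda>x. c * f x) = (cmod c)\<^sup>2 * sqint f"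
  by (simp add: sqint_def norm_mult power_mult_distrib)

lemma L2_Cauchy_Schwarz:
  assumes f: "sq_integrable f" and g: "sq_integrable g"
  shows "cmod (\<integral>x. f x * g x \<partial>lborel) \<le> sqrt (sqint f) * sqrt (sqint g)"
proof -
  have [measurable]: "f \<in> borel_measurable borel" "g \<in> borel_measurable borel"
    using f g by (auto simp: sq_integrable_def)
  have I: "integrable lborel (\<lambda>x. cmod (f x) * cmod (g x))"
    using integrable_norm[OF sq_integrable_mult[OF f g]] by (simp add: norm_mult)
  define J where "J = (\<integral>x. cmod (f x) * cmod (g x) \<partial>lborel)"
  have J0: "0 \<le> J" by (simp add: J_def)
  have "(\<integral>\<^sup>+x. ennreal (cmod (f x)) * ennreal (cmod (g x)) \<partial>lborel)\<^sup>2
     \<le> (\<integral>\<^sup>+x. (ennreal (cmod (f x)))\<^sup>2 \<partial>lborel) * (\<integral>\<^sup>+x. (ennreal (cmod (g x)))\<^sup>2 \<partial>lborel)"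
    by (rule Cauchy_Schwarz_nn_integral) auto
  also have "(\<integral>\<^sup>+x. ennreal (cmod (f x)) * ennreal (cmod (g x)) \<partial>lborel) = ennreal J"
    unfolding J_def using I by (subst nn_integral_eq_integral[symmetric]) (auto simp: ennreal_mult)
  also have "(\<integral>\<^sup>+x. (ennreal (cmod (f x)))\<^sup>2 \<partial>lborel) = ennreal (sqint f)"
    unfolding sqint_def using sq_integrableD[OF f] by (subst nn_integral_eq_integral[symmetric]) (auto simp: ennreal_power)
  also have "(\<integral>\<^sup>+x. (ennreal (cmod (g x)))\<^sup>2 \<partial>lborel) = ennreal (sqint g)"
    unfolding sqint_def using sq_integrableD[OF g] by (subst nn_integral_eq_integral[symmetric]) (auto simp: ennreal_power)
  finally have "J\<^sup>2 \<le> sqint f * sqint g"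
    using J0 by (simp add: ennreal_power sqint_nonneg ennreal_mult[symmetric] ennreal_le_iff)
  then have "J \<le> sqrt (sqint f * sqint g)"
    by (simp add: real_le_rsqrt)
  moreover have "cmod (\<integral>x. f x * g x \<partial>lborel) \<le> J"
    unfolding J_def by (rule order_trans[OF integral_norm_bound]) (simp add: norm_mult)
  ultimately show ?thesis by (simp add: real_sqrt_mult)
qed

text \<open>Interpolation between L1 and bounded functions. It upgrades L1 convergence of
  mollifications of bounded functions to L2 convergence, so continuity of translations is needed in
  L1 only.\<close>

lemma sq_integrable_bounded:
  fixes \<psi> :: "'a::euclidean_space \<Rightarrow> complex"
  assumes i: "integrable lborel \<psi>" and b: "\<And>\<xi>. cmod (\<psi> \<xi>) \<le> M"
  shows "sq_integrable \<psi>" and "sqint \<psi> \<le> M * (\<integral>\<xi>. cmod (\<psi> \<xi>) \<partial>lborel)"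
proof -
  have [measurable]: "\<psi> \<in> borel_measurable borel" using i by auto
  have *: "(cmod (\<psi> \<xi>))\<^sup>2 \<le> M * cmod (\<psi> \<xi>)" for \<xi>
    using b[of \<xi>] by (simp add: power2_eq_square mult_right_mono)
  have iM: "integrable lborel (\<lambda>\<xi>. M * cmod (\<psi> \<xi>))" using i by auto
  show "sq_integrable \<psi>"
    unfolding sq_integrable_def
  proof
    show "integrable lborel (\<lambda>x. (cmod (\<psi> x))\<^sup>2)"
      by (rule Bochner_Integration.integrable_bound[OF iM]) (use order_trans[OF * abs_ge_self] in auto)
  qed measurable
  then show "sqint \<psi> \<le> M * (\<integral>\<xi>. cmod (\<psi> \<xi>) \<partial>lborel)"
    unfolding sqint_def integral_mult_right_zero[symmetric]
    by (intro integral_mono iM *) (auto simp: sq_integrable_def)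
qed

section \<open>Convergence of the Gaussian mollification\<close>

lemma borel_measurable_mollify[measurable]:
  assumes [measurable]: "\<psi> \<in> borel_measurable borel"
  shows "mollify \<delta> \<psi> \<in> borel_measurable borel"
  unfolding mollify_def[abs_def] by measurable

text \<open>Because \<open>gauss\<close> has mass one, the difference is a Gaussian average of
  \<open>\<psi> (\<xi> - \<delta> *\<^sub>R z) - \<psi> \<xi>\<close>. The L1 estimate is
  Minkowski's integral inequality, obtained from Fubini, and reduces convergence to the L1 modulus
  of continuity under translation.\<close>

lemma
  assumes i: "integrable lborel \<psi>" and b: "\<And>\<xi>. cmod (\<psi> \<xi>) \<le> M"
  shows mollify_diff_integrable: "integrable lborel (\<lambda>\<xi>. mollify \<delta> \<psi> \<xi> - \<psi> \<xi>)"
    and mollify_diff_bound: "cmod (mollify \<delta> \<psi> \<xi> - \<psi> \<xi>) \<le> 2 * M"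
    and mollify_L1_bound: "(\<integral>\<xi>. cmod (mollify \<delta> \<psi> \<xi> - \<psi> \<xi>) \<partial>lborel)
      \<le> (\<integral>z. gauss z * (\<integral>\<xi>. cmod (\<psi> (\<xi> - \<delta> *\<^sub>R z) - \<psi> \<xi>) \<partial>lborel) \<partial>lborel)"
proof -
  have [measurable]: "\<psi> \<in> borel_measurable borel" using i by auto
  have M0: "0 \<le> M" using b[of 0] norm_ge_zero order_trans by blast
  define F where "F = (\<lambda>z \<xi>. complex_of_real (gauss z) * (\<psi> (\<xi> - \<delta> *\<^sub>R z) - \<psi> \<xi>))"
  have [measurable]: "case_prod F \<in> borel_measurable (borel \<Otimes>\<^sub>M borel)"
    unfolding F_def by measurable
  have ig: "integrable lborel (\<lambda>z::real^3. 2 * M * gauss z)" using integrable_gauss by auto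
  have bF: "cmod (F z \<xi>) \<le> 2 * M * gauss z" for z \<xi>
  proof -
    have "cmod (\<psi> (\<xi> - \<delta> *\<^sub>R z) - \<psi> \<xi>) \<le> M + M"
      by (rule order_trans[OF norm_triangle_ineq4]) (intro add_mono b)
    then have "gauss z * cmod (\<psi> (\<xi> - \<delta> *\<^sub>R z) - \<psi> \<xi>) \<le> gauss z * (2 * M)"
      using gauss_pos[of z] by (intro mult_left_mono) auto
    then show ?thesis using gauss_pos[of z] by (simp add: F_def norm_mult mult_ac)
  qed
  have iz: "integrable lborel (\<lambda>z. F z \<xi>)" for \<xi>
    by (rule Bochner_Integration.integrable_bound[OF ig])
       (use bF M0 gauss_pos in \<open>auto intro!: AE_I2 simp: abs_mult less_imp_le\<close>)
  have im: "integrable lborel (\<lambda>z. complex_of_real (gauss z) * \<psi> \<xi>)" for \<xi> :: "real^3"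
    by (intro integrable_mult_left integrable_of_real integrable_gauss)
  have eq: "mollify \<delta> \<psi> \<xi> - \<psi> \<xi> = (\<integral>z. F z \<xi> \<partial>lborel)" for \<xi>
  proof -
    have "(\<integral>z. F z \<xi> + complex_of_real (gauss z) * \<psi> \<xi> \<partial>lborel)
       = (\<integral>z. F z \<xi> \<partial>lborel) + (\<integral>z. complex_of_real (gauss z) * \<psi> \<xi> \<partial>(lborel :: (real^3) measure))"
      by (rule Bochner_Integration.integral_add[OF iz im])
    moreover have "(\<integral>z. F z \<xi> + complex_of_real (gauss z) * \<psi> \<xi> \<partial>lborel) = mollify \<delta> \<psi> \<xi>"
      unfolding mollify_def F_def by (simp add: algebra_simps)
    moreover have "(\<integral>z. complex_of_real (gauss z) * \<psi> \<xi> \<partial>(lborel :: (real^3) measure)) = \<psi> \<xi>"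
      using integral_gauss[where 'a="real^3"] by simp
    ultimately show ?thesis by auto
  qed
  show "cmod (mollify \<delta> \<psi> \<xi> - \<psi> \<xi>) \<le> 2 * M"
  proof -
    have "cmod (\<integral>z. F z \<xi> \<partial>lborel) \<le> (\<integral>z. 2 * M * gauss z \<partial>(lborel :: (real^3) measure))"
      by (rule order_trans[OF integral_norm_bound integral_mono])
         (use iz ig bF in auto)
    then show ?thesis using integral_gauss[where 'a="real^3"] by (simp add: eq)
  qed
  let ?w = "\<lambda>z. \<integral>\<xi>. cmod (\<psi> (\<xi> - \<delta> *\<^sub>R z) - \<psi> \<xi>) \<partial>lborel"
  have it: "integrable lborel (\<lambda>\<xi>. \<psi> (\<xi> - \<delta> *\<^sub>R z))" for z
    using lborel_integrable_translate[OF i, of "- \<delta> *\<^sub>R z"] by simp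
  have wF: "(\<integral>\<xi>. norm (F z \<xi>) \<partial>lborel) = gauss z * ?w z" for z
    using gauss_pos[of z] by (simp add: F_def norm_mult)
  have w_le: "?w z \<le> 2 * (\<integral>\<xi>. cmod (\<psi> \<xi>) \<partial>lborel)" for z
    using L1_translation_le[OF i, of "- \<delta> *\<^sub>R z"] by simp
  have iw: "integrable lborel (\<lambda>z. gauss z * ?w z)"
  proof (rule Bochner_Integration.integrable_bound)
    show "integrable lborel (\<lambda>z::real^3. gauss z * (2 * (\<integral>\<xi>. cmod (\<psi> \<xi>) \<partial>lborel)))"
      using integrable_gauss by auto
    show "AE z in lborel. norm (gauss z * ?w z) \<le> norm (gauss z * (2 * (\<integral>\<xi>. cmod (\<psi> \<xi>) \<partial>lborel)))"
      using w_le gauss_pos by (intro AE_I2) (auto simp: abs_mult intro!: mult_left_mono)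
  qed measurable
  have pF: "integrable (lborel \<Otimes>\<^sub>M lborel) (case_prod F)"
  proof (rule lborel_pair.Fubini_integrable)
    show "integrable lborel (\<lambda>z. \<integral>\<xi>. norm (case (z, \<xi>) of (z, \<xi>) \<Rightarrow> F z \<xi>) \<partial>lborel)"
      using iw by (simp add: wF)
    show "AE z in lborel. integrable lborel (\<lambda>\<xi>. case (z, \<xi>) of (z, \<xi>) \<Rightarrow> F z \<xi>)"
      using it i by (auto simp: F_def)
  qed simp
  show "integrable lborel (\<lambda>\<xi>. mollify \<delta> \<psi> \<xi> - \<psi> \<xi>)"
    unfolding eq using lborel_pair.integrable_snd[OF pF] by simp
  have pN: "integrable (lborel \<Otimes>\<^sub>M lborel) (case_prod (\<lambda>z \<xi>. norm (F z \<xi>)))"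
    using integrable_norm[OF pF] by (simp add: case_prod_beta')
  have "(\<integral>\<xi>. cmod (\<integral>z. F z \<xi> \<partial>lborel) \<partial>lborel) \<le> (\<integral>\<xi>. (\<integral>z. norm (F z \<xi>) \<partial>lborel) \<partial>lborel)"
    by (rule integral_mono)
       (use lborel_pair.integrable_snd[OF pF] lborel_pair.integrable_snd[OF pN] in auto)
  also have "\<dots> = (\<integral>z. (\<integral>\<xi>. norm (F z \<xi>) \<partial>lborel) \<partial>lborel)"
    by (rule lborel_pair.Fubini_integral[OF pN])
  finally show "(\<integral>\<xi>. cmod (mollify \<delta> \<psi> \<xi> - \<psi> \<xi>) \<partial>lborel) \<le> (\<integral>z. gauss z * ?w z \<partial>lborel)"
    unfolding eq wF .
qed

text \<open>For each fixed \<open>z\<close> the translation modulus tends to 0, and it never exceeds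
  twice the L1 norm; dominated convergence in \<open>z\<close> against \<open>gauss\<close>
  concludes.\<close>

lemma mollify_L1_tendsto:
  assumes i: "integrable lborel \<psi>" and b: "\<And>\<xi>. cmod (\<psi> \<xi>) \<le> M" and d: "d \<longlonglongrightarrow> 0"
  shows "(\<lambda>n. \<integral>\<xi>. cmod (mollify (d n) \<psi> \<xi> - \<psi> \<xi>) \<partial>lborel) \<longlonglongrightarrow> 0"
proof -
  have [measurable]: "\<psi> \<in> borel_measurable borel" using i by auto
  let ?w = "\<lambda>h. \<integral>\<xi>. cmod (\<psi> (\<xi> + h) - \<psi> \<xi>) \<partial>lborel"
  have w_le: "?w h \<le> 2 * (\<integral>\<xi>. cmod (\<psi> \<xi>) \<partial>lborel)" for h
    by (rule L1_translation_le[OF i])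
  have "(\<lambda>n. \<integral>z. gauss z * ?w (- d n *\<^sub>R z) \<partial>lborel) \<longlonglongrightarrow> (\<integral>z. 0 \<partial>(lborel :: (real^3) measure))"
  proof (rule integral_dominated_convergence)
    show "integrable lborel (\<lambda>z::real^3. gauss z * (2 * (\<integral>\<xi>. cmod (\<psi> \<xi>) \<partial>lborel)))"
      using integrable_gauss by auto
    show "AE z in lborel. norm (gauss z * ?w (- d n *\<^sub>R z)) \<le> gauss z * (2 * (\<integral>\<xi>. cmod (\<psi> \<xi>) \<partial>lborel))" for n
      using w_le gauss_pos by (intro AE_I2) (auto simp: abs_mult less_imp_le simp del: scaleR_minus_left intro!: mult_left_mono)
    show "AE z in lborel. (\<lambda>n. gauss z * ?w (- d n *\<^sub>R z)) \<longlonglongrightarrow> 0"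
    proof (rule AE_I2)
      fix z :: "real^3"
      have "(\<lambda>n. - d n *\<^sub>R z) \<longlonglongrightarrow> - 0 *\<^sub>R z"
        by (intro tendsto_intros d)
      then have "(\<lambda>n. - d n *\<^sub>R z) \<longlonglongrightarrow> 0" by simp
      from L1_translation_continuous[OF i this]
      show "(\<lambda>n. gauss z * ?w (- d n *\<^sub>R z)) \<longlonglongrightarrow> 0"
        by (intro tendsto_mult_right_zero)
    qed
  qed measurable
  then have lim: "(\<lambda>n. \<integral>z. gauss z * ?w (- d n *\<^sub>R z) \<partial>lborel) \<longlonglongrightarrow> 0" by simp
  have "(\<integral>\<xi>. cmod (mollify (d n) \<psi> \<xi> - \<psi> \<xi>) \<partial>lborel) \<le> (\<integral>z. gauss z * ?w (- d n *\<^sub>R z) \<partial>lborel)" for n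
    using mollify_L1_bound[OF i b, of "d n"] by simp
  then show ?thesis
    by (intro tendsto_sandwich[OF _ _ tendsto_const lim]) auto
qed

lemma sq_integrable_mollify:
  assumes i: "integrable lborel \<psi>" and b: "\<And>\<xi>. cmod (\<psi> \<xi>) \<le> M"
  shows "sq_integrable (mollify \<delta> \<psi>)"
proof -
  have "sq_integrable (\<lambda>\<xi>. (mollify \<delta> \<psi> \<xi> - \<psi> \<xi>) - (- 1) * \<psi> \<xi>)"
    by (intro sq_integrable_diff sq_integrable_cmult sq_integrable_bounded(1)[OF i b]
        sq_integrable_bounded(1)[OF mollify_diff_integrable[OF i b] mollify_diff_bound[OF i b]])
  then show ?thesis by simp
qed

text \<open>Cauchy-Schwarz, with the squared L2 norm of the error bounded by \<open>2 * M\<close>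
  times its L1 norm.\<close>

lemma mollify_weak_tendsto:
  assumes i: "integrable lborel \<psi>" and b: "\<And>\<xi>. cmod (\<psi> \<xi>) \<le> M" and d: "d \<longlonglongrightarrow> 0"
    and f: "sq_integrable f"
  shows "(\<lambda>n. \<integral>\<xi>. f \<xi> * mollify (d n) \<psi> \<xi> \<partial>lborel) \<longlonglongrightarrow> (\<integral>\<xi>. f \<xi> * \<psi> \<xi> \<partial>lborel)"
proof (rule LIM_zero_cancel, rule Lim_null_comparison)
  let ?D = "\<lambda>n \<xi>. mollify (d n) \<psi> \<xi> - \<psi> \<xi>"
  have sD: "sq_integrable (?D n)" and bD: "sqint (?D n) \<le> 2 * M * (\<integral>\<xi>. cmod (?D n \<xi>) \<partial>lborel)" for n
    using sq_integrable_bounded[OF mollify_diff_integrable[OF i b] mollify_diff_bound[OF i b]] by auto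
  show "\<forall>\<^sub>F n in sequentially. norm ((\<integral>\<xi>. f \<xi> * mollify (d n) \<psi> \<xi> \<partial>lborel) - (\<integral>\<xi>. f \<xi> * \<psi> \<xi> \<partial>lborel))
      \<le> sqrt (sqint f) * sqrt (2 * M * (\<integral>\<xi>. cmod (?D n \<xi>) \<partial>lborel))"
  proof (rule always_eventually, rule allI)
    fix n
    have "(\<integral>\<xi>. f \<xi> * mollify (d n) \<psi> \<xi> \<partial>lborel) - (\<integral>\<xi>. f \<xi> * \<psi> \<xi> \<partial>lborel) = (\<integral>\<xi>. f \<xi> * ?D n \<xi> \<partial>lborel)"
      unfolding right_diff_distrib
      by (rule Bochner_Integration.integral_diff[symmetric])
         (intro sq_integrable_mult f sq_integrable_mollify[OF i b] sq_integrable_bounded(1)[OF i b])+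
    also have "cmod \<dots> \<le> sqrt (sqint f) * sqrt (sqint (?D n))"
      by (rule L2_Cauchy_Schwarz[OF f sD])
    also have "\<dots> \<le> sqrt (sqint f) * sqrt (2 * M * (\<integral>\<xi>. cmod (?D n \<xi>) \<partial>lborel))"
      by (intro mult_left_mono real_sqrt_le_mono bD) (simp add: sqint_nonneg)
    finally show "norm ((\<integral>\<xi>. f \<xi> * mollify (d n) \<psi> \<xi> \<partial>lborel) - (\<integral>\<xi>. f \<xi> * \<psi> \<xi> \<partial>lborel))
      \<le> sqrt (sqint f) * sqrt (2 * M * (\<integral>\<xi>. cmod (?D n \<xi>) \<partial>lborel))" .
  qed
  have "(\<lambda>n. sqrt (sqint f) * sqrt (2 * M * (\<integral>\<xi>. cmod (?D n \<xi>) \<partial>lborel))) \<longlonglongrightarrow> sqrt (sqint f) * sqrt (2 * M * 0)"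
    by (intro tendsto_intros mollify_L1_tendsto[OF i b d])
  then show "(\<lambda>n. sqrt (sqint f) * sqrt (2 * M * (\<integral>\<xi>. cmod (?D n \<xi>) \<partial>lborel))) \<longlonglongrightarrow> 0" by simp
qed

section \<open>Plancherel identities\<close>

lemma scale_tendsto_0: "(\<lambda>n. 1 / real (Suc n)) \<longlonglongrightarrow> 0"
  using LIMSEQ_inverse_real_of_nat by (simp add: inverse_eq_divide)

lemma damp_scale_tendsto: "(\<lambda>n. damp (1 / real (Suc n)) x) \<longlonglongrightarrow> 1"
proof -
  have "(\<lambda>n. exp (- (norm ((1 / real (Suc n)) *\<^sub>R x))\<^sup>2 / 2)) \<longlonglongrightarrow> exp (- (norm (0 *\<^sub>R x))\<^sup>2 / 2)"
    by (intro tendsto_intros scale_tendsto_0) auto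
  then show ?thesis by (simp add: damp_def)
qed

text \<open>Monotonicity is what lets the damping be removed before square integrability of the
  transform is known.\<close>

lemma mono_damp_scale: "mono (\<lambda>n. damp (1 / real (Suc n)) x)"
proof (rule monoI)
  fix m n :: nat assume "m \<le> n"
  then have "norm ((1 / real (Suc n)) *\<^sub>R x) \<le> norm ((1 / real (Suc m)) *\<^sub>R x)"
    by (auto simp: frac_le intro!: divide_left_mono)
  then have "(norm ((1 / real (Suc n)) *\<^sub>R x))\<^sup>2 \<le> (norm ((1 / real (Suc m)) *\<^sub>R x))\<^sup>2"
    by (intro power_mono) auto
  then show "damp (1 / real (Suc m)) x \<le> damp (1 / real (Suc n)) x"
    unfolding damp_def by simp
qed

lemma integrable_damp_FT1:
  assumes \<delta>: "\<delta> > 0" and i: "integrable lborel \<psi>"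
  shows "integrable lborel (\<lambda>x. complex_of_real (damp \<delta> x) * FT1 \<psi> (- x))"
proof -
  have [measurable]: "\<psi> \<in> borel_measurable borel" using i by auto
  show ?thesis
  proof (rule Bochner_Integration.integrable_bound[OF integrable_mult_left[OF integrable_damp[OF \<delta>]]])
    show "AE x in lborel. norm (complex_of_real (damp \<delta> x) * FT1 \<psi> (- x)) \<le> norm (damp \<delta> x * (\<integral>\<xi>. cmod (\<psi> \<xi>) \<partial>lborel))"
      using norm_FT1_le[OF i] damp_bounds[of \<delta>]
      by (intro AE_I2) (auto simp: norm_mult abs_mult intro!: mult_left_mono)
  qed measurable
qed

text \<open>Common source of Plancherel's identity, where \<open>\<phi>\<close> is the conjugate of
  \<open>\<psi>\<close>, and of the inversion formula, where \<open>\<phi>\<close> is an arbitrary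
  test function.\<close>

lemma FT1_damp_pairing:
  assumes \<delta>: "\<delta> > 0" and \<phi>: "integrable lborel \<phi>" and \<psi>: "integrable lborel \<psi>"
  shows "(\<integral>x. FT1 \<phi> x * (complex_of_real (damp \<delta> x) * FT1 \<psi> (- x)) \<partial>lborel)
    = (2 * pi) ^ 3 * (\<integral>\<xi>. \<phi> \<xi> * mollify \<delta> \<psi> \<xi> \<partial>lborel)"
  unfolding FT1_multiplication[OF \<phi> integrable_damp_FT1[OF \<delta> \<psi>]] FT1_damp_FT1[OF \<delta> \<psi>]
  by (subst integral_mult_right_zero[symmetric]) (simp add: mult_ac)

lemma sq_integrable_reflect:
  assumes "sq_integrable f"
  shows "sq_integrable (\<lambda>x. f (- x))" and "sqint (\<lambda>x. f (- x)) = sqint f"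
  using assms lborel_integrable_affine[of "-1" "\<lambda>x. (cmod (f x))\<^sup>2" 0] lborel_integral_affine[of "-1" "\<lambda>x. (cmod (f x))\<^sup>2" 0]
  by (auto simp: sq_integrable_def sqint_def)

text \<open>Pair the damped transform with its own conjugate and let the damping tend to 1. The
  frequency side converges by mollification; on the space side monotone convergence yields
  integrability and value at once.\<close>

lemma
  assumes i: "integrable lborel \<psi>" and b: "\<And>\<xi>. cmod (\<psi> \<xi>) \<le> M"
  shows sq_integrable_FT1_bounded: "sq_integrable (FT1 \<psi>)"
    and Plancherel_bounded: "sqint (FT1 \<psi>) = (2 * pi) ^ 3 * sqint \<psi>"
proof -
  have [measurable]: "\<psi> \<in> borel_measurable borel" using i by auto
  let ?d = "\<lambda>n. 1 / real (Suc n)"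
  have sc: "sq_integrable (\<lambda>\<xi>. cnj (\<psi> \<xi>))"
    using sq_integrable_bounded(1)[OF i b] by (simp add: sq_integrable_def)
  have ic: "integrable lborel (\<lambda>\<xi>. cnj (\<psi> \<xi>))" using i by simp
  \<comment> \<open>With the conjugate as first factor the integrand is real and nonnegative, as
    monotone convergence demands.\<close>
  have eqI: "FT1 (\<lambda>\<xi>. cnj (\<psi> \<xi>)) x * (complex_of_real (damp \<delta> x) * FT1 \<psi> (- x)) = complex_of_real (damp \<delta> x * (cmod (FT1 \<psi> (- x)))\<^sup>2)" for \<delta> x
    using cnj_FT1[of \<psi> "- x"] complex_norm_square[of "FT1 \<psi> (- x)"]
    by (simp add: mult_ac del: complex_cnj)
  have P: "(\<integral>x. complex_of_real (damp (?d n) x * (cmod (FT1 \<psi> (- x)))\<^sup>2) \<partial>lborel)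
    = (2 * pi) ^ 3 * (\<integral>\<xi>. cnj (\<psi> \<xi>) * mollify (?d n) \<psi> \<xi> \<partial>lborel)" for n
    using FT1_damp_pairing[OF _ ic i, of "?d n"] unfolding eqI by simp
  have "(\<lambda>n. (2 * pi) ^ 3 * (\<integral>\<xi>. cnj (\<psi> \<xi>) * mollify (?d n) \<psi> \<xi> \<partial>lborel)) \<longlonglongrightarrow> (2 * pi) ^ 3 * (\<integral>\<xi>. cnj (\<psi> \<xi>) * \<psi> \<xi> \<partial>lborel)"
    by (intro tendsto_intros mollify_weak_tendsto[OF i b scale_tendsto_0 sc])
  also have "(\<integral>\<xi>. cnj (\<psi> \<xi>) * \<psi> \<xi> \<partial>lborel) = complex_of_real (sqint \<psi>)"
    unfolding sqint_def integral_complex_of_real[symmetric]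
    by (intro Bochner_Integration.integral_cong refl) (simp only: complex_norm_square mult.commute)
  finally have "(\<lambda>n. complex_of_real (\<integral>x. damp (?d n) x * (cmod (FT1 \<psi> (- x)))\<^sup>2 \<partial>lborel)) \<longlonglongrightarrow> complex_of_real ((2 * pi) ^ 3 * sqint \<psi>)"
    unfolding P[symmetric] integral_complex_of_real by simp
  then have lim: "(\<lambda>n. \<integral>x. damp (?d n) x * (cmod (FT1 \<psi> (- x)))\<^sup>2 \<partial>lborel) \<longlonglongrightarrow> (2 * pi) ^ 3 * sqint \<psi>"
    by (simp only: tendsto_of_real_iff)
  have ii: "integrable lborel (\<lambda>x. damp (?d n) x * (cmod (FT1 \<psi> (- x)))\<^sup>2)" for n
  proof (rule Bochner_Integration.integrable_bound[OF integrable_mult_left[OF integrable_damp[of "?d n"]]])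
    show "AE x in lborel. norm (damp (?d n) x * (cmod (FT1 \<psi> (- x)))\<^sup>2) \<le> norm (damp (?d n) x * (\<integral>\<xi>. cmod (\<psi> \<xi>) \<partial>lborel)\<^sup>2)"
      using norm_FT1_le[OF i] damp_bounds[of "?d n"]
      by (intro AE_I2) (auto simp: abs_mult intro!: mult_left_mono power_mono)
  qed (auto, measurable)
  have conv: "integrable lborel (\<lambda>x. (cmod (FT1 \<psi> (- x)))\<^sup>2)" "(\<integral>x. (cmod (FT1 \<psi> (- x)))\<^sup>2 \<partial>lborel) = (2 * pi) ^ 3 * sqint \<psi>"
  proof -
    have mono: "AE x in lborel. mono (\<lambda>n. damp (?d n) x * (cmod (FT1 \<psi> (- x)))\<^sup>2)"
      using mono_damp_scale by (intro AE_I2) (auto simp: mono_def intro!: mult_right_mono)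
    have pos: "AE x in lborel. 0 \<le> damp (?d n) x * (cmod (FT1 \<psi> (- x)))\<^sup>2" for n
      using damp_bounds by (intro AE_I2) (auto simp: less_imp_le)
    have lm: "AE x in lborel. (\<lambda>n. damp (?d n) x * (cmod (FT1 \<psi> (- x)))\<^sup>2) \<longlonglongrightarrow> (cmod (FT1 \<psi> (- x)))\<^sup>2"
    proof (rule AE_I2)
      fix x
      show "(\<lambda>n. damp (?d n) x * (cmod (FT1 \<psi> (- x)))\<^sup>2) \<longlonglongrightarrow> (cmod (FT1 \<psi> (- x)))\<^sup>2"
        using tendsto_mult_right[OF damp_scale_tendsto[of x], of "(cmod (FT1 \<psi> (- x)))\<^sup>2"] by simp
    qed
    show "integrable lborel (\<lambda>x. (cmod (FT1 \<psi> (- x)))\<^sup>2)" "(\<integral>x. (cmod (FT1 \<psi> (- x)))\<^sup>2 \<partial>lborel) = (2 * pi) ^ 3 * sqint \<psi>"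
      by (rule integral_monotone_convergence_nonneg[OF ii mono pos lm lim], measurable)+
  qed
  have s: "sq_integrable (\<lambda>x. FT1 \<psi> (- x))" "sqint (\<lambda>x. FT1 \<psi> (- x)) = (2 * pi) ^ 3 * sqint \<psi>"
    using conv by (auto simp: sq_integrable_def sqint_def)
  then show "sq_integrable (FT1 \<psi>)" "sqint (FT1 \<psi>) = (2 * pi) ^ 3 * sqint \<psi>"
    using sq_integrable_reflect[OF s(1)] by simp_all
qed

text \<open>Test functions in \<open>is_FT\<close> may be unbounded, so the bounded case is extended
  by truncating the values: the transforms converge pointwise by L1 convergence, and Fatou's lemma
  keeps the Plancherel bound.\<close>

lemma sq_integrable_FT1:
  assumes i: "integrable lborel \<phi>" and s: "integrable lborel (\<lambda>\<xi>. (cmod (\<phi> \<xi>))\<^sup>2)"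
  shows "sq_integrable (FT1 \<phi>)"
proof -
  have [measurable]: "\<phi> \<in> borel_measurable borel" using i by auto
  define c where "c n \<xi> = (if cmod (\<phi> \<xi>) \<le> real n then \<phi> \<xi> else 0)" for n \<xi>
  have [measurable]: "c n \<in> borel_measurable borel" for n
    unfolding c_def by measurable
  have ic: "integrable lborel (c n)" for n
    by (rule Bochner_Integration.integrable_bound[OF i]) (auto simp: c_def)
  have bc: "cmod (c n \<xi>) \<le> real n" for n \<xi> by (auto simp: c_def)
  have sc: "sqint (c n) \<le> sqint \<phi>" for n
    unfolding sqint_def using sq_integrable_bounded(1)[OF ic bc] s
    by (intro integral_mono) (auto simp: sq_integrable_def c_def)
  have lim: "(\<lambda>n. FT1 (c n) x) \<longlonglongrightarrow> FT1 \<phi> x" for x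
    unfolding FT1_def
  proof (rule integral_dominated_convergence[OF _ _ integrable_norm[OF i]])
    show "AE \<xi> in lborel. (\<lambda>n. exp (- \<i> * complex_of_real (x \<bullet> \<xi>)) * c n \<xi>) \<longlonglongrightarrow> exp (- \<i> * complex_of_real (x \<bullet> \<xi>)) * \<phi> \<xi>"
    proof (intro AE_I2 tendsto_mult_left tendsto_eventually)
      fix \<xi>
      obtain N where "cmod (\<phi> \<xi>) \<le> real N" using real_arch_simple by blast
      then show "\<forall>\<^sub>F n in sequentially. c n \<xi> = \<phi> \<xi>"
        by (intro eventually_sequentiallyI[of N]) (auto simp: c_def)
    qed
    show "AE \<xi> in lborel. norm (exp (- \<i> * complex_of_real (x \<bullet> \<xi>)) * c n \<xi>) \<le> cmod (\<phi> \<xi>)" for n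
      by (intro AE_I2) (auto simp: norm_mult norm_cis_inner c_def)
  qed measurable
  have "(\<integral>\<^sup>+x. ennreal ((cmod (FT1 \<phi> x))\<^sup>2) \<partial>lborel) = (\<integral>\<^sup>+x. liminf (\<lambda>n. ennreal ((cmod (FT1 (c n) x))\<^sup>2)) \<partial>lborel)"
  proof (intro nn_integral_cong)
    fix x
    have "(\<lambda>n. ennreal ((cmod (FT1 (c n) x))\<^sup>2)) \<longlonglongrightarrow> ennreal ((cmod (FT1 \<phi> x))\<^sup>2)"
      by (intro tendsto_ennrealI tendsto_intros lim)
    then show "ennreal ((cmod (FT1 \<phi> x))\<^sup>2) = liminf (\<lambda>n. ennreal ((cmod (FT1 (c n) x))\<^sup>2))"
      by (rule lim_imp_Liminf[OF trivial_limit_sequentially, symmetric])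
  qed
  also have "\<dots> \<le> liminf (\<lambda>n. \<integral>\<^sup>+x. ennreal ((cmod (FT1 (c n) x))\<^sup>2) \<partial>lborel)"
    by (rule nn_integral_liminf) measurable
  also have "\<dots> = liminf (\<lambda>n. ennreal ((2 * pi) ^ 3 * sqint (c n)))"
  proof -
    have "(\<integral>\<^sup>+x. ennreal ((cmod (FT1 (c n) x))\<^sup>2) \<partial>lborel) = ennreal ((2 * pi) ^ 3 * sqint (c n))" for n
      using sq_integrable_FT1_bounded[OF ic bc, of n] Plancherel_bounded[OF ic bc, of n]
      by (subst nn_integral_eq_integral) (auto simp: sq_integrable_def sqint_def)
    then show ?thesis by simp
  qed
  also have "\<dots> \<le> liminf (\<lambda>n::nat. ennreal ((2 * pi) ^ 3 * sqint \<phi>))"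
    by (intro Liminf_mono always_eventually allI ennreal_leI mult_left_mono sc) simp
  also have "\<dots> < \<infinity>" by (simp add: Liminf_const)
  finally have "(\<integral>\<^sup>+x. ennreal ((cmod (FT1 \<phi> x))\<^sup>2) \<partial>lborel) < \<infinity>" .
  then show ?thesis
    unfolding sq_integrable_def by (simp add: integrable_iff_bounded)
qed

text \<open>Produces physical fields with prescribed transform. It serves both the band-limited
  solutions and the elements of the kernel against which the data are tested.\<close>

lemma is_FT_inverse:
  assumes i: "integrable lborel \<psi>" and b: "\<And>\<xi>. cmod (\<psi> \<xi>) \<le> M"
  shows "is_FT (\<lambda>x. FT1 \<psi> (- x) / (2 * pi) ^ 3) \<psi>"
proof -
  have [measurable]: "\<psi> \<in> borel_measurable borel" using i by auto
  let ?d = "\<lambda>n. 1 / real (Suc n)"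
  let ?f = "\<lambda>x. FT1 \<psi> (- x)"
  have sf: "sq_integrable ?f"
    by (rule sq_integrable_reflect(1)[OF sq_integrable_FT1_bounded[OF i b]])
  have "(\<integral>\<xi>. \<psi> \<xi> * \<phi> \<xi> \<partial>lborel) = (\<integral>x. ?f x / (2 * pi) ^ 3 * FT1 \<phi> x \<partial>lborel)"
    if i\<phi>: "integrable lborel \<phi>" and s\<phi>: "integrable lborel (\<lambda>\<xi>. (cmod (\<phi> \<xi>))\<^sup>2)" for \<phi>
  proof -
    have [measurable]: "\<phi> \<in> borel_measurable borel" using i\<phi> by auto
    have sF: "sq_integrable (FT1 \<phi>)" by (rule sq_integrable_FT1[OF i\<phi> s\<phi>])
    have s: "sq_integrable \<phi>" using s\<phi> by (simp add: sq_integrable_def)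
    \<comment> \<open>The damped pairing has two limits: undamping on the space side, where the
      product of two L2 functions dominates, and mollification on the frequency side. Uniqueness of
      limits gives the inversion formula.\<close>
    have 1: "(\<lambda>n. \<integral>x. FT1 \<phi> x * (complex_of_real (damp (?d n) x) * ?f x) \<partial>lborel) \<longlonglongrightarrow> (\<integral>x. FT1 \<phi> x * ?f x \<partial>lborel)"
    proof (rule integral_dominated_convergence[OF _ _ integrable_norm[OF sq_integrable_mult[OF sF sf]]])
      show "AE x in lborel. (\<lambda>n. FT1 \<phi> x * (complex_of_real (damp (?d n) x) * ?f x)) \<longlonglongrightarrow> FT1 \<phi> x * ?f x"
      proof (rule AE_I2)
        fix x
        have "(\<lambda>n. FT1 \<phi> x * (complex_of_real (damp (?d n) x) * ?f x)) \<longlonglongrightarrow> FT1 \<phi> x * (complex_of_real 1 * ?f x)"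
          by (intro tendsto_intros damp_scale_tendsto)
        then show "(\<lambda>n. FT1 \<phi> x * (complex_of_real (damp (?d n) x) * ?f x)) \<longlonglongrightarrow> FT1 \<phi> x * ?f x" by simp
      qed
      show "AE x in lborel. norm (FT1 \<phi> x * (complex_of_real (damp (?d n) x) * ?f x)) \<le> norm (FT1 \<phi> x * ?f x)" for n
        using damp_bounds[of "?d n"]
        by (intro AE_I2) (auto simp: norm_mult intro!: mult_left_mono mult_left_le_one_le)
    qed measurable
    have "(\<lambda>n. (2 * pi) ^ 3 * (\<integral>\<xi>. \<phi> \<xi> * mollify (?d n) \<psi> \<xi> \<partial>lborel)) \<longlonglongrightarrow> (2 * pi) ^ 3 * (\<integral>\<xi>. \<phi> \<xi> * \<psi> \<xi> \<partial>lborel)"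
      by (intro tendsto_intros mollify_weak_tendsto[OF i b scale_tendsto_0 s])
    then have "(\<lambda>n. \<integral>x. FT1 \<phi> x * (complex_of_real (damp (?d n) x) * ?f x) \<partial>lborel) \<longlonglongrightarrow> (2 * pi) ^ 3 * (\<integral>\<xi>. \<phi> \<xi> * \<psi> \<xi> \<partial>lborel)"
      using FT1_damp_pairing[OF _ i\<phi> i] by simp
    from LIMSEQ_unique[OF 1 this]
    have eq: "(\<integral>x. FT1 \<phi> x * ?f x \<partial>lborel) = (2 * pi) ^ 3 * (\<integral>\<xi>. \<phi> \<xi> * \<psi> \<xi> \<partial>lborel)" .
    have "(\<integral>x. ?f x / (2 * pi) ^ 3 * FT1 \<phi> x \<partial>lborel) = (\<integral>x. (FT1 \<phi> x * ?f x) / (2 * pi) ^ 3 \<partial>lborel)"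
      by (simp add: mult.commute)
    also have "\<dots> = (\<integral>x. FT1 \<phi> x * ?f x \<partial>lborel) / (2 * pi) ^ 3"
      by (rule integral_divide_zero)
    finally show ?thesis unfolding eq by (simp add: mult.commute)
  qed
  moreover have "sq_integrable (\<lambda>x. ?f x / (2 * pi) ^ 3)"
    using sq_integrable_cmult[OF sf, of "1 / (2 * pi) ^ 3"] by simp
  ultimately show ?thesis
    unfolding is_FT_def L2fun_iff using sq_integrable_bounded(1)[OF i b] by blast
qed

text \<open>Both argument and value are truncated, so a cutoff is an admissible test function even
  if \<open>f\<close> is merely measurable, and pairing \<open>f\<close> with the conjugate of its
  cutoff gives the square of the cutoff.\<close>

definition cutoff :: "nat \<Rightarrow> (real^3 \<Rightarrow> complex) \<Rightarrow> real^3 \<Rightarrow> complex" where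
  "cutoff n f x = (if norm x \<le> real n \<and> cmod (f x) \<le> real n then f x else 0)"

lemma integrable_bounded_support:
  fixes f :: "'a::euclidean_space \<Rightarrow> 'b::{banach, second_countable_topology}"
  assumes [measurable]: "f \<in> borel_measurable borel" and "\<And>x. norm (f x) \<le> M * indicator (cball 0 R) x"
  shows "integrable lborel f"
proof (rule Bochner_Integration.integrable_bound)
  show "integrable lborel (\<lambda>x::'a. M * indicator (cball 0 R) x)"
    by (intro integrable_mult_right integrable_real_indicator emeasure_bounded_finite) auto
  show "AE x in lborel. norm (f x) \<le> norm (M * indicator (cball 0 R) x)"
    using assms(2) by (intro AE_I2) (metis abs_ge_self order_trans real_norm_def)
qed measurable

lemma
  assumes [measurable]: "f \<in> borel_measurable borel"
  shows integrable_cutoff: "integrable lborel (cutoff n f)"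
    and cutoff_le: "cmod (cutoff n f x) \<le> real n"
    and cutoff_le': "cmod (cutoff n f x) \<le> cmod (f x)"
    and borel_measurable_cutoff: "cutoff n f \<in> borel_measurable borel"
    and cutoff_mult: "f x * cnj (cutoff n f x) = complex_of_real ((cmod (cutoff n f x))\<^sup>2)"
    and cutoff_tendsto: "(\<lambda>n. cutoff n f x) \<longlonglongrightarrow> f x"
proof -
  show m: "cutoff n f \<in> borel_measurable borel"
    unfolding cutoff_def[abs_def] by measurable
  show "integrable lborel (cutoff n f)"
    by (rule integrable_bounded_support[OF m, of "real n" "real n"]) (auto simp: cutoff_def indicator_def)
  show "cmod (cutoff n f x) \<le> real n" "cmod (cutoff n f x) \<le> cmod (f x)" by (auto simp: cutoff_def)
  show "f x * cnj (cutoff n f x) = complex_of_real ((cmod (cutoff n f x))\<^sup>2)"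
    unfolding complex_norm_square by (auto simp: cutoff_def)
  obtain N where "max (norm x) (cmod (f x)) \<le> real N" using real_arch_simple by blast
  then show "(\<lambda>n. cutoff n f x) \<longlonglongrightarrow> f x"
    by (intro tendsto_eventually eventually_sequentiallyI[of N]) (auto simp: cutoff_def)
qed

lemma sqint_cutoff_tendsto:
  assumes "sq_integrable f"
  shows "(\<lambda>n. sqint (cutoff n f)) \<longlonglongrightarrow> sqint f"
proof -
  note f = sq_integrableD[OF assms]
  note [measurable] = f(1) borel_measurable_cutoff[OF f(1)]
  show ?thesis unfolding sqint_def
  proof (rule integral_dominated_convergence[OF _ _ f(2)])
    show "AE x in lborel. (\<lambda>n. (cmod (cutoff n f x))\<^sup>2) \<longlonglongrightarrow> (cmod (f x))\<^sup>2"
      by (intro AE_I2 tendsto_intros cutoff_tendsto f(1))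
    show "AE x in lborel. norm ((cmod (cutoff n f x))\<^sup>2) \<le> (cmod (f x))\<^sup>2" for n
      using cutoff_le'[OF f(1)] by (intro AE_I2) (auto intro!: power_mono)
  qed measurable
qed

text \<open>Cancels the norm of the test function that a duality argument leaves on both
  sides.\<close>

lemma le_of_le_sqrt_mult:
  assumes "0 \<le> a" "0 \<le> b" "a \<le> sqrt b * sqrt a"
  shows "a \<le> (b::real)"
proof (cases "a = 0")
  case False
  then have "sqrt a * sqrt a \<le> sqrt b * sqrt a" "sqrt a > 0" using assms by auto
  then have "sqrt a \<le> sqrt b" by (rule mult_right_le_imp_le)
  then show ?thesis by simp
qed (use assms in simp)

text \<open>The L2 norm is recovered by duality: test with the conjugate of a cutoff of
  \<open>g\<close>, apply Cauchy-Schwarz and Plancherel for the bounded test function, then let the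
  cutoff grow.\<close>

lemma is_FT_sqint_le:
  assumes "is_FT f g"
  shows "sqint g \<le> (2 * pi) ^ 3 * sqint f"
proof (rule LIMSEQ_le_const2[OF sqint_cutoff_tendsto])
  have f: "sq_integrable f" and g: "sq_integrable g"
    and eq: "\<And>\<phi>. integrable lborel \<phi> \<Longrightarrow> integrable lborel (\<lambda>\<xi>. (cmod (\<phi> \<xi>))\<^sup>2) \<Longrightarrow>
        (\<integral>\<xi>. g \<xi> * \<phi> \<xi> \<partial>lborel) = (\<integral>x. f x * FT1 \<phi> x \<partial>lborel)"
    using assms by (auto simp: is_FT_def L2fun_iff)
  show "sq_integrable g" by fact
  show "\<exists>N. \<forall>n\<ge>N. sqint (cutoff n g) \<le> (2 * pi) ^ 3 * sqint f"
  proof (intro exI allI impI)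
    fix n
    note gm = sq_integrableD(1)[OF g]
    let ?\<phi> = "\<lambda>\<xi>. cnj (cutoff n g \<xi>)"
    have i: "integrable lborel ?\<phi>" using integrable_cutoff[OF gm] by simp
    have b: "cmod (?\<phi> \<xi>) \<le> real n" for \<xi> using cutoff_le[OF gm] by simp
    have sq: "sqint ?\<phi> = sqint (cutoff n g)" by (simp add: sqint_def)
    have "complex_of_real (sqint (cutoff n g)) = (\<integral>\<xi>. g \<xi> * ?\<phi> \<xi> \<partial>lborel)"
      unfolding sqint_def cutoff_mult[OF gm] by (rule integral_complex_of_real[symmetric])
    also have "\<dots> = (\<integral>x. f x * FT1 ?\<phi> x \<partial>lborel)"
      using sq_integrable_bounded(1)[OF i b] by (intro eq i) (auto simp: sq_integrable_def)
    finally have "sqint (cutoff n g) = cmod (\<integral>x. f x * FT1 ?\<phi> x \<partial>lborel)"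
      using sqint_nonneg[of "cutoff n g"] by (metis abs_of_nonneg norm_of_real)
    also have "\<dots> \<le> sqrt (sqint f) * sqrt (sqint (FT1 ?\<phi>))"
      by (rule L2_Cauchy_Schwarz[OF f sq_integrable_FT1_bounded[OF i b]])
    also have "\<dots> = sqrt ((2 * pi) ^ 3 * sqint f) * sqrt (sqint (cutoff n g))"
      unfolding Plancherel_bounded[OF i b] sq by (simp add: real_sqrt_mult)
    finally show "sqint (cutoff n g) \<le> (2 * pi) ^ 3 * sqint f"
      by (rule le_of_le_sqrt_mult[rotated 2]) (simp_all add: sqint_nonneg)
  qed
qed

lemma inverse_square_mult: "(a::real) \<noteq> 0 \<Longrightarrow> (1 / a)\<^sup>2 * (a * b) = b / a"
  by (simp add: power2_eq_square)

text \<open>Tested with functions whose transforms are mollifications of the conjugate of a cutoff of f.\<close>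
lemma is_FT_sqint_ge:
  assumes "is_FT f g"
  shows "sqint f \<le> sqint g / (2 * pi) ^ 3"
proof (rule LIMSEQ_le_const2[OF sqint_cutoff_tendsto])
  have f: "sq_integrable f" and g: "sq_integrable g"
    and eq: "\<And>\<phi>. integrable lborel \<phi> \<Longrightarrow> integrable lborel (\<lambda>\<xi>. (cmod (\<phi> \<xi>))\<^sup>2) \<Longrightarrow>
        (\<integral>\<xi>. g \<xi> * \<phi> \<xi> \<partial>lborel) = (\<integral>x. f x * FT1 \<phi> x \<partial>lborel)"
    using assms by (auto simp: is_FT_def L2fun_iff)
  show "sq_integrable f" by fact
  show "\<exists>N. \<forall>m\<ge>N. sqint (cutoff m f) \<le> sqint g / (2 * pi) ^ 3"
  proof (intro exI allI impI)
    fix m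
    note fm = sq_integrableD(1)[OF f]
    let ?\<psi> = "\<lambda>\<xi>. cnj (cutoff m f \<xi>)"
    have i: "integrable lborel ?\<psi>" using integrable_cutoff[OF fm] by simp
    have b: "cmod (?\<psi> \<xi>) \<le> real m" for \<xi> using cutoff_le[OF fm] by simp
    have sq: "sqint ?\<psi> = sqint (cutoff m f)" by (simp add: sqint_def)
    let ?d = "\<lambda>n. 1 / real (Suc n)"
    define \<phi> where "\<phi> n \<xi> = complex_of_real (1 / (2 * pi) ^ 3) * (complex_of_real (damp (?d n) \<xi>) * FT1 ?\<psi> (- \<xi>))" for n \<xi>
    have [measurable]: "?\<psi> \<in> borel_measurable borel" by (intro borel_measurable_cnj borel_measurable_cutoff fm)
    have i\<phi>: "integrable lborel (\<phi> n)" for n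
      unfolding \<phi>_def by (intro integrable_mult_right integrable_damp_FT1 i) simp
    have le: "cmod (\<phi> n \<xi>) \<le> cmod (1 / (2 * pi) ^ 3 * FT1 ?\<psi> (- \<xi>))" for n \<xi>
      unfolding \<phi>_def norm_mult
      by (auto simp: norm_divide norm_mult norm_power intro!: divide_right_mono mult_left_le_one_le)
    have sF: "sq_integrable (\<lambda>\<xi>. 1 / (2 * pi) ^ 3 * FT1 ?\<psi> (- \<xi>))"
      by (intro sq_integrable_cmult sq_integrable_reflect(1) sq_integrable_FT1_bounded[OF i b])
    have s\<phi>: "sq_integrable (\<phi> n)" for n
      unfolding sq_integrable_def
    proof
      show "integrable lborel (\<lambda>x. (cmod (\<phi> n x))\<^sup>2)"
      proof (rule Bochner_Integration.integrable_bound[OF sq_integrableD(2)[OF sF]])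
        show "AE x in lborel. norm ((cmod (\<phi> n x))\<^sup>2) \<le> norm ((cmod (1 / (2 * pi) ^ 3 * FT1 ?\<psi> (- x)))\<^sup>2)"
          using le by (intro AE_I2) (auto simp del: norm_mult intro!: power_mono)
        show "(\<lambda>x. (cmod (\<phi> n x))\<^sup>2) \<in> borel_measurable lborel"
          using i\<phi>[of n] by measurable
      qed
    qed (use i\<phi>[of n] in auto)
    have n\<phi>: "sqint (\<phi> n) \<le> sqint (cutoff m f) / (2 * pi) ^ 3" for n
    proof -
      have "sqint (\<phi> n) \<le> sqint (\<lambda>\<xi>. 1 / (2 * pi) ^ 3 * FT1 ?\<psi> (- \<xi>))"
        unfolding sqint_def using sq_integrableD(2)[OF sF] sq_integrableD(2)[OF s\<phi>[of n]]
        by (intro integral_mono power_mono le) auto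
      also have "\<dots> = (1 / (2 * pi) ^ 3)\<^sup>2 * sqint (\<lambda>\<xi>. FT1 ?\<psi> (- \<xi>))"
        unfolding sqint_cmult by (simp add: norm_divide norm_power norm_mult)
      also have "\<dots> = sqint (cutoff m f) / (2 * pi) ^ 3"
        unfolding sq_integrable_reflect(2)[OF sq_integrable_FT1_bounded[OF i b]] Plancherel_bounded[OF i b] sq
        by (rule inverse_square_mult) simp
      finally show ?thesis .
    qed
    have FT\<phi>: "FT1 (\<phi> n) x = mollify (?d n) ?\<psi> x" for n x
      unfolding \<phi>_def FT1_cmult by (subst FT1_damp_FT1[OF _ i]) auto
    have bound: "cmod (\<integral>x. f x * mollify (?d n) ?\<psi> x \<partial>lborel) \<le> sqrt (sqint g) * sqrt (sqint (cutoff m f) / (2 * pi) ^ 3)" for n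
    proof -
      have "(\<integral>x. f x * mollify (?d n) ?\<psi> x \<partial>lborel) = (\<integral>\<xi>. g \<xi> * \<phi> n \<xi> \<partial>lborel)"
        using eq[OF i\<phi>[of n] sq_integrableD(2)[OF s\<phi>[of n]]] unfolding FT\<phi> by simp
      also have "cmod \<dots> \<le> sqrt (sqint g) * sqrt (sqint (\<phi> n))"
        by (rule L2_Cauchy_Schwarz[OF g s\<phi>])
      also have "\<dots> \<le> sqrt (sqint g) * sqrt (sqint (cutoff m f) / (2 * pi) ^ 3)"
        by (intro mult_left_mono real_sqrt_le_mono n\<phi>) (simp add: sqint_nonneg)
      finally show ?thesis .
    qed
    have lim: "(\<lambda>n. cmod (\<integral>x. f x * mollify (?d n) ?\<psi> x \<partial>lborel)) \<longlonglongrightarrow> cmod (\<integral>x. f x * ?\<psi> x \<partial>lborel)"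
      by (intro tendsto_intros mollify_weak_tendsto[OF i b scale_tendsto_0 f])
    have "(\<integral>x. f x * ?\<psi> x \<partial>lborel) = complex_of_real (sqint (cutoff m f))"
      unfolding sqint_def cutoff_mult[OF fm] by (rule integral_complex_of_real)
    then have "sqint (cutoff m f) = cmod (\<integral>x. f x * ?\<psi> x \<partial>lborel)"
      using sqint_nonneg[of "cutoff m f"] by simp
    also have "\<dots> \<le> sqrt (sqint g) * sqrt (sqint (cutoff m f) / (2 * pi) ^ 3)"
      using LIMSEQ_le_const2[OF lim] bound by blast
    also have "\<dots> = sqrt (sqint g / (2 * pi) ^ 3) * sqrt (sqint (cutoff m f))"
      by (simp add: real_sqrt_divide)
    finally show "sqint (cutoff m f) \<le> sqint g / (2 * pi) ^ 3"
      by (rule le_of_le_sqrt_mult[rotated 2]) (simp_all add: sqint_nonneg)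
  qed
qed

lemma is_FT_diff:
  assumes "is_FT f g" "is_FT f' g'"
  shows "is_FT (\<lambda>x. f x - f' x) (\<lambda>x. g x - g' x)"
proof -
  have s: "sq_integrable f" "sq_integrable g" "sq_integrable f'" "sq_integrable g'"
    using assms by (auto simp: is_FT_def L2fun_iff)
  have "(\<integral>\<xi>. (g \<xi> - g' \<xi>) * \<phi> \<xi> \<partial>lborel) = (\<integral>x. (f x - f' x) * FT1 \<phi> x \<partial>lborel)"
    if "integrable lborel \<phi>" "integrable lborel (\<lambda>\<xi>. (cmod (\<phi> \<xi>))\<^sup>2)" for \<phi>
  proof -
    have s\<phi>: "sq_integrable \<phi>" "sq_integrable (FT1 \<phi>)"
      using that by (auto simp: sq_integrable_def[of \<phi>] intro: sq_integrable_FT1)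
    show ?thesis
      using assms that unfolding left_diff_distrib
      by (subst (1 2) Bochner_Integration.integral_diff) (auto simp: is_FT_def intro!: sq_integrable_mult s s\<phi>)
  qed
  then show ?thesis
    by (simp add: is_FT_def L2fun_iff sq_integrable_diff s)
qed

section \<open>Energy flux of a real Maxwell field\<close>

text \<open>Integrate f(x + v) - f(x), the integral of f'(x + h v) over h in [0, 1], over all x.\<close>
lemma integral_directional_derivative_eq_0:
  fixes f f' :: "'a::euclidean_space \<Rightarrow> real"
  assumes f: "integrable lborel f" and f': "integrable lborel f'" and c: "continuous_on UNIV f'"
    and d: "\<And>x. ((\<lambda>h. f (x + h *\<^sub>R v)) has_real_derivative f' x) (at 0)"
  shows "(\<integral>x. f' x \<partial>lborel) = 0"
proof -
  have [measurable]: "f' \<in> borel_measurable borel" using f' by auto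
  define F where "F = (\<lambda>(h::real) x. f' (x + h *\<^sub>R v) * indicator {0..1} h)"
  have I: "(\<integral>x. f' (x + h *\<^sub>R v) \<partial>lborel) = (\<integral>x. f' x \<partial>lborel)" for h
    by (rule lborel_integral_translate[OF f'])
  have In: "(\<integral>x. \<bar>f' (x + h *\<^sub>R v)\<bar> \<partial>lborel) = (\<integral>x. \<bar>f' x\<bar> \<partial>lborel)" for h
    using lborel_integral_translate[OF integrable_norm[OF f'], of "h *\<^sub>R v"] by simp
  have i01: "integrable lborel (indicator {0..1::real} :: real \<Rightarrow> real)" by simp
  have pF: "integrable (lborel \<Otimes>\<^sub>M lborel) (case_prod F)"
  proof (rule lborel_pair.Fubini_integrable)
    show "case_prod F \<in> borel_measurable (lborel \<Otimes>\<^sub>M lborel)" unfolding F_def by measurable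
    show "integrable lborel (\<lambda>h. \<integral>x. norm (case (h, x) of (h, x) \<Rightarrow> F h x) \<partial>lborel)"
      using integrable_mult_right[OF i01, of "\<integral>x. \<bar>f' x\<bar> \<partial>lborel"] by (simp add: F_def abs_mult In)
    show "AE h in lborel. integrable lborel (\<lambda>x. case (h, x) of (h, x) \<Rightarrow> F h x)"
      using lborel_integrable_translate[OF f'] by (simp add: F_def)
  qed
  have der: "((\<lambda>k. f (x + k *\<^sub>R v)) has_real_derivative f' (x + h *\<^sub>R v)) (at h)" for x h
  proof -
    have e: "(\<lambda>k. f ((x + h *\<^sub>R v) + k *\<^sub>R v)) = (\<lambda>k. f (x + (k + h) *\<^sub>R v))"
      by (simp add: scaleR_left_distrib add_ac)
    have "((\<lambda>k. f (x + (k + h) *\<^sub>R v)) has_real_derivative f' (x + h *\<^sub>R v)) (at 0)"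
      using d[of "x + h *\<^sub>R v"] unfolding e .
    then have "((\<lambda>k. f (x + k *\<^sub>R v)) has_real_derivative f' (x + h *\<^sub>R v)) (at (0 + h))"
      by (rule DERIV_shift[THEN iffD2])
    then show ?thesis by (simp only: add_0_left)
  qed
  have "(\<integral>h. F h x \<partial>lborel) = f (x + v) - f x" for x
  proof -
    have "isCont (\<lambda>h. f' (x + h *\<^sub>R v)) h" for h
    proof (rule isCont_o2[where g=f'])
      show "isCont (\<lambda>h. x + h *\<^sub>R v) h" by (intro continuous_intros)
      show "isCont f' (x + h *\<^sub>R v)" using c by (simp add: continuous_on_eq_continuous_at)
    qed
    then show ?thesis
      unfolding F_def
      using integral_FTC_Icc_real[of 0 1 "\<lambda>k. f (x + k *\<^sub>R v)" "\<lambda>h. f' (x + h *\<^sub>R v)"] der by simp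
  qed
  then have "(\<integral>x. (\<integral>h. F h x \<partial>lborel) \<partial>lborel) = 0"
    using f lborel_integrable_translate[OF f, of v] lborel_integral_translate[OF f, of v] by simp
  moreover have "(\<integral>x. (\<integral>h. F h x \<partial>lborel) \<partial>lborel) = (\<integral>h. (\<integral>x. F h x \<partial>lborel) \<partial>lborel)"
    by (rule lborel_pair.Fubini_integral[OF pF])
  moreover have "(\<integral>h. (\<integral>x. F h x \<partial>lborel) \<partial>lborel) = (\<integral>x. f' x \<partial>lborel)"
    by (simp add: F_def I)
  ultimately show ?thesis by simp
qed

lemma integrable_bounded_mult_L2:
  fixes c f g :: "'a::euclidean_space \<Rightarrow> real"
  assumes [measurable]: "c \<in> borel_measurable borel" "f \<in> borel_measurable borel" "g \<in> borel_measurable borel"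
    and c: "\<And>x. \<bar>c x\<bar> \<le> A" and f: "integrable lborel (\<lambda>x. (f x)\<^sup>2)" and g: "integrable lborel (\<lambda>x. (g x)\<^sup>2)"
  shows "integrable lborel (\<lambda>x. c x * (f x * g x))"
proof (rule Bochner_Integration.integrable_bound)
  show "integrable lborel (\<lambda>x. A * ((f x)\<^sup>2 + (g x)\<^sup>2))" using f g by auto
  show "AE x in lborel. norm (c x * (f x * g x)) \<le> norm (A * ((f x)\<^sup>2 + (g x)\<^sup>2))"
  proof (rule AE_I2)
    fix x
    have A: "0 \<le> A" using c[of x] by linarith
    have "\<bar>c x\<bar> * \<bar>f x * g x\<bar> \<le> A * ((f x)\<^sup>2 + (g x)\<^sup>2)"
      using c[of x] A by (intro mult_mono abs_mult_le_squares) auto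
    then show "norm (c x * (f x * g x)) \<le> norm (A * ((f x)\<^sup>2 + (g x)\<^sup>2))"
      using A by (simp add: abs_mult)
  qed
qed measurable

text \<open>Here \<open>dE i j\<close> stands for the derivative of \<open>E i\<close> in direction
  j. The bound \<open>K\<close> is uniform in time, as Fubini on [-T, T] times space requires; decay
  at infinity enters only through square integrability. The fields are real, and complex ones enter
  by their real and imaginary parts.\<close>

locale maxwell_solution =
  fixes E B :: "3 \<Rightarrow> real^3 \<Rightarrow> real \<Rightarrow> real" and dE dB :: "3 \<Rightarrow> 3 \<Rightarrow> real^3 \<Rightarrow> real \<Rightarrow> real" and K :: real
  assumes contE: "continuous_on UNIV (\<lambda>(x, t). E i x t)" and contB: "continuous_on UNIV (\<lambda>(x, t). B i x t)"
    and contdE: "continuous_on UNIV (\<lambda>(x, t). dE i j x t)" and contdB: "continuous_on UNIV (\<lambda>(x, t). dB i j x t)"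
    and derE: "((\<lambda>h. E i (x + h *\<^sub>R axis j 1) t) has_real_derivative dE i j x t) (at 0)"
    and derB: "((\<lambda>h. B i (x + h *\<^sub>R axis j 1) t) has_real_derivative dB i j x t) (at 0)"
    and timeE: "(E 1 x has_real_derivative dB 3 2 x t - dB 2 3 x t) (at t)"
      "(E 2 x has_real_derivative dB 1 3 x t - dB 3 1 x t) (at t)"
      "(E 3 x has_real_derivative dB 2 1 x t - dB 1 2 x t) (at t)"
    and timeB: "(B 1 x has_real_derivative dE 2 3 x t - dE 3 2 x t) (at t)"
      "(B 2 x has_real_derivative dE 3 1 x t - dE 1 3 x t) (at t)"
      "(B 3 x has_real_derivative dE 1 2 x t - dE 2 1 x t) (at t)"
    and divE: "dE 1 1 x t + dE 2 2 x t + dE 3 3 x t = 0"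
    and divB: "dB 1 1 x t + dB 2 2 x t + dB 3 3 x t = 0"
    and sqE: "integrable lborel (\<lambda>x. (E i x t)\<^sup>2)" "(\<integral>x. (E i x t)\<^sup>2 \<partial>lborel) \<le> K"
    and sqB: "integrable lborel (\<lambda>x. (B i x t)\<^sup>2)" "(\<integral>x. (B i x t)\<^sup>2 \<partial>lborel) \<le> K"
    and sqdE: "integrable lborel (\<lambda>x. (dE i j x t)\<^sup>2)" "(\<integral>x. (dE i j x t)\<^sup>2 \<partial>lborel) \<le> K"
    and sqdB: "integrable lborel (\<lambda>x. (dB i j x t)\<^sup>2)" "(\<integral>x. (dB i j x t)\<^sup>2 \<partial>lborel) \<le> K"
begin

definition energy :: "real^3 \<Rightarrow> real \<Rightarrow> real" where
  "energy x t = (\<Sum>i\<in>UNIV. (E i x t)\<^sup>2 + (B i x t)\<^sup>2)"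

lemma energy_integrable: "integrable lborel (\<lambda>x. energy x t)"
  unfolding energy_def by (intro Bochner_Integration.integrable_sum Bochner_Integration.integrable_add sqE sqB)

lemma energy_nonneg: "0 \<le> energy x t"
  unfolding energy_def by (intro sum_nonneg) auto

definition poynting :: "(3 \<Rightarrow> real^3 \<Rightarrow> real) \<Rightarrow> real^3 \<Rightarrow> real \<Rightarrow> real" where
  "poynting a x t = a 1 x * (E 2 x t * B 3 x t - E 3 x t * B 2 x t)
     + a 2 x * (E 3 x t * B 1 x t - E 1 x t * B 3 x t) + a 3 x * (E 1 x t * B 2 x t - E 2 x t * B 1 x t)"

definition dpoynting :: "(3 \<Rightarrow> real^3 \<Rightarrow> real) \<Rightarrow> real^3 \<Rightarrow> real \<Rightarrow> real" where
  "dpoynting a x t =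
     a 1 x * ((dB 1 3 x t - dB 3 1 x t) * B 3 x t + E 2 x t * (dE 1 2 x t - dE 2 1 x t)
            - (dB 2 1 x t - dB 1 2 x t) * B 2 x t - E 3 x t * (dE 3 1 x t - dE 1 3 x t))
   + a 2 x * ((dB 2 1 x t - dB 1 2 x t) * B 1 x t + E 3 x t * (dE 2 3 x t - dE 3 2 x t)
            - (dB 3 2 x t - dB 2 3 x t) * B 3 x t - E 1 x t * (dE 1 2 x t - dE 2 1 x t))
   + a 3 x * ((dB 3 2 x t - dB 2 3 x t) * B 2 x t + E 1 x t * (dE 3 1 x t - dE 1 3 x t)
            - (dB 1 3 x t - dB 3 1 x t) * B 1 x t - E 2 x t * (dE 2 3 x t - dE 3 2 x t))"

lemma poynting_derivative: "(poynting a x has_real_derivative dpoynting a x t) (at t)"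
  unfolding poynting_def[abs_def] dpoynting_def
  by (rule derivative_eq_intros timeE timeB refl)+ (simp add: algebra_simps)

text \<open>The Maxwell stress tensor contracted with the Jacobian of the multiplier, where
  \<open>da i j\<close> is the derivative of component i in direction j.\<close>

definition stress :: "(3 \<Rightarrow> 3 \<Rightarrow> real^3 \<Rightarrow> real) \<Rightarrow> real^3 \<Rightarrow> real \<Rightarrow> real" where
  "stress da x t = (\<Sum>j\<in>UNIV. \<Sum>i\<in>UNIV. da j j x * ((E i x t * E i x t + B i x t * B i x t) / 2)
      - da i j x * (E j x t * E i x t + B j x t * B i x t))"

text \<open>Component j of the stress tensor applied to the vector field \<open>a\<close>.\<close>

definition flux :: "(3 \<Rightarrow> real^3 \<Rightarrow> real) \<Rightarrow> 3 \<Rightarrow> real^3 \<Rightarrow> real \<Rightarrow> real" where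
  "flux a j x t = (\<Sum>i\<in>UNIV. a j x * ((E i x t * E i x t + B i x t * B i x t) / 2)
      - a i x * (E j x t * E i x t + B j x t * B i x t))"

definition dflux :: "(3 \<Rightarrow> real^3 \<Rightarrow> real) \<Rightarrow> (3 \<Rightarrow> 3 \<Rightarrow> real^3 \<Rightarrow> real) \<Rightarrow> 3 \<Rightarrow> real^3 \<Rightarrow> real \<Rightarrow> real" where
  "dflux a da j x t = (\<Sum>i\<in>UNIV. da j j x * ((E i x t * E i x t + B i x t * B i x t) / 2)
      - da i j x * (E j x t * E i x t + B j x t * B i x t)
      + a j x * (E i x t * dE i j x t + B i x t * dB i j x t)
      - a i x * (dE j j x t * E i x t + E j x t * dE i j x t + dB j j x t * B i x t + B j x t * dB i j x t))"

text \<open>The local momentum balance after the Leibniz rule for the divergence of stress tensor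
  times \<open>a\<close>. The divergence conditions remove the terms E div E and B div B; once
  \<open>dE 3 3\<close> and \<open>dB 3 3\<close> are eliminated, a polynomial identity
  remains.\<close>

lemma stress_eq: "stress da x t = (\<Sum>j\<in>UNIV. dflux a da j x t) + dpoynting a x t"
proof -
  have e: "dE 3 3 x t = - dE 1 1 x t - dE 2 2 x t" and b: "dB 3 3 x t = - dB 1 1 x t - dB 2 2 x t"
    using divE[of x t] divB[of x t] by linarith+
  show ?thesis
    unfolding stress_def dflux_def dpoynting_def
    by (simp add: sum_3 e b) (simp add: algebra_simps)
qed

lemma continuous_slices:
  "continuous_on UNIV (\<lambda>x. E i x t)" "continuous_on UNIV (\<lambda>x. B i x t)"
  "continuous_on UNIV (\<lambda>x. dE i j x t)" "continuous_on UNIV (\<lambda>x. dB i j x t)"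
proof -
  have "continuous_on UNIV (\<lambda>x::real^3. F x t)" if "continuous_on UNIV (\<lambda>(x, t). F x t)" for F :: "real^3 \<Rightarrow> real \<Rightarrow> real"
    using continuous_on_compose2[OF that, of UNIV "\<lambda>x. (x, t)"] by (simp add: continuous_on_Pair)
  from this[OF contE] this[OF contB] this[OF contdE] this[OF contdB]
  show "continuous_on UNIV (\<lambda>x. E i x t)" "continuous_on UNIV (\<lambda>x. B i x t)"
    "continuous_on UNIV (\<lambda>x. dE i j x t)" "continuous_on UNIV (\<lambda>x. dB i j x t)" by auto
qed

lemma measurable_slices[measurable]:
  "(\<lambda>x. E i x t) \<in> borel_measurable borel" "(\<lambda>x. B i x t) \<in> borel_measurable borel"
  "(\<lambda>x. dE i j x t) \<in> borel_measurable borel" "(\<lambda>x. dB i j x t) \<in> borel_measurable borel"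
  using continuous_slices by (auto intro: borel_measurable_continuous_onI)

end

text \<open>A bounded continuously differentiable vector field with bounded Jacobian: products of
  two L2 functions stay integrable after multiplication by it, so no boundary term appears at
  infinity.\<close>

locale maxwell_multiplier = maxwell_solution +
  fixes a :: "3 \<Rightarrow> real^3 \<Rightarrow> real" and da :: "3 \<Rightarrow> 3 \<Rightarrow> real^3 \<Rightarrow> real" and A :: real
  assumes conta: "continuous_on UNIV (a i)" and contda: "continuous_on UNIV (da i j)"
    and dera: "((\<lambda>h. a i (x + h *\<^sub>R axis j 1)) has_real_derivative da i j x) (at 0)"
    and bda: "\<bar>a i x\<bar> \<le> A" and bdda: "\<bar>da i j x\<bar> \<le> A"
begin

lemma measurable_multiplier[measurable]: "a i \<in> borel_measurable borel" "da i j \<in> borel_measurable borel"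
  using conta contda by (auto intro: borel_measurable_continuous_onI)

lemmas mult_integrable =
  integrable_bounded_mult_L2[OF measurable_multiplier(1) _ _ bda]
  integrable_bounded_mult_L2[OF measurable_multiplier(2) _ _ bdda]

lemma integrable_flux: "integrable lborel (\<lambda>x. flux a j x t)"
  unfolding flux_def times_divide_eq_right distrib_left
  by (intro Bochner_Integration.integrable_sum Bochner_Integration.integrable_add Bochner_Integration.integrable_diff
      integrable_divide_zero mult_integrable measurable_slices sqE sqB)

lemma integrable_dflux: "integrable lborel (\<lambda>x. dflux a da j x t)"
  unfolding dflux_def times_divide_eq_right distrib_left
  by (intro Bochner_Integration.integrable_sum Bochner_Integration.integrable_add Bochner_Integration.integrable_diff
      integrable_divide_zero mult_integrable measurable_slices sqE sqB sqdE sqdB)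

lemma integrable_dpoynting: "integrable lborel (\<lambda>x. dpoynting a x t)"
  unfolding dpoynting_def right_diff_distrib left_diff_distrib distrib_left
  by (intro Bochner_Integration.integrable_sum Bochner_Integration.integrable_add Bochner_Integration.integrable_diff
      mult_integrable measurable_slices sqE sqB sqdE sqdB)

lemma integrable_poynting: "integrable lborel (\<lambda>x. poynting a x t)"
  unfolding poynting_def right_diff_distrib left_diff_distrib distrib_left
  by (intro Bochner_Integration.integrable_sum Bochner_Integration.integrable_add Bochner_Integration.integrable_diff
      mult_integrable measurable_slices sqE sqB sqdE sqdB)

lemma flux_derivative: "((\<lambda>h. flux a j (x + h *\<^sub>R axis j 1) t) has_real_derivative dflux a da j x t) (at 0)"
  unfolding flux_def dflux_def
  by (rule derivative_eq_intros derE derB dera refl | simp)+ (simp add: algebra_simps add_divide_distrib)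

lemma continuous_dflux: "continuous_on UNIV (\<lambda>x. dflux a da j x t)"
  unfolding dflux_def by (intro continuous_intros conta contda continuous_slices) auto

lemma integral_dflux: "(\<integral>x. dflux a da j x t \<partial>lborel) = 0"
  by (rule integral_directional_derivative_eq_0[OF integrable_flux integrable_dflux continuous_dflux flux_derivative])

lemma integral_stress:
  "integrable lborel (\<lambda>x. stress da x t)" "(\<integral>x. stress da x t \<partial>lborel) = (\<integral>x. dpoynting a x t \<partial>lborel)"
  unfolding stress_eq[where a=a]
  by (auto simp: integral_dflux integrable_dflux integrable_dpoynting)

end

section \<open>Integrability over a bounded time interval times space\<close>

lemma integrable_slab_square:
  fixes f :: "real^3 \<Rightarrow> real \<Rightarrow> real"
  assumes [measurable]: "(\<lambda>p. f (snd p) (fst p)) \<in> borel_measurable (borel \<Otimes>\<^sub>M borel)"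
    and i: "\<And>t. integrable lborel (\<lambda>x. (f x t)\<^sup>2)" and b: "\<And>t. (\<integral>x. (f x t)\<^sup>2 \<partial>lborel) \<le> K"
  shows "integrable (lborel \<Otimes>\<^sub>M lborel) (\<lambda>p. indicator {-T..T} (fst p) * (f (snd p) (fst p))\<^sup>2)"
proof (rule lborel_pair.Fubini_integrable)
  show "(\<lambda>p. indicator {-T..T} (fst p) * (f (snd p) (fst p))\<^sup>2) \<in> borel_measurable (lborel \<Otimes>\<^sub>M lborel)"
    by measurable
  have [measurable]: "(\<lambda>p. f (snd p) (fst p)) \<in> borel_measurable (lborel \<Otimes>\<^sub>M lborel)" by measurable
  have [measurable]: "(\<lambda>t. \<integral>x. (f x t)\<^sup>2 \<partial>lborel) \<in> borel_measurable borel"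
    using lborel.borel_measurable_lebesgue_integral[of "\<lambda>t x. (f x t)\<^sup>2" borel] by (simp add: case_prod_beta')
  show "AE t in lborel. integrable lborel (\<lambda>x. indicator {-T..T} (fst (t, x)) * (f (snd (t, x)) (fst (t, x)))\<^sup>2)"
    using i by simp
  have eq: "(\<integral>x. norm (indicator {-T..T} (fst (t, x)) * (f (snd (t, x)) (fst (t, x)))\<^sup>2) \<partial>lborel)
      = indicator {-T..T} t * (\<integral>x. (f x t)\<^sup>2 \<partial>lborel)" for t
    by (simp add: abs_mult)
  show "integrable lborel (\<lambda>t. \<integral>x. norm (indicator {-T..T} (fst (t, x)) * (f (snd (t, x)) (fst (t, x)))\<^sup>2) \<partial>lborel)"
    unfolding eq
  proof (rule Bochner_Integration.integrable_bound)
    show "integrable lborel (\<lambda>t. indicator {-T..T} t * K)"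
      by (intro integrable_mult_left integrable_real_indicator emeasure_bounded_finite) auto
    show "AE t in lborel. norm (indicator {- T..T} t * (\<integral>x. (f x t)\<^sup>2 \<partial>lborel)) \<le> norm (indicator {- T..T} t * K)"
      using order_trans[OF b abs_ge_self] by (intro AE_I2) (auto simp: indicator_def)
  qed measurable
qed

lemma integrable_slab_mult:
  fixes f g :: "real^3 \<Rightarrow> real \<Rightarrow> real"
  assumes [measurable]: "c \<in> borel_measurable borel" and c: "\<And>x. \<bar>c x\<bar> \<le> A"
    and [measurable]: "(\<lambda>p. f (snd p) (fst p)) \<in> borel_measurable (borel \<Otimes>\<^sub>M borel)"
      "(\<lambda>p. g (snd p) (fst p)) \<in> borel_measurable (borel \<Otimes>\<^sub>M borel)"
    and f: "\<And>t. integrable lborel (\<lambda>x. (f x t)\<^sup>2)" "\<And>t. (\<integral>x. (f x t)\<^sup>2 \<partial>lborel) \<le> K"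
    and g: "\<And>t. integrable lborel (\<lambda>x. (g x t)\<^sup>2)" "\<And>t. (\<integral>x. (g x t)\<^sup>2 \<partial>lborel) \<le> K"
  shows "integrable (lborel \<Otimes>\<^sub>M lborel)
    (\<lambda>p. indicator {-T..T} (fst p) * (c (snd p) * (f (snd p) (fst p) * g (snd p) (fst p))))"
proof (rule Bochner_Integration.integrable_bound)
  show "integrable (lborel \<Otimes>\<^sub>M lborel) (\<lambda>p. A * (indicator {-T..T} (fst p) * (f (snd p) (fst p))\<^sup>2 + indicator {-T..T} (fst p) * (g (snd p) (fst p))\<^sup>2))"
    by (intro integrable_mult_right Bochner_Integration.integrable_add integrable_slab_square[where K=K] assms)
  show "AE p in lborel \<Otimes>\<^sub>M lborel. norm (indicator {-T..T} (fst p) * (c (snd p) * (f (snd p) (fst p) * g (snd p) (fst p))))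
     \<le> norm (A * (indicator {-T..T} (fst p) * (f (snd p) (fst p))\<^sup>2 + indicator {-T..T} (fst p) * (g (snd p) (fst p))\<^sup>2))"
  proof (rule AE_I2)
    fix p :: "real \<times> (real^3)"
    obtain t x where p: "p = (t, x)" by (cases p)
    have A: "0 \<le> A" using c[of x] by linarith
    have "\<bar>c x\<bar> * \<bar>f x t * g x t\<bar> \<le> A * ((f x t)\<^sup>2 + (g x t)\<^sup>2)"
      using c[of x] A by (intro mult_mono abs_mult_le_squares) auto
    then show "norm (indicator {-T..T} (fst p) * (c (snd p) * (f (snd p) (fst p) * g (snd p) (fst p))))
     \<le> norm (A * (indicator {-T..T} (fst p) * (f (snd p) (fst p))\<^sup>2 + indicator {-T..T} (fst p) * (g (snd p) (fst p))\<^sup>2))"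
      using A by (auto simp: abs_mult p indicator_def)
  qed
qed measurable

lemma borel_measurable_swapI:
  fixes F :: "real^3 \<Rightarrow> real \<Rightarrow> real"
  assumes "continuous_on UNIV (\<lambda>(x, t). F x t)"
  shows "(\<lambda>p. F (snd p) (fst p)) \<in> borel_measurable (borel \<Otimes>\<^sub>M borel)"
proof -
  have "continuous_on UNIV (\<lambda>p. F (snd p) (fst p))"
    using continuous_on_compose2[OF assms, of UNIV "\<lambda>p. (snd p, fst p)"]
    by (simp add: continuous_on_Pair continuous_on_fst continuous_on_snd continuous_on_id)
  then show ?thesis by (simp add: borel_prod borel_measurable_continuous_onI)
qed

context maxwell_solution
begin

lemma measurable_joint[measurable]:
  "(\<lambda>p. E i (snd p) (fst p)) \<in> borel_measurable (borel \<Otimes>\<^sub>M borel)"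
  "(\<lambda>p. B i (snd p) (fst p)) \<in> borel_measurable (borel \<Otimes>\<^sub>M borel)"
  "(\<lambda>p. dE i j (snd p) (fst p)) \<in> borel_measurable (borel \<Otimes>\<^sub>M borel)"
  "(\<lambda>p. dB i j (snd p) (fst p)) \<in> borel_measurable (borel \<Otimes>\<^sub>M borel)"
  by (intro borel_measurable_swapI contE contB contdE contdB)+

end

context maxwell_multiplier
begin

lemma continuous_dpoynting: "continuous_on UNIV (\<lambda>t. dpoynting a x t)"
proof -
  have "continuous_on UNIV (\<lambda>t. F x t)" if "continuous_on UNIV (\<lambda>(x, t). F x t)" for F :: "real^3 \<Rightarrow> real \<Rightarrow> real"
    using continuous_on_compose2[OF that, of UNIV "\<lambda>t. (x, t)"] by (simp add: continuous_on_Pair)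
  from this[OF contE] this[OF contB] this[OF contdE] this[OF contdB]
  show ?thesis
    unfolding dpoynting_def by (intro continuous_intros)
qed

lemma integrable_slab_dpoynting:
  "integrable (lborel \<Otimes>\<^sub>M lborel) (\<lambda>p. indicator {-T..T} (fst p) * dpoynting a (snd p) (fst p))"
  unfolding dpoynting_def right_diff_distrib left_diff_distrib distrib_left
  by (intro Bochner_Integration.integrable_add Bochner_Integration.integrable_diff
      integrable_slab_mult[where K=K, OF measurable_multiplier(1) bda] measurable_joint sqE sqB sqdE sqdB)

text \<open>At each time the space integrals of stress and \<open>dpoynting\<close> agree, as the
  flux integrates to 0. Fubini then allows the time integral to be taken first at fixed x, by the
  fundamental theorem of calculus, which avoids differentiating a space integral in time.\<close>

lemma stress_spacetime:
  assumes T: "0 \<le> T" and pos: "\<And>x t. 0 \<le> stress da x t"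
  shows "(\<integral>\<^sup>+t. indicator {-T..T} t * (\<integral>\<^sup>+x. ennreal (stress da x t) \<partial>lborel) \<partial>lborel)
    = ennreal (\<integral>x. poynting a x T - poynting a x (-T) \<partial>lborel)"
proof -
  define F where "F = (\<lambda>t x. indicator {-T..T} t * dpoynting a x t)"
  have pF: "integrable (lborel \<Otimes>\<^sub>M lborel) (case_prod F)"
    using integrable_slab_dpoynting[of T] by (simp add: F_def case_prod_beta')
  have ix: "(\<integral>x. F t x \<partial>lborel) = indicator {-T..T} t * (\<integral>x. stress da x t \<partial>lborel)" for t
    unfolding F_def integral_stress(2) by simp
  have it: "(\<integral>t. F t x \<partial>lborel) = poynting a x T - poynting a x (-T)" for x
    unfolding F_def using T
    using integral_FTC_Icc_real[of "-T" T "poynting a x" "dpoynting a x"] poynting_derivative continuous_dpoynting[of x]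
    by (simp add: mult.commute continuous_on_eq_continuous_at)
  have "(\<integral>\<^sup>+t. indicator {-T..T} t * (\<integral>\<^sup>+x. ennreal (stress da x t) \<partial>lborel) \<partial>lborel) = (\<integral>\<^sup>+t. ennreal (\<integral>x. F t x \<partial>lborel) \<partial>lborel)"
  proof (rule nn_integral_cong)
    fix t
    have "(\<integral>\<^sup>+x. ennreal (stress da x t) \<partial>lborel) = ennreal (\<integral>x. stress da x t \<partial>lborel)"
      using pos integral_stress(1) by (intro nn_integral_eq_integral) auto
    then show "indicator {-T..T} t * (\<integral>\<^sup>+x. ennreal (stress da x t) \<partial>lborel) = ennreal (\<integral>x. F t x \<partial>lborel)"
      unfolding ix by (simp add: indicator_def)
  qed
  also have "\<dots> = ennreal (\<integral>t. (\<integral>x. F t x \<partial>lborel) \<partial>lborel)"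
  proof (rule nn_integral_eq_integral)
    show "integrable lborel (\<lambda>t. \<integral>x. F t x \<partial>lborel)"
      using lborel_pair.integrable_fst[OF pF] by simp
    show "AE t in lborel. 0 \<le> (\<integral>x. F t x \<partial>lborel)"
      unfolding ix using pos by (intro AE_I2 mult_nonneg_nonneg integral_nonneg_AE) auto
  qed
  also have "(\<integral>t. (\<integral>x. F t x \<partial>lborel) \<partial>lborel) = (\<integral>x. (\<integral>t. F t x \<partial>lborel) \<partial>lborel)"
    by (rule lborel_pair.Fubini_integral[OF pF, symmetric])
  finally show ?thesis unfolding it .
qed

end

section \<open>The Morawetz multiplier\<close>

text \<open>The square of the Japanese bracket, so that the weight of the theorem is its power
  \<open>-s\<close>.\<close>

definition bracket :: "real^3 \<Rightarrow> real" where
  "bracket x = 1 + (norm x)\<^sup>2"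

definition morawetz_p :: "real \<Rightarrow> real^3 \<Rightarrow> real" where
  "morawetz_p s x = 2 * s * bracket x powr (-1/2) - bracket x powr (-s)"

text \<open>The derivative of the profile in r, divided by r. The division leaves no singularity at
  the origin, and the Jacobian of the field becomes p times the identity plus q times the rank-one
  matrix of x.\<close>

definition morawetz_q :: "real \<Rightarrow> real^3 \<Rightarrow> real" where
  "morawetz_q s x = - 2 * s * bracket x powr (-3/2) + 2 * s * bracket x powr (-s-1)"

lemma bracket_ge_1: "1 \<le> bracket x" by (simp add: bracket_def)

lemma bracket_pos: "0 < bracket x" using bracket_ge_1[of x] by linarith

lemma bracket_sum: "bracket x = 1 + ((x$1)\<^sup>2 + (x$2)\<^sup>2 + (x$3)\<^sup>2)"
  unfolding bracket_def power2_norm_eq_inner by (simp add: inner_vec_def sum_3 power2_eq_square)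

lemma continuous_bracket: "continuous_on UNIV bracket"
  unfolding bracket_def[abs_def] by (intro continuous_intros)

lemma bracket_derivative: "((\<lambda>h. bracket (x + h *\<^sub>R axis j 1)) has_real_derivative 2 * x$j) (at 0)"
proof -
  have "bracket (x + h *\<^sub>R axis j 1) = bracket x + 2 * h * x$j + h\<^sup>2" for h
    unfolding bracket_def power2_norm_eq_inner
    by (simp add: inner_add_left inner_add_right inner_axis inner_axis' power2_eq_square inner_axis_axis algebra_simps)
  then show ?thesis by (auto intro!: derivative_eq_intros)
qed

lemma morawetz_p_derivative: "((\<lambda>h. morawetz_p s (x + h *\<^sub>R axis j 1)) has_real_derivative x$j * morawetz_q s x) (at 0)"
proof -
  have P: "((\<lambda>h. bracket (x + h *\<^sub>R axis j 1) powr r) has_real_derivative r * bracket x powr (r - 1) * (2 * x$j)) (at 0)" for r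
    using DERIV_fun_powr[OF bracket_derivative[of x j], of r] bracket_pos[of x] by (simp add: mult_ac)
  show ?thesis
    unfolding morawetz_p_def
    by (rule derivative_eq_intros P refl)+ (simp add: morawetz_q_def algebra_simps)
qed

lemma continuous_morawetz: "continuous_on UNIV (morawetz_p s)" "continuous_on UNIV (morawetz_q s)"
  unfolding morawetz_p_def[abs_def] morawetz_q_def[abs_def]
  using bracket_pos by (auto intro!: continuous_intros continuous_bracket simp: less_imp_neq[symmetric])

definition morawetz_field :: "real \<Rightarrow> 3 \<Rightarrow> real^3 \<Rightarrow> real" where
  "morawetz_field s i x = x$i * morawetz_p s x"

definition morawetz_jacobian :: "real \<Rightarrow> 3 \<Rightarrow> 3 \<Rightarrow> real^3 \<Rightarrow> real" where
  "morawetz_jacobian s i j x = (if i = j then morawetz_p s x else 0) + x$i * (x$j * morawetz_q s x)"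

lemma morawetz_field_derivative: "((\<lambda>h. morawetz_field s i (x + h *\<^sub>R axis j 1)) has_real_derivative morawetz_jacobian s i j x) (at 0)"
proof -
  have "((\<lambda>h. (x + h *\<^sub>R axis j 1) $ i) has_real_derivative (if i = j then 1 else 0)) (at 0)"
    by (auto simp: axis_def intro!: derivative_eq_intros)
  from DERIV_mult[OF this morawetz_p_derivative[of s x j]]
  show ?thesis unfolding morawetz_field_def morawetz_jacobian_def by (rule DERIV_cong) auto
qed

lemma norm_le_bracket_powr: "norm x \<le> bracket x powr (1/2)"
proof -
  have "norm x = sqrt ((norm x)\<^sup>2)" by simp
  also have "\<dots> \<le> sqrt (bracket x)" by (intro real_sqrt_le_mono) (simp add: bracket_def)
  finally show ?thesis using bracket_pos[of x] by (simp add: powr_half_sqrt)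
qed

text \<open>All four follow from \<open>bracket x \<ge> 1\<close>, which orders its powers by
  exponent: -s < -1/2 and -s-1 < -3/2. The coefficient 2s exceeds 1, hence p is nonnegative.\<close>

lemma
  assumes s: "s > 1/2"
  shows morawetz_p_nonneg: "0 \<le> morawetz_p s x" and morawetz_p_le: "morawetz_p s x \<le> 2 * s * bracket x powr (-1/2)"
    and morawetz_q_nonpos: "morawetz_q s x \<le> 0" and morawetz_q_ge: "- (2 * s * bracket x powr (-3/2)) \<le> morawetz_q s x"
proof -
  have 1: "bracket x powr (-s) \<le> bracket x powr (-1/2)" and 2: "bracket x powr (-s-1) \<le> bracket x powr (-3/2)"
    using s bracket_ge_1[of x] by (auto intro!: powr_mono)
  have 3: "1 * bracket x powr (-1/2) \<le> 2 * s * bracket x powr (-1/2)" using s by (intro mult_right_mono) auto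
  show "0 \<le> morawetz_p s x" using 1 3 by (simp add: morawetz_p_def)
  show "morawetz_p s x \<le> 2 * s * bracket x powr (-1/2)" by (simp add: morawetz_p_def)
  show "morawetz_q s x \<le> 0" using 2 s by (simp add: morawetz_q_def)
  show "- (2 * s * bracket x powr (-3/2)) \<le> morawetz_q s x" using s by (simp add: morawetz_q_def)
qed

lemma norm_morawetz_p_le:
  assumes s: "s > 1/2"
  shows "norm x * morawetz_p s x \<le> 2 * s"
proof -
  have "norm x * morawetz_p s x \<le> bracket x powr (1/2) * (2 * s * bracket x powr (-1/2))"
    using s by (intro mult_mono norm_le_bracket_powr morawetz_p_le morawetz_p_nonneg) auto
  also have "\<dots> = 2 * s * (bracket x powr (1/2) * bracket x powr (-1/2))" by simp
  also have "\<dots> = 2 * s" using bracket_pos[of x] by (subst powr_add[symmetric]) simp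
  finally show ?thesis .
qed

text \<open>In the Jacobian, p and the rank-one part contribute at most \<open>2 * s\<close> each;
  the decay of q by a power -3/2 of the bracket compensates the factor of size
  \<open>(norm x)\<^sup>2\<close>.\<close>

lemma
  assumes s: "s > 1/2"
  shows morawetz_field_bound: "\<bar>morawetz_field s i x\<bar> \<le> 4 * s" and morawetz_jacobian_bound: "\<bar>morawetz_jacobian s i j x\<bar> \<le> 4 * s"
proof -
  have p: "0 \<le> morawetz_p s x" by (rule morawetz_p_nonneg[OF s])
  have "\<bar>morawetz_field s i x\<bar> \<le> norm x * morawetz_p s x"
    using p component_le_norm_cart[of x i] by (simp add: morawetz_field_def abs_mult mult_right_mono)
  then show "\<bar>morawetz_field s i x\<bar> \<le> 4 * s" using norm_morawetz_p_le[OF s, of x] s by linarith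
  have le1: "bracket x powr (-1/2) \<le> 1" using bracket_ge_1[of x] powr_mono[of "-1/2" 0 "bracket x"] by simp
  have p2: "morawetz_p s x \<le> 2 * s"
    using morawetz_p_le[OF s, of x] mult_left_mono[OF le1, of "2 * s"] s by linarith
  have q: "\<bar>morawetz_q s x\<bar> \<le> 2 * s * bracket x powr (-3/2)" using morawetz_q_nonpos[OF s, of x] morawetz_q_ge[OF s, of x] by linarith
  have "\<bar>x$i * (x$j * morawetz_q s x)\<bar> \<le> norm x * (norm x * (2 * s * bracket x powr (-3/2)))"
    unfolding abs_mult using q component_le_norm_cart[of x] s by (intro mult_mono) auto
  also have "\<dots> \<le> bracket x powr (1/2) * (bracket x powr (1/2) * (2 * s * bracket x powr (-3/2)))"
    using s norm_le_bracket_powr[of x] by (intro mult_mono) auto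
  also have "\<dots> = 2 * s * (bracket x powr (1/2) * bracket x powr (1/2) * bracket x powr (-3/2))" by simp
  also have "\<dots> = 2 * s * bracket x powr (-1/2)" by (simp only: powr_add[symmetric]) simp
  also have "\<dots> \<le> 2 * s * 1" using s le1 by (intro mult_left_mono) auto
  finally show "\<bar>morawetz_jacobian s i j x\<bar> \<le> 4 * s"
    using p p2 s by (auto simp: morawetz_jacobian_def)
qed

text \<open>The right side is the derivative of r p in r. With the squared norm written as y - 1,
  the terms in y^(-1/2) cancel, and what exceeds the weight is 2s (y^(-3/2) - y^(-s-1)), nonnegative
  for y >= 1.\<close>

lemma morawetz_weight:
  assumes s: "s > 1/2"
  shows "(2 * s - 1) * bracket x powr (-s) \<le> morawetz_p s x + (norm x)\<^sup>2 * morawetz_q s x"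
proof -
  let ?y = "bracket x"
  have n: "(norm x)\<^sup>2 = ?y - 1" by (simp add: bracket_def)
  have a: "?y * ?y powr (-3/2) = ?y powr (-1/2)" and b: "?y * ?y powr (-s-1) = ?y powr (-s)"
    using bracket_pos[of x] by (simp_all add: powr_mult_base)
  have "morawetz_p s x + (norm x)\<^sup>2 * morawetz_q s x = 2 * s * ?y powr (-1/2) - ?y powr (-s)
     - 2 * s * (?y * ?y powr (-3/2)) + 2 * s * (?y * ?y powr (-s-1)) + 2 * s * ?y powr (-3/2) - 2 * s * ?y powr (-s-1)"
    unfolding n morawetz_p_def morawetz_q_def by (simp add: algebra_simps)
  also have "\<dots> = (2 * s - 1) * ?y powr (-s) + 2 * s * (?y powr (-3/2) - ?y powr (-s-1))"
    unfolding a b by (simp add: algebra_simps)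
  also have "\<dots> \<ge> (2 * s - 1) * ?y powr (-s)"
  proof -
    have "?y powr (-s-1) \<le> ?y powr (-3/2)" using s bracket_ge_1[of x] by (auto intro!: powr_mono)
    then show ?thesis using s by simp
  qed
  finally show ?thesis .
qed

context maxwell_solution
begin

text \<open>In dimension three the stress tensor has trace 3/2 - 1 = 1/2 times the energy density;
  its quadratic form at x is half the energy density times the squared norm, minus the squares of
  the radial field components.\<close>

lemma stress_morawetz:
  "stress (morawetz_jacobian s) x t = (morawetz_p s x + (norm x)\<^sup>2 * morawetz_q s x) * (energy x t / 2)
    - morawetz_q s x * ((\<Sum>i\<in>UNIV. x$i * E i x t)\<^sup>2 + (\<Sum>i\<in>UNIV. x$i * B i x t)\<^sup>2)"
proof -
  have n: "(norm x)\<^sup>2 = (x$1)\<^sup>2 + (x$2)\<^sup>2 + (x$3)\<^sup>2" using bracket_sum[of x] by (simp add: bracket_def)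
  show ?thesis
    unfolding stress_def energy_def n morawetz_jacobian_def
    by (simp add: sum_3) (simp add: power2_eq_square algebra_simps add_divide_distrib)
qed

lemma stress_morawetz_ge:
  assumes s: "s > 1/2"
  shows "(2 * s - 1) / 2 * (bracket x powr (-s) * energy x t) \<le> stress (morawetz_jacobian s) x t"
proof -
  have "(2 * s - 1) * bracket x powr (-s) * (energy x t / 2) \<le> (morawetz_p s x + (norm x)\<^sup>2 * morawetz_q s x) * (energy x t / 2)"
    using energy_nonneg[of x t] by (intro mult_right_mono morawetz_weight[OF s]) auto
  moreover have "morawetz_q s x * ((\<Sum>i\<in>UNIV. x$i * E i x t)\<^sup>2 + (\<Sum>i\<in>UNIV. x$i * B i x t)\<^sup>2) \<le> 0"
    using morawetz_q_nonpos[OF s, of x] by (intro mult_nonpos_nonneg) auto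
  moreover have "(2 * s - 1) / 2 * (bracket x powr (-s) * energy x t) = (2 * s - 1) * bracket x powr (-s) * (energy x t / 2)"
    by simp
  ultimately show ?thesis unfolding stress_morawetz by linarith
qed

text \<open>The cross product costs at most half the energy density, and the field
  \<open>x p\<close> has length at most \<open>2 * s\<close>; together this gives the factor
  \<open>s\<close>.\<close>

lemma poynting_morawetz_le:
  assumes s: "s > 1/2"
  shows "\<bar>poynting (morawetz_field s) x t\<bar> \<le> s * energy x t"
proof -
  define e b :: "real^3" where "e = (\<chi> i. E i x t)" and "b = (\<chi> i. B i x t)"
  have P: "poynting (morawetz_field s) x t = morawetz_p s x * (x \<bullet> cross3 e b)"
    by (simp add: poynting_def morawetz_field_def cross3_def inner_vec_def sum_3 e_def b_def algebra_simps)
  have en: "energy x t = (norm e)\<^sup>2 + (norm b)\<^sup>2"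
    unfolding power2_norm_eq_inner by (simp add: energy_def e_def b_def inner_vec_def sum_3 power2_eq_square)
  have "(norm (cross3 e b))\<^sup>2 \<le> (norm e * norm b)\<^sup>2"
    unfolding norm_cross_dot[symmetric] by simp
  then have "norm (cross3 e b) \<le> norm e * norm b"
    by (rule power2_le_imp_le) simp
  also have "\<dots> \<le> energy x t / 2" using two_mult_le_squares[of "norm e" "norm b"] by (simp add: en)
  finally have c: "norm (cross3 e b) \<le> energy x t / 2" .
  have "\<bar>x \<bullet> cross3 e b\<bar> \<le> norm x * norm (cross3 e b)" by (rule Cauchy_Schwarz_ineq2)
  also have "\<dots> \<le> norm x * (energy x t / 2)" using c by (intro mult_left_mono) auto
  finally have "morawetz_p s x * \<bar>x \<bullet> cross3 e b\<bar> \<le> morawetz_p s x * (norm x * (energy x t / 2))"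
    by (intro mult_left_mono morawetz_p_nonneg[OF s])
  also have "\<dots> = norm x * morawetz_p s x * (energy x t / 2)" by simp
  also have "\<dots> \<le> 2 * s * (energy x t / 2)"
    using energy_nonneg[of x t] by (intro mult_right_mono norm_morawetz_p_le[OF s]) auto
  finally show ?thesis using morawetz_p_nonneg[OF s, of x] by (simp add: P abs_mult)
qed

lemma maxwell_multiplier_morawetz:
  assumes s: "s > 1/2"
  shows "maxwell_multiplier E B dE dB K (morawetz_field s) (morawetz_jacobian s) (4 * s)"
proof unfold_locales
  show "continuous_on UNIV (morawetz_field s i)" for i
    unfolding morawetz_field_def[abs_def] by (intro continuous_intros continuous_morawetz)
  show "continuous_on UNIV (morawetz_jacobian s i j)" for i j
    unfolding morawetz_jacobian_def[abs_def] by (cases "i = j") (auto intro!: continuous_intros continuous_morawetz)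
qed (rule morawetz_field_derivative morawetz_field_bound[OF s] morawetz_jacobian_bound[OF s])+

lemma morawetz:
  assumes s: "s > 1/2" and T: "0 \<le> T"
  shows "(\<integral>\<^sup>+t. indicator {-T..T} t * (\<integral>\<^sup>+x. ennreal (bracket x powr (-s) * energy x t) \<partial>lborel) \<partial>lborel)
    \<le> ennreal (2 * s / (2 * s - 1) * ((\<integral>x. energy x T \<partial>lborel) + (\<integral>x. energy x (-T) \<partial>lborel)))"
proof -
  interpret maxwell_multiplier E B dE dB K "morawetz_field s" "morawetz_jacobian s" "4 * s" by (rule maxwell_multiplier_morawetz[OF s])
  \<comment> \<open>Inverse of the coercivity factor in \<open>stress_morawetz_ge\<close>;
    multiplied by the factor \<open>s\<close> from the Poynting bound it gives
    \<open>2 * s / (2 * s - 1)\<close>.\<close>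
  define c where "c = 2 / (2 * s - 1)"
  have c: "c > 0" using s by (simp add: c_def)
  have le: "bracket x powr (-s) * energy x t \<le> c * stress (morawetz_jacobian s) x t" for x t
    using stress_morawetz_ge[OF s, of x t] s by (simp add: c_def field_simps)
  have nn: "0 \<le> bracket x powr (-s) * energy x t" for x t using energy_nonneg by simp
  have pos: "0 \<le> stress (morawetz_jacobian s) x t" for x t
    using order_trans[OF nn le] c by (simp add: zero_le_mult_iff)
  have bound: "poynting (morawetz_field s) x T - poynting (morawetz_field s) x (-T) \<le> s * energy x T + s * energy x (-T)" for x
    using poynting_morawetz_le[OF s, of x T] poynting_morawetz_le[OF s, of x "-T"] by linarith
  have "(\<integral>\<^sup>+t. indicator {-T..T} t * (\<integral>\<^sup>+x. ennreal (bracket x powr (-s) * energy x t) \<partial>lborel) \<partial>lborel)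
      \<le> (\<integral>\<^sup>+t. ennreal c * (indicator {-T..T} t * (\<integral>\<^sup>+x. ennreal (stress (morawetz_jacobian s) x t) \<partial>lborel)) \<partial>lborel)"
  proof (rule nn_integral_mono)
    fix t
    have [measurable]: "(\<lambda>x. stress (morawetz_jacobian s) x t) \<in> borel_measurable lborel"
      using integral_stress(1) by auto
    have "(\<integral>\<^sup>+x. ennreal (bracket x powr (-s) * energy x t) \<partial>lborel) \<le> (\<integral>\<^sup>+x. ennreal c * ennreal (stress (morawetz_jacobian s) x t) \<partial>lborel)"
      using le c by (intro nn_integral_mono) (simp add: ennreal_mult'[symmetric] ennreal_leI)
    also have "\<dots> = ennreal c * (\<integral>\<^sup>+x. ennreal (stress (morawetz_jacobian s) x t) \<partial>lborel)"
      by (rule nn_integral_cmult) measurable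
    finally show "indicator {-T..T} t * (\<integral>\<^sup>+x. ennreal (bracket x powr (-s) * energy x t) \<partial>lborel)
      \<le> ennreal c * (indicator {-T..T} t * (\<integral>\<^sup>+x. ennreal (stress (morawetz_jacobian s) x t) \<partial>lborel))"
      by (auto simp: indicator_def)
  qed
  also have "\<dots> = ennreal c * (\<integral>\<^sup>+t. indicator {-T..T} t * (\<integral>\<^sup>+x. ennreal (stress (morawetz_jacobian s) x t) \<partial>lborel) \<partial>lborel)"
  proof (rule nn_integral_cmult)
    have "(\<lambda>p. stress (morawetz_jacobian s) (snd p) (fst p)) \<in> borel_measurable (borel \<Otimes>\<^sub>M borel)"
      unfolding stress_def by measurable
    then have "(\<lambda>(t, x). ennreal (stress (morawetz_jacobian s) x t)) \<in> borel_measurable (borel \<Otimes>\<^sub>M lborel)"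
      by (simp add: case_prod_beta' cong: measurable_cong_sets)
    from lborel.borel_measurable_nn_integral[OF this]
    show "(\<lambda>t. indicator {-T..T} t * (\<integral>\<^sup>+x. ennreal (stress (morawetz_jacobian s) x t) \<partial>lborel)) \<in> borel_measurable lborel"
      by measurable
  qed
  also have "\<dots> = ennreal c * ennreal (\<integral>x. poynting (morawetz_field s) x T - poynting (morawetz_field s) x (-T) \<partial>lborel)"
    unfolding stress_spacetime[OF T pos] ..
  also have "\<dots> \<le> ennreal c * ennreal (\<integral>x. s * energy x T + s * energy x (-T) \<partial>lborel)"
    using bound by (intro mult_left_mono ennreal_leI integral_mono)
      (auto intro!: integrable_poynting Bochner_Integration.integrable_diff energy_integrable)
  also have "(\<integral>x. s * energy x T + s * energy x (-T) \<partial>lborel) = s * ((\<integral>x. energy x T \<partial>lborel) + (\<integral>x. energy x (-T) \<partial>lborel))"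
    by (simp add: energy_integrable distrib_left)
  also have "ennreal c * ennreal (s * ((\<integral>x. energy x T \<partial>lborel) + (\<integral>x. energy x (-T) \<partial>lborel)))
     = ennreal (2 * s / (2 * s - 1) * ((\<integral>x. energy x T \<partial>lborel) + (\<integral>x. energy x (-T) \<partial>lborel)))"
    using c by (simp add: ennreal_mult'[symmetric] c_def mult_ac)
  finally show ?thesis .
qed

end

section \<open>Band-limited synthesis\<close>

lemma norm_diff_le_of_vector_derivative_bound:
  fixes f :: "real \<Rightarrow> 'a::real_inner"
  assumes d: "\<And>t. (f has_vector_derivative f' t) (at t)" and b: "\<And>t. norm (f' t) \<le> C"
  shows "norm (f t - f u) \<le> C * \<bar>t - u\<bar>"
proof -
  have *: "norm (f t - f u) \<le> C * (t - u)" if "u < t" for t u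
  proof -
    have "continuous_on {u..t} f"
      using d by (auto intro!: continuous_at_imp_continuous_on has_vector_derivative_continuous)
    from mvt_general[OF that this, of "\<lambda>x h. h *\<^sub>R f' x"] d
    obtain x where "norm (f t - f u) \<le> norm ((t - u) *\<^sub>R f' x)"
      by (auto simp: has_vector_derivative_def)
    also have "\<dots> \<le> (t - u) * C" using that b[of x] by (simp add: mult_left_mono)
    finally show ?thesis by (simp add: mult.commute)
  qed
  show ?thesis
    using *[of t u] *[of u t] by (cases t u rule: linorder_cases) (auto simp: norm_minus_commute)
qed

lemma has_vector_derivative_integral:
  fixes F :: "real \<Rightarrow> 'a \<Rightarrow> 'b::euclidean_space"
  assumes i: "\<And>h. integrable M (F h)"
    and d: "\<And>h x. ((\<lambda>h. F h x) has_vector_derivative F' h x) (at h)"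
    and b: "\<And>h x. norm (F' h x) \<le> w x" and w: "integrable M w"
    and [measurable]: "F' t \<in> borel_measurable M"
  shows "((\<lambda>h. \<integral>x. F h x \<partial>M) has_vector_derivative (\<integral>x. F' t x \<partial>M)) (at t)"
proof -
  have [measurable]: "F h \<in> borel_measurable M" for h using i[of h] by auto
  have iF': "integrable M (F' t)"
    by (rule Bochner_Integration.integrable_bound[OF w]) (use b order_trans[OF b abs_ge_self] in auto)
  \<comment> \<open>Normalised remainder of the linear approximation. It tends to 0 pointwise and is
    at most \<open>2 * w\<close>: one \<open>w\<close> for the difference quotient by the mean value
    inequality, one for the derivative.\<close>
  let ?q = "\<lambda>h x. norm (F h x - F t x - (h - t) *\<^sub>R F' t x) / norm (h - t)"
  have lim: "((\<lambda>h. \<integral>x. ?q h x \<partial>M) \<longlongrightarrow> 0) (at t)"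
    unfolding tendsto_at_iff_sequentially
  proof (intro allI impI)
    fix X :: "nat \<Rightarrow> real" assume X: "\<forall>i. X i \<in> UNIV - {t}" "X \<longlonglongrightarrow> t"
    have "(\<lambda>n. \<integral>x. ?q (X n) x \<partial>M) \<longlonglongrightarrow> (\<integral>x. 0 \<partial>M)"
    proof (rule integral_dominated_convergence)
      show "integrable M (\<lambda>x. 2 * w x)" using w by auto
      show "AE x in M. (\<lambda>n. ?q (X n) x) \<longlonglongrightarrow> 0"
      proof (rule AE_I2)
        fix x
        have "((\<lambda>h. ?q h x) \<longlongrightarrow> 0) (at t)"
          using d[of x t] by (simp add: has_vector_derivative_def has_derivative_iff_norm)
        then show "(\<lambda>n. ?q (X n) x) \<longlonglongrightarrow> 0"
          using X unfolding tendsto_at_iff_sequentially by (auto simp: o_def)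
      qed
      show "AE x in M. norm (?q (X n) x) \<le> 2 * w x" for n
      proof (rule AE_I2)
        fix x
        have n: "norm (F (X n) x - F t x) \<le> w x * \<bar>X n - t\<bar>"
          by (rule norm_diff_le_of_vector_derivative_bound[OF d b])
        have "norm ((X n - t) *\<^sub>R F' t x) \<le> w x * \<bar>X n - t\<bar>"
          using mult_right_mono[OF b[of t x], of "\<bar>X n - t\<bar>"] by (simp add: mult.commute)
        with n have "norm (F (X n) x - F t x - (X n - t) *\<^sub>R F' t x) \<le> 2 * w x * \<bar>X n - t\<bar>"
          using norm_triangle_ineq4[of "F (X n) x - F t x" "(X n - t) *\<^sub>R F' t x"] by linarith
        moreover have "X n \<noteq> t" using X by auto
        ultimately show "norm (?q (X n) x) \<le> 2 * w x"
          by (simp add: divide_simps)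
      qed
    qed measurable
    then show "((\<lambda>h. \<integral>x. ?q h x \<partial>M) \<circ> X) \<longlonglongrightarrow> 0" by (simp add: o_def)
  qed
  have "((\<lambda>h. norm ((\<integral>x. F h x \<partial>M) - (\<integral>x. F t x \<partial>M) - (h - t) *\<^sub>R (\<integral>x. F' t x \<partial>M)) / norm (h - t)) \<longlongrightarrow> 0) (at t)"
  proof (rule Lim_null_comparison[OF always_eventually lim], rule allI)
    fix h
    have "(\<integral>x. F h x \<partial>M) - (\<integral>x. F t x \<partial>M) - (h - t) *\<^sub>R (\<integral>x. F' t x \<partial>M) = (\<integral>x. F h x - F t x - (h - t) *\<^sub>R F' t x \<partial>M)"
      using i iF' by simp
    then show "norm (norm ((\<integral>x. F h x \<partial>M) - (\<integral>x. F t x \<partial>M) - (h - t) *\<^sub>R (\<integral>x. F' t x \<partial>M)) / norm (h - t)) \<le> (\<integral>x. ?q h x \<partial>M)"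
      using integral_norm_bound[of M "\<lambda>x. F h x - F t x - (h - t) *\<^sub>R F' t x"] by (simp add: divide_right_mono)
  qed
  then show ?thesis
    by (simp add: has_vector_derivative_def has_derivative_iff_norm bounded_linear_scaleR_left)
qed

text \<open>Amplitudes are only measurable in frequency, since the truncation makes them
  discontinuous there, but continuous in time. The bound is uniform in time and supplies the
  dominating function for every differentiation under the integral.\<close>

definition band_limited :: "(real^3 \<Rightarrow> real \<Rightarrow> complex) \<Rightarrow> real \<Rightarrow> real \<Rightarrow> bool" where
  "band_limited a M R \<longleftrightarrow> (\<forall>t. (\<lambda>\<xi>. a \<xi> t) \<in> borel_measurable borel) \<and> (\<forall>\<xi>. continuous_on UNIV (a \<xi>)) \<and>
     (\<forall>\<xi> t. cmod (a \<xi> t) \<le> M * indicator (cball 0 R) \<xi>)"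

text \<open>The inverse Fourier transform in the space variable, with the factor matching the
  unnormalised \<open>FT1\<close>.\<close>

definition synth :: "(real^3 \<Rightarrow> real \<Rightarrow> complex) \<Rightarrow> real^3 \<Rightarrow> real \<Rightarrow> complex" where
  "synth a x t = FT1 (\<lambda>\<xi>. a \<xi> t) (- x) / (2 * pi) ^ 3"

lemma band_limitedD:
  assumes "band_limited a M R"
  shows "(\<lambda>\<xi>. a \<xi> t) \<in> borel_measurable borel" "continuous_on UNIV (a \<xi>)"
    "cmod (a \<xi> t) \<le> M * indicator (cball 0 R) \<xi>" "cmod (a \<xi> t) \<le> \<bar>M\<bar>" "integrable lborel (\<lambda>\<xi>. a \<xi> t)"
proof -
  show m: "(\<lambda>\<xi>. a \<xi> t) \<in> borel_measurable borel" "continuous_on UNIV (a \<xi>)"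
    using assms by (auto simp: band_limited_def)
  have b: "cmod (a \<xi> t) \<le> M * indicator (cball 0 R) \<xi>" for \<xi> using assms by (auto simp: band_limited_def)
  show "cmod (a \<xi> t) \<le> M * indicator (cball 0 R) \<xi>" by fact
  then show "cmod (a \<xi> t) \<le> \<bar>M\<bar>" by (cases "\<xi> \<in> cball 0 R") auto
  show "integrable lborel (\<lambda>\<xi>. a \<xi> t)" by (rule integrable_bounded_support[OF m(1) b])
qed

lemma integrable_ball_const: "integrable lborel (\<lambda>\<xi>::'a::euclidean_space. (M::real) * indicator (cball 0 R) \<xi>)"
  by (intro integrable_mult_right integrable_real_indicator emeasure_bounded_finite) auto

lemma is_FT_synth:
  assumes "band_limited a M R"
  shows "is_FT (\<lambda>x. synth a x t) (\<lambda>\<xi>. a \<xi> t)"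
  unfolding synth_def by (rule is_FT_inverse[OF band_limitedD(5,4)[OF assms]])

lemma continuous_synth:
  assumes "band_limited a M R"
  shows "continuous_on UNIV (\<lambda>(x, t). synth a x t)"
  unfolding continuous_on_sequentially
proof (intro ballI allI impI, elim conjE)
  fix p :: "(real^3) \<times> real" and X :: "nat \<Rightarrow> (real^3) \<times> real"
  assume X: "X \<longlonglongrightarrow> p"
  note n = band_limitedD[OF assms]
  note [measurable] = n(1)
  have Xf: "(\<lambda>n. fst (X n)) \<longlonglongrightarrow> fst p" and Xs: "(\<lambda>n. snd (X n)) \<longlonglongrightarrow> snd p"
    using X by (auto intro: tendsto_intros)
  have "(\<lambda>n. FT1 (\<lambda>\<xi>. a \<xi> (snd (X n))) (- fst (X n))) \<longlonglongrightarrow> FT1 (\<lambda>\<xi>. a \<xi> (snd p)) (- fst p)"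
    unfolding FT1_def
  proof (rule integral_dominated_convergence[OF _ _ integrable_ball_const])
    show "AE \<xi> in lborel. (\<lambda>n. exp (- \<i> * complex_of_real (- fst (X n) \<bullet> \<xi>)) * a \<xi> (snd (X n)))
        \<longlonglongrightarrow> exp (- \<i> * complex_of_real (- fst p \<bullet> \<xi>)) * a \<xi> (snd p)"
    proof (rule AE_I2)
      fix \<xi>
      have "(\<lambda>n. a \<xi> (snd (X n))) \<longlonglongrightarrow> a \<xi> (snd p)"
        by (rule continuous_on_tendsto_compose[OF n(2) Xs]) auto
      then show "(\<lambda>n. exp (- \<i> * complex_of_real (- fst (X n) \<bullet> \<xi>)) * a \<xi> (snd (X n)))
        \<longlonglongrightarrow> exp (- \<i> * complex_of_real (- fst p \<bullet> \<xi>)) * a \<xi> (snd p)"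
        by (intro tendsto_intros Xf)
    qed
    show "AE \<xi> in lborel. norm (exp (- \<i> * complex_of_real (- fst (X m) \<bullet> \<xi>)) * a \<xi> (snd (X m))) \<le> M * indicator (cball 0 R) \<xi>" for m
      using n(3) by (intro AE_I2) (simp only: norm_mult norm_cis_inner mult_1)
  qed measurable
  then have "(\<lambda>n. FT1 (\<lambda>\<xi>. a \<xi> (snd (X n))) (- fst (X n)) / (2 * pi) ^ 3) \<longlonglongrightarrow> FT1 (\<lambda>\<xi>. a \<xi> (snd p)) (- fst p) / (2 * pi) ^ 3"
    by (intro tendsto_divide tendsto_const) auto
  then show "((\<lambda>(x, t). synth a x t) \<circ> X) \<longlonglongrightarrow> (case p of (x, t) \<Rightarrow> synth a x t)"
    by (simp add: o_def synth_def case_prod_beta')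
qed

text \<open>On the ball the multiplier of a partial derivative has modulus at most \<open>R\<close>,
  so differentiation stays within the class.\<close>

lemma band_limited_deriv:
  assumes "band_limited a M R"
  shows "band_limited (\<lambda>\<xi> t. \<i> * complex_of_real (\<xi>$j) * a \<xi> t) (R * M) R"
  unfolding band_limited_def
proof (intro conjI allI)
  note n = band_limitedD[OF assms]
  note [measurable] = n(1)
  show "(\<lambda>\<xi>. \<i> * complex_of_real (\<xi>$j) * a \<xi> t) \<in> borel_measurable borel" for t by measurable
  show "continuous_on UNIV (\<lambda>t. \<i> * complex_of_real (\<xi>$j) * a \<xi> t)" for \<xi> by (intro continuous_intros n(2))
  show "cmod (\<i> * complex_of_real (\<xi>$j) * a \<xi> t) \<le> R * M * indicator (cball 0 R) \<xi>" for \<xi> t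
  proof (cases "\<xi> \<in> cball 0 R")
    case True
    then have "\<bar>\<xi>$j\<bar> \<le> R" using component_le_norm_cart[of \<xi> j] by simp
    then show ?thesis using n(3)[of \<xi> t] True
      by (auto simp: norm_mult intro!: mult_mono order_trans[OF norm_ge_zero])
  qed (use n(3)[of \<xi> t] in auto)
qed

lemma synth_space_derivative:
  assumes "band_limited a M R"
  shows "((\<lambda>h. synth a (x + h *\<^sub>R axis j 1) t) has_vector_derivative synth (\<lambda>\<xi> t. \<i> * complex_of_real (\<xi>$j) * a \<xi> t) x t) (at 0)"
proof -
  note n = band_limitedD[OF assms]
  note n' = band_limitedD[OF band_limited_deriv[OF assms, of j]]
  note [measurable] = n(1)
  let ?F = "\<lambda>h \<xi>. exp (- \<i> * complex_of_real ((- (x + h *\<^sub>R axis j 1)) \<bullet> \<xi>)) * a \<xi> t"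
  let ?F' = "\<lambda>h \<xi>. exp (- \<i> * complex_of_real ((- (x + h *\<^sub>R axis j 1)) \<bullet> \<xi>)) * (\<i> * complex_of_real (\<xi>$j) * a \<xi> t)"
  have "((\<lambda>h. \<integral>\<xi>. ?F h \<xi> \<partial>lborel) has_vector_derivative (\<integral>\<xi>. ?F' 0 \<xi> \<partial>lborel)) (at 0)"
  proof (rule has_vector_derivative_integral[where w="\<lambda>\<xi>. R * M * indicator (cball 0 R) \<xi>"])
    show "integrable lborel (?F h)" for h by (rule integrable_FT1[OF n(5)])
    show "integrable lborel (\<lambda>\<xi>::real^3. R * M * indicator (cball 0 R) \<xi>)" by (rule integrable_ball_const)
    show "norm (?F' h \<xi>) \<le> R * M * indicator (cball 0 R) \<xi>" for h \<xi>
      using n'(3)[of \<xi> t] by (simp only: norm_mult[of "exp _"] norm_cis_inner mult_1)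
    show "((\<lambda>h. ?F h \<xi>) has_vector_derivative ?F' h \<xi>) (at h)" for h \<xi>
    proof -
      have "((\<lambda>h. exp (\<i> * (complex_of_real (x \<bullet> \<xi>) + complex_of_real h * complex_of_real (\<xi>$j))) * a \<xi> t) has_vector_derivative
        exp (\<i> * (complex_of_real (x \<bullet> \<xi>) + complex_of_real h * complex_of_real (\<xi>$j))) * (\<i> * complex_of_real (\<xi>$j) * a \<xi> t)) (at h)"
      proof -
        have "((\<lambda>z. exp (\<i> * (complex_of_real (x \<bullet> \<xi>) + z * complex_of_real (\<xi>$j))) * a \<xi> t) has_field_derivative
          exp (\<i> * (complex_of_real (x \<bullet> \<xi>) + complex_of_real h * complex_of_real (\<xi>$j))) * (\<i> * complex_of_real (\<xi>$j) * a \<xi> t)) (at (complex_of_real h))"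
          by (auto intro!: derivative_eq_intros)
        from has_vector_derivative_real_field[OF this] show ?thesis by simp
      qed
      moreover have "- \<i> * complex_of_real ((- (x + h *\<^sub>R axis j 1)) \<bullet> \<xi>) = \<i> * (complex_of_real (x \<bullet> \<xi>) + complex_of_real h * complex_of_real (\<xi>$j))" for h
        by (simp add: inner_add_left inner_axis' algebra_simps)
      ultimately show ?thesis by simp
    qed
  qed measurable
  then have "((\<lambda>h. FT1 (\<lambda>\<xi>. a \<xi> t) (- (x + h *\<^sub>R axis j 1))) has_vector_derivative FT1 (\<lambda>\<xi>. \<i> * complex_of_real (\<xi>$j) * a \<xi> t) (- x)) (at 0)"
    unfolding FT1_def by simp
  then show ?thesis
    unfolding synth_def by (rule bounded_linear.has_vector_derivative[OF bounded_linear_divide])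
qed

lemma synth_time_derivative:
  assumes a: "band_limited a M R" and a': "band_limited a' M' R'"
    and d: "\<And>\<xi> t. (a \<xi> has_vector_derivative a' \<xi> t) (at t)"
  shows "(synth a x has_vector_derivative synth a' x t) (at t)"
proof -
  note n = band_limitedD[OF a] and n' = band_limitedD[OF a']
  note [measurable] = n(1) n'(1)
  let ?e = "\<lambda>\<xi>. exp (- \<i> * complex_of_real (- x \<bullet> \<xi>))"
  have "((\<lambda>h. \<integral>\<xi>. ?e \<xi> * a \<xi> h \<partial>lborel) has_vector_derivative (\<integral>\<xi>. ?e \<xi> * a' \<xi> t \<partial>lborel)) (at t)"
  proof (rule has_vector_derivative_integral[where w="\<lambda>\<xi>. M' * indicator (cball 0 R') \<xi>"])
    show "integrable lborel (\<lambda>\<xi>. ?e \<xi> * a \<xi> h)" for h by (rule integrable_FT1[OF n(5)])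
    show "integrable lborel (\<lambda>\<xi>::real^3. M' * indicator (cball 0 R') \<xi>)" by (rule integrable_ball_const)
    show "norm (?e \<xi> * a' \<xi> h) \<le> M' * indicator (cball 0 R') \<xi>" for h \<xi>
      using n'(3)[of \<xi> h] by (simp only: norm_mult norm_cis_inner mult_1)
    show "((\<lambda>h. ?e \<xi> * a \<xi> h) has_vector_derivative ?e \<xi> * a' \<xi> h) (at h)" for h \<xi>
      by (rule bounded_linear.has_vector_derivative[OF bounded_linear_mult_right d])
  qed measurable
  then show ?thesis
    unfolding synth_def FT1_def by (rule bounded_linear.has_vector_derivative[OF bounded_linear_divide])
qed

lemma synth_diff:
  assumes "band_limited a M R" "band_limited b M' R'"
  shows "synth (\<lambda>\<xi> t. a \<xi> t - b \<xi> t) x t = synth a x t - synth b x t"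
  unfolding synth_def FT1_def right_diff_distrib
  by (simp only: Bochner_Integration.integral_diff[OF integrable_FT1 integrable_FT1]
      band_limitedD(5)[OF assms(1)] band_limitedD(5)[OF assms(2)] diff_divide_distrib)

lemma synth_add:
  assumes "band_limited a M R" "band_limited b M' R'"
  shows "synth (\<lambda>\<xi> t. a \<xi> t + b \<xi> t) x t = synth a x t + synth b x t"
  unfolding synth_def FT1_def distrib_left
  by (simp only: Bochner_Integration.integral_add[OF integrable_FT1 integrable_FT1]
      band_limitedD(5)[OF assms(1)] band_limitedD(5)[OF assms(2)] add_divide_distrib)

lemma band_limited_diff:
  assumes "band_limited a M R" "band_limited b M' R"
  shows "band_limited (\<lambda>\<xi> t. a \<xi> t - b \<xi> t) (M + M') R"
proof -
  note a = band_limitedD[OF assms(1)] and b = band_limitedD[OF assms(2)]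
  have "cmod (a \<xi> t - b \<xi> t) \<le> (M + M') * indicator (cball 0 R) \<xi>" for \<xi> t
    using a(3)[of \<xi> t] b(3)[of \<xi> t] norm_triangle_ineq4[of "a \<xi> t" "b \<xi> t"] by (simp add: distrib_right)
  then show ?thesis
    unfolding band_limited_def using a(1,2) b(1,2) by (auto intro!: continuous_intros borel_measurable_diff)
qed

lemma band_limited_add:
  assumes "band_limited a M R" "band_limited b M' R"
  shows "band_limited (\<lambda>\<xi> t. a \<xi> t + b \<xi> t) (M + M') R"
proof -
  note a = band_limitedD[OF assms(1)] and b = band_limitedD[OF assms(2)]
  have "cmod (a \<xi> t + b \<xi> t) \<le> (M + M') * indicator (cball 0 R) \<xi>" for \<xi> t
    using a(3)[of \<xi> t] b(3)[of \<xi> t] norm_triangle_ineq[of "a \<xi> t" "b \<xi> t"] by (simp add: distrib_right)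
  then show ?thesis
    unfolding band_limited_def using a(1,2) b(1,2) by (auto intro!: continuous_intros borel_measurable_add)
qed

lemma is_FT_sqint_eq:
  assumes "is_FT f g"
  shows "sqint f = sqint g / (2 * pi) ^ 3"
  using is_FT_sqint_ge[OF assms] is_FT_sqint_le[OF assms] by (simp add: field_simps)

lemma
  assumes "band_limited a M R"
  shows sq_integrable_synth: "sq_integrable (\<lambda>x. synth a x t)"
    and sqint_synth: "sqint (\<lambda>x. synth a x t) = sqint (\<lambda>\<xi>. a \<xi> t) / (2 * pi) ^ 3"
    and sqint_band_limited_le: "sqint (\<lambda>\<xi>. a \<xi> t) \<le> (\<integral>\<xi>. M\<^sup>2 * indicator (cball 0 R) \<xi> \<partial>(lborel :: (real^3) measure))"
proof -
  note n = band_limitedD[OF assms]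
  show "sq_integrable (\<lambda>x. synth a x t)" using is_FT_synth[OF assms, of t] by (simp add: is_FT_def L2fun_iff)
  show "sqint (\<lambda>x. synth a x t) = sqint (\<lambda>\<xi>. a \<xi> t) / (2 * pi) ^ 3"
    by (rule is_FT_sqint_eq[OF is_FT_synth[OF assms]])
  have "sq_integrable (\<lambda>\<xi>. a \<xi> t)" by (rule sq_integrable_bounded(1)[OF n(5,4)])
  moreover have "(cmod (a \<xi> t))\<^sup>2 \<le> M\<^sup>2 * indicator (cball 0 R) \<xi>" for \<xi>
    using power_mono[OF n(3)[of \<xi> t], of 2] by (cases "\<xi> \<in> cball 0 R") auto
  ultimately show "sqint (\<lambda>\<xi>. a \<xi> t) \<le> (\<integral>\<xi>. M\<^sup>2 * indicator (cball 0 R) \<xi> \<partial>(lborel :: (real^3) measure))"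
    unfolding sqint_def by (intro integral_mono integrable_ball_const) (auto simp: sq_integrable_def)
qed

section \<open>The flow in Fourier space\<close>

text \<open>The symbol is Hermitian, so its product with -i is skew-Hermitian; the inner product on
  \<open>field6\<close> is the real part of the Hermitian one, hence the quadratic form
  vanishes.\<close>

lemma inner_maxwell_symbol: "w \<bullet> cscale6 (- \<i>) (maxwell_symbol \<xi> w) = 0"
  by (cases w) (simp add: inner_prod_def inner_vec_def sum_3 inner_complex_def cscale6_def maxwell_symbol_def
      ccross_def algebra_simps)

lemma norm_field6: "(norm (w :: field6))\<^sup>2 = (\<Sum>i\<in>UNIV. (cmod (fst w $ i))\<^sup>2 + (cmod (snd w $ i))\<^sup>2)"
  unfolding power2_norm_eq_inner
  by (cases w) (simp add: inner_prod_def inner_vec_def sum_3 power2_norm_eq_inner)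

lemma cmod_field6_le: "cmod (fst w $ i) \<le> norm (w :: field6)" "cmod (snd w $ i) \<le> norm (w :: field6)"
  using Finite_Cartesian_Product.norm_nth_le[of "fst w" i] Finite_Cartesian_Product.norm_nth_le[of "snd w" i]
    norm_fst_le[of "fst w" "snd w"] norm_snd_le[of "snd w" "fst w"] by auto

text \<open>Energy is conserved at each single frequency. This gives the total energy balance and
  also keeps truncated amplitudes bounded for all times.\<close>

lemma flow_norm:
  assumes d: "\<And>t. (v has_vector_derivative cscale6 (- \<i>) (maxwell_symbol \<xi> (v t))) (at t)"
  shows "norm (v t) = norm (v 0)"
proof -
  have "((\<lambda>t. v t \<bullet> v t) has_vector_derivative 0) (at t)" for t
    using bounded_bilinear.has_vector_derivative[OF bounded_bilinear_inner d[of t] d[of t]]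
    by (simp add: inner_maxwell_symbol inner_commute)
  then have "v t \<bullet> v t = v 0 \<bullet> v 0"
    using DERIV_isconst_all[of "\<lambda>t. v t \<bullet> v t"] by (simp add: has_real_derivative_iff_has_vector_derivative)
  then show ?thesis by (simp add: norm_eq_sqrt_inner)
qed

lemma flow_components_raw:
  assumes d: "(v has_vector_derivative v') (at t)"
  shows "((\<lambda>t. fst (v t) $ i) has_vector_derivative fst v' $ i) (at t)"
    and "((\<lambda>t. snd (v t) $ i) has_vector_derivative snd v' $ i) (at t)"
  using bounded_linear.has_vector_derivative[OF bounded_linear_compose[OF bounded_linear_vec_nth bounded_linear_fst] d]
    bounded_linear.has_vector_derivative[OF bounded_linear_compose[OF bounded_linear_vec_nth bounded_linear_snd] d] by auto

lemma flow_components: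
  assumes d: "(v has_vector_derivative cscale6 (- \<i>) (maxwell_symbol \<xi> (v t))) (at t)"
  shows "((\<lambda>t. fst (v t) $ 1) has_vector_derivative \<i> * complex_of_real (\<xi>$2) * snd (v t) $ 3 - \<i> * complex_of_real (\<xi>$3) * snd (v t) $ 2) (at t)"
    "((\<lambda>t. fst (v t) $ 2) has_vector_derivative \<i> * complex_of_real (\<xi>$3) * snd (v t) $ 1 - \<i> * complex_of_real (\<xi>$1) * snd (v t) $ 3) (at t)"
    "((\<lambda>t. fst (v t) $ 3) has_vector_derivative \<i> * complex_of_real (\<xi>$1) * snd (v t) $ 2 - \<i> * complex_of_real (\<xi>$2) * snd (v t) $ 1) (at t)"
    "((\<lambda>t. snd (v t) $ 1) has_vector_derivative \<i> * complex_of_real (\<xi>$3) * fst (v t) $ 2 - \<i> * complex_of_real (\<xi>$2) * fst (v t) $ 3) (at t)"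
    "((\<lambda>t. snd (v t) $ 2) has_vector_derivative \<i> * complex_of_real (\<xi>$1) * fst (v t) $ 3 - \<i> * complex_of_real (\<xi>$3) * fst (v t) $ 1) (at t)"
    "((\<lambda>t. snd (v t) $ 3) has_vector_derivative \<i> * complex_of_real (\<xi>$2) * fst (v t) $ 1 - \<i> * complex_of_real (\<xi>$1) * fst (v t) $ 2) (at t)"
  using flow_components_raw[OF d, of 1] flow_components_raw[OF d, of 2] flow_components_raw[OF d, of 3]
  by (simp_all add: cscale6_def maxwell_symbol_def ccross_def algebra_simps)

text \<open>The longitudinal component: the transform of the divergence up to the factor i.\<close>

definition longE :: "real^3 \<Rightarrow> field6 \<Rightarrow> complex" where
  "longE \<xi> w = (\<Sum>i\<in>UNIV. complex_of_real (\<xi>$i) * fst w $ i)"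

definition longB :: "real^3 \<Rightarrow> field6 \<Rightarrow> complex" where
  "longB \<xi> w = (\<Sum>i\<in>UNIV. complex_of_real (\<xi>$i) * snd w $ i)"

text \<open>The time derivative of either field is a cross product with \<open>\<xi>\<close>, hence
  orthogonal to \<open>\<xi>\<close>.\<close>

lemma flow_longitudinal:
  assumes d: "\<And>t. (v has_vector_derivative cscale6 (- \<i>) (maxwell_symbol \<xi> (v t))) (at t)"
  shows "longE \<xi> (v t) = longE \<xi> (v 0)" "longB \<xi> (v t) = longB \<xi> (v 0)"
proof -
  have const: "f t = f 0" if "\<And>t. (f has_vector_derivative 0) (at t)" for f :: "real \<Rightarrow> complex"
  proof -
    have "norm (f t - f 0) \<le> 0 * \<bar>t - 0\<bar>"
      by (rule norm_diff_le_of_vector_derivative_bound[OF that]) simp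
    then show ?thesis by simp
  qed
  have "((\<lambda>t. longE \<xi> (v t)) has_vector_derivative 0) (at t)" for t
    unfolding longE_def sum_3
    by (rule has_vector_derivative_eq_rhs,
        (rule has_vector_derivative_add bounded_linear.has_vector_derivative[OF bounded_linear_mult_right] flow_components[OF d])+)
       (simp add: algebra_simps)
  from const[OF this] show "longE \<xi> (v t) = longE \<xi> (v 0)" .
  have "((\<lambda>t. longB \<xi> (v t)) has_vector_derivative 0) (at t)" for t
    unfolding longB_def sum_3
    by (rule has_vector_derivative_eq_rhs,
        (rule has_vector_derivative_add bounded_linear.has_vector_derivative[OF bounded_linear_mult_right] flow_components[OF d])+)
       (simp add: algebra_simps)
  from const[OF this] show "longB \<xi> (v t) = longB \<xi> (v 0)" .
qed

text \<open>The kept frequencies \<open>S\<close> are constrained only through time 0, yet the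
  constraints persist: the flow acts frequency by frequency and conserves both norm and longitudinal
  components. The single number \<open>R\<close> bounds frequency and amplitude.\<close>

locale truncated_flow =
  fixes v :: "real^3 \<Rightarrow> real \<Rightarrow> field6" and S :: "(real^3) set" and R :: real
  assumes S[measurable]: "S \<in> sets borel"
    and vm[measurable]: "\<And>t i. (\<lambda>\<xi>. fst (v \<xi> t) $ i) \<in> borel_measurable borel" "\<And>t i. (\<lambda>\<xi>. snd (v \<xi> t) $ i) \<in> borel_measurable borel"
    and flow: "\<And>\<xi> t. (v \<xi> has_vector_derivative cscale6 (- \<i>) (maxwell_symbol \<xi> (v \<xi> t))) (at t)"
    and S_le: "\<And>\<xi>. \<xi> \<in> S \<Longrightarrow> norm \<xi> \<le> R" "\<And>\<xi>. \<xi> \<in> S \<Longrightarrow> norm (v \<xi> 0) \<le> R"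
    and S_long: "\<And>\<xi>. \<xi> \<in> S \<Longrightarrow> longE \<xi> (v \<xi> 0) = 0" "\<And>\<xi>. \<xi> \<in> S \<Longrightarrow> longB \<xi> (v \<xi> 0) = 0"
begin

definition aE :: "3 \<Rightarrow> real^3 \<Rightarrow> real \<Rightarrow> complex" where
  "aE i \<xi> t = indicator S \<xi> * fst (v \<xi> t) $ i"

definition aB :: "3 \<Rightarrow> real^3 \<Rightarrow> real \<Rightarrow> complex" where
  "aB i \<xi> t = indicator S \<xi> * snd (v \<xi> t) $ i"

lemma bl_amplitudes: "band_limited (aE i) R R" "band_limited (aB i) R R"
proof -
  have c: "continuous_on UNIV (v \<xi>)" for \<xi>
    using flow by (auto intro!: continuous_at_imp_continuous_on has_vector_derivative_continuous)
  have cf: "continuous_on UNIV (\<lambda>t. fst (v \<xi> t) $ i)" "continuous_on UNIV (\<lambda>t. snd (v \<xi> t) $ i)" for \<xi>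
    by (intro continuous_intros continuous_on_component c)+
  have b: "norm (v \<xi> t) \<le> R" if "\<xi> \<in> S" for \<xi> t
    using S_le(2)[OF that] flow_norm[OF flow, of \<xi> t] by simp
  have bE: "cmod (aE i \<xi> t) \<le> R * indicator (cball 0 R) \<xi>" and bB: "cmod (aB i \<xi> t) \<le> R * indicator (cball 0 R) \<xi>" for \<xi> t
    using S_le(1)[of \<xi>] b[of \<xi> t] order_trans[OF cmod_field6_le(1) b[of \<xi> t], of i] order_trans[OF cmod_field6_le(2) b[of \<xi> t], of i]
    by (auto simp: aE_def aB_def indicator_def intro: order_trans[OF norm_ge_zero])
  show "band_limited (aE i) R R"
    unfolding band_limited_def
  proof (intro conjI allI)
    show "(\<lambda>\<xi>. aE i \<xi> t) \<in> borel_measurable borel" for t unfolding aE_def by measurable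
    show "continuous_on UNIV (aE i \<xi>)" for \<xi> unfolding aE_def[abs_def] by (intro continuous_intros cf)
  qed (rule bE)
  show "band_limited (aB i) R R"
    unfolding band_limited_def
  proof (intro conjI allI)
    show "(\<lambda>\<xi>. aB i \<xi> t) \<in> borel_measurable borel" for t unfolding aB_def by measurable
    show "continuous_on UNIV (aB i \<xi>)" for \<xi> unfolding aB_def[abs_def] by (intro continuous_intros cf)
  qed (rule bB)
qed

abbreviation "D j a \<equiv> (\<lambda>\<xi> t. \<i> * complex_of_real (\<xi>$j) * a \<xi> t)"

lemma amplitude_derivative:
  "(aE 1 \<xi> has_vector_derivative D 2 (aB 3) \<xi> t - D 3 (aB 2) \<xi> t) (at t)"
  "(aE 2 \<xi> has_vector_derivative D 3 (aB 1) \<xi> t - D 1 (aB 3) \<xi> t) (at t)"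
  "(aE 3 \<xi> has_vector_derivative D 1 (aB 2) \<xi> t - D 2 (aB 1) \<xi> t) (at t)"
  "(aB 1 \<xi> has_vector_derivative D 3 (aE 2) \<xi> t - D 2 (aE 3) \<xi> t) (at t)"
  "(aB 2 \<xi> has_vector_derivative D 1 (aE 3) \<xi> t - D 3 (aE 1) \<xi> t) (at t)"
  "(aB 3 \<xi> has_vector_derivative D 2 (aE 1) \<xi> t - D 1 (aE 2) \<xi> t) (at t)"
  unfolding aE_def[abs_def] aB_def[abs_def]
  by (rule has_vector_derivative_eq_rhs, rule bounded_linear.has_vector_derivative[OF bounded_linear_mult_right], rule flow_components[OF flow],
      simp add: algebra_simps)+

lemma synth_time_diff:
  assumes "band_limited a R R" "band_limited b M R" "band_limited c M' R"
    and "\<And>\<xi> t. (a \<xi> has_vector_derivative b \<xi> t - c \<xi> t) (at t)"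
  shows "(synth a x has_vector_derivative synth b x t - synth c x t) (at t)"
  using synth_time_derivative[OF assms(1) band_limited_diff[OF assms(2,3)] assms(4), of x t]
  unfolding synth_diff[OF assms(2,3)] .

lemmas synth_time =
  amplitude_derivative(1-3)[THEN synth_time_diff[rotated 3], OF bl_amplitudes(1)
    band_limited_deriv[OF bl_amplitudes(2)] band_limited_deriv[OF bl_amplitudes(2)]]
  amplitude_derivative(4-6)[THEN synth_time_diff[rotated 3], OF bl_amplitudes(2)
    band_limited_deriv[OF bl_amplitudes(1)] band_limited_deriv[OF bl_amplitudes(1)]]

lemma synth_div:
  "synth (D 1 (aE 1)) x t + synth (D 2 (aE 2)) x t + synth (D 3 (aE 3)) x t = 0"
  "synth (D 1 (aB 1)) x t + synth (D 2 (aB 2)) x t + synth (D 3 (aB 3)) x t = 0"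
proof -
  note n = band_limited_deriv[OF bl_amplitudes(1)] band_limited_deriv[OF bl_amplitudes(2)]
  have z: "synth (\<lambda>\<xi> t. 0) x t = 0" by (simp add: synth_def FT1_def)
  have "D 1 (aE 1) \<xi> t + D 2 (aE 2) \<xi> t + D 3 (aE 3) \<xi> t = 0" for \<xi> t
  proof -
    have "D 1 (aE 1) \<xi> t + D 2 (aE 2) \<xi> t + D 3 (aE 3) \<xi> t = \<i> * indicator S \<xi> * longE \<xi> (v \<xi> t)"
      by (simp add: aE_def longE_def sum_3 algebra_simps)
    then show ?thesis
      using S_long(1)[of \<xi>] flow_longitudinal(1)[OF flow, of \<xi> t] by (cases "\<xi> \<in> S") auto
  qed
  then show "synth (D 1 (aE 1)) x t + synth (D 2 (aE 2)) x t + synth (D 3 (aE 3)) x t = 0"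
    using z by (simp add: synth_add[OF n(1) n(1), symmetric] synth_add[OF band_limited_add[OF n(1) n(1)] n(1), symmetric])
  have "D 1 (aB 1) \<xi> t + D 2 (aB 2) \<xi> t + D 3 (aB 3) \<xi> t = 0" for \<xi> t
  proof -
    have "D 1 (aB 1) \<xi> t + D 2 (aB 2) \<xi> t + D 3 (aB 3) \<xi> t = \<i> * indicator S \<xi> * longB \<xi> (v \<xi> t)"
      by (simp add: aB_def longB_def sum_3 algebra_simps)
    then show ?thesis
      using S_long(2)[of \<xi>] flow_longitudinal(2)[OF flow, of \<xi> t] by (cases "\<xi> \<in> S") auto
  qed
  then show "synth (D 1 (aB 1)) x t + synth (D 2 (aB 2)) x t + synth (D 3 (aB 3)) x t = 0"
    using z by (simp add: synth_add[OF n(2) n(2), symmetric] synth_add[OF band_limited_add[OF n(2) n(2)] n(2), symmetric])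
qed

text \<open>One bound for fields, with amplitude at most \<open>R\<close>, and for first
  derivatives, with amplitude at most \<open>R * R\<close>. It secures integrability; the constant
  in \<open>morawetz\<close> does not depend on it.\<close>

definition L2_bound :: real where
  "L2_bound = ((\<integral>\<xi>. R\<^sup>2 * indicator (cball 0 R) \<xi> \<partial>(lborel :: (real^3) measure))
     + (\<integral>\<xi>. (R * R)\<^sup>2 * indicator (cball 0 R) \<xi> \<partial>(lborel :: (real^3) measure))) / (2 * pi) ^ 3"

text \<open>Meant for \<open>Re\<close> and \<open>Im\<close>: the physical system has real
  coefficients, so a real-linear functional of a complex solution solves it again, and one of norm
  at most 1 keeps the L2 bounds.\<close>

lemma maxwell_solution_part:
  fixes \<rho> :: "complex \<Rightarrow> real"
  assumes \<rho>: "bounded_linear \<rho>" and \<rho>_le: "\<And>z. \<bar>\<rho> z\<bar> \<le> cmod z"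
  shows "maxwell_solution (\<lambda>i x t. \<rho> (synth (aE i) x t)) (\<lambda>i x t. \<rho> (synth (aB i) x t))
    (\<lambda>i j x t. \<rho> (synth (D j (aE i)) x t)) (\<lambda>i j x t. \<rho> (synth (D j (aB i)) x t)) L2_bound"
proof -
  note nd = band_limited_deriv[OF bl_amplitudes(1)] band_limited_deriv[OF bl_amplitudes(2)]
  note lin = linear_simps[OF \<rho>]
  have cont: "continuous_on UNIV (\<lambda>(x, t). \<rho> (synth a x t))" if "band_limited a M R'" for a M R'
    using continuous_on_compose2[OF linear_continuous_on[OF \<rho>, of UNIV] continuous_synth[OF that]]
    by (simp add: case_prod_beta')
  have space: "((\<lambda>h. \<rho> (synth a (x + h *\<^sub>R axis j 1) t)) has_real_derivative \<rho> (synth (D j a) x t)) (at 0)"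
    if "band_limited a M R'" for a M R' x t j
    using bounded_linear.has_vector_derivative[OF \<rho> synth_space_derivative[OF that]]
    by (simp add: has_real_derivative_iff_has_vector_derivative)
  have time: "((\<lambda>t. \<rho> (synth a x t)) has_real_derivative \<rho> b - \<rho> c) (at t)"
    if "(synth a x has_vector_derivative b - c) (at t)" for a b c x t
    using bounded_linear.has_vector_derivative[OF \<rho> that] lin(2)[of b c]
    by (simp add: has_real_derivative_iff_has_vector_derivative)
  have sq: "integrable lborel (\<lambda>x. (\<rho> (synth a x t))\<^sup>2)" "(\<integral>x. (\<rho> (synth a x t))\<^sup>2 \<partial>lborel) \<le> L2_bound"
    if "band_limited a M R" "M = R \<or> M = R * R" for a M t
  proof -
    note s = sq_integrableD[OF sq_integrable_synth[OF that(1), of t]]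
    have le: "(\<rho> (synth a x t))\<^sup>2 \<le> (cmod (synth a x t))\<^sup>2" for x
      using power_mono[OF \<rho>_le[of "synth a x t"], of 2] by simp
    have [measurable]: "(\<lambda>x. \<rho> (synth a x t)) \<in> borel_measurable borel"
      by (rule borel_measurable_continuous_on[OF linear_continuous_on[OF \<rho>] s(1)])
    show i: "integrable lborel (\<lambda>x. (\<rho> (synth a x t))\<^sup>2)"
      by (rule Bochner_Integration.integrable_bound[OF s(2)]) (use le in auto)
    have "(\<integral>x. (\<rho> (synth a x t))\<^sup>2 \<partial>lborel) \<le> sqint (\<lambda>x. synth a x t)"
      unfolding sqint_def by (rule integral_mono[OF i s(2) le])
    also have "\<dots> \<le> (\<integral>\<xi>. M\<^sup>2 * indicator (cball 0 R) \<xi> \<partial>(lborel :: (real^3) measure)) / (2 * pi) ^ 3"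
      unfolding sqint_synth[OF that(1)] by (intro divide_right_mono sqint_band_limited_le[OF that(1)]) simp
    also have "\<dots> \<le> L2_bound"
      unfolding L2_bound_def using that(2) by (intro divide_right_mono) auto
    finally show "(\<integral>x. (\<rho> (synth a x t))\<^sup>2 \<partial>lborel) \<le> L2_bound" .
  qed
  have div: "\<rho> a + \<rho> b + \<rho> c = 0" if "a + b + c = 0" for a b c
    using that lin(1)[of "a + b" c] lin(1)[of a b] lin(3) by simp
  show ?thesis
    by unfold_locales
      (rule cont[OF bl_amplitudes(1)] cont[OF bl_amplitudes(2)] cont[OF nd(1)] cont[OF nd(2)] space[OF bl_amplitudes(1)] space[OF bl_amplitudes(2)]
        time[OF synth_time(1)] time[OF synth_time(2)] time[OF synth_time(3)] time[OF synth_time(4)] time[OF synth_time(5)] time[OF synth_time(6)]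
        div[OF synth_div(1)] div[OF synth_div(2)] sq[OF bl_amplitudes(1)] sq[OF bl_amplitudes(2)] sq[OF nd(1)] sq[OF nd(2)] disjI1[OF refl] disjI2[OF refl])+
qed

end

section \<open>Transversality\<close>

text \<open>Parseval's formula against an inverse transform. The duality in \<open>is_FT\<close>
  carries no conjugate, and conjugating \<open>FT1\<close> at \<open>-x\<close> gives
  \<open>FT1\<close> of the conjugate at \<open>x\<close>.\<close>

lemma is_FT_pairing:
  assumes ft: "is_FT f g" and i: "integrable lborel \<psi>" and b: "\<And>\<xi>. cmod (\<psi> \<xi>) \<le> M"
  shows "integrable lborel (\<lambda>x. f x * cnj (FT1 \<psi> (- x) / (2 * pi) ^ 3))"
    and "(\<integral>x. f x * cnj (FT1 \<psi> (- x) / (2 * pi) ^ 3) \<partial>lborel) = (\<integral>\<xi>. g \<xi> * cnj (\<psi> \<xi>) \<partial>lborel) / (2 * pi) ^ 3"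
proof -
  let ?\<phi> = "\<lambda>\<xi>. cnj (\<psi> \<xi>)"
  have i': "integrable lborel ?\<phi>" using i by simp
  have b': "cmod (?\<phi> \<xi>) \<le> M" for \<xi> using b by simp
  have s: "sq_integrable ?\<phi>" by (rule sq_integrable_bounded(1)[OF i' b'])
  have f: "sq_integrable f" using ft by (simp add: is_FT_def L2fun_iff)
  have eq: "f x * cnj (FT1 \<psi> (- x) / (2 * pi) ^ 3) = (f x * FT1 ?\<phi> x) / (2 * pi) ^ 3" for x
    using cnj_FT1[of \<psi> "- x"] by simp
  have I: "integrable lborel (\<lambda>x. f x * FT1 ?\<phi> x)"
    by (rule sq_integrable_mult[OF f sq_integrable_FT1_bounded[OF i' b']])
  then show "integrable lborel (\<lambda>x. f x * cnj (FT1 \<psi> (- x) / (2 * pi) ^ 3))"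
    unfolding eq by (rule integrable_divide_zero)
  have "(\<integral>x. f x * FT1 ?\<phi> x \<partial>lborel) = (\<integral>\<xi>. g \<xi> * cnj (\<psi> \<xi>) \<partial>lborel)"
    using ft[unfolded is_FT_def, THEN conjunct2, THEN conjunct2, rule_format, OF conjI[OF i' sq_integrableD(2)[OF s]]] by (rule sym)
  then show "(\<integral>x. f x * cnj (FT1 \<psi> (- x) / (2 * pi) ^ 3) \<partial>lborel) = (\<integral>\<xi>. g \<xi> * cnj (\<psi> \<xi>) \<partial>lborel) / (2 * pi) ^ 3"
    unfolding eq integral_divide_zero by simp
qed

text \<open>The test amplitude is a cutoff of the longitudinal component itself; orthogonality then
  says that the squared norm of the cutoff is 0. The cutoff is essential, as the factor
  \<open>\<xi>\<close> may destroy square integrability.\<close>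

lemma longitudinal_test:
  fixes U g :: "3 \<Rightarrow> real^3 \<Rightarrow> complex"
  assumes ft: "\<And>i. is_FT (U i) (g i)"
    and orth: "\<And>q M R. q \<in> borel_measurable borel \<Longrightarrow> (\<And>\<xi>. cmod (q \<xi>) \<le> M * indicator (cball 0 R) \<xi>) \<Longrightarrow>
      (\<integral>x. (\<Sum>i\<in>UNIV. U i x * cnj (FT1 (\<lambda>\<xi>. q \<xi> * complex_of_real (\<xi>$i)) (- x) / (2 * pi) ^ 3)) \<partial>lborel) = 0"
  shows "AE \<xi> in lborel. (\<Sum>i\<in>UNIV. complex_of_real (\<xi>$i) * g i \<xi>) = 0"
proof -
  have [measurable]: "g i \<in> borel_measurable borel" for i
    using ft[of i] by (auto simp: is_FT_def L2fun_def)
  define p where "p \<xi> = (\<Sum>i\<in>UNIV. complex_of_real (\<xi>$i) * g i \<xi>)" for \<xi> :: "real^3"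
  have [measurable]: "p \<in> borel_measurable borel" unfolding p_def by measurable
  have "AE \<xi> in lborel. cutoff n p \<xi> = 0" for n
  proof -
    have cb: "cmod (cutoff n p \<xi>) \<le> real n * indicator (cball 0 (real n)) \<xi>" for \<xi>
      by (auto simp: cutoff_def indicator_def)
    have [measurable]: "cutoff n p \<in> borel_measurable borel" by (rule borel_measurable_cutoff) measurable
    let ?\<psi> = "\<lambda>i \<xi>. cutoff n p \<xi> * complex_of_real (\<xi>$i)"
    have bs: "norm (?\<psi> i \<xi>) \<le> (real n * real n) * indicator (cball 0 (real n)) \<xi>" for i \<xi>
    proof (cases "\<xi> \<in> cball 0 (real n)")
      case True
      then have "\<bar>\<xi>$i\<bar> \<le> real n" using component_le_norm_cart[of \<xi> i] by simp
      then show ?thesis using cb[of \<xi>] True by (auto simp: norm_mult intro!: mult_mono)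
    qed (use cb[of \<xi>] in auto)
    have i\<psi>: "integrable lborel (?\<psi> i)" for i
      by (rule integrable_bounded_support[OF _ bs]) measurable
    have b\<psi>: "cmod (?\<psi> i \<xi>) \<le> real n * real n" for i \<xi>
      using order_trans[OF bs[of \<xi> i], of "real n * real n"] by (simp add: indicator_def)
    note P = is_FT_pairing[OF ft i\<psi> b\<psi>]
    have sg: "integrable lborel (\<lambda>\<xi>. g i \<xi> * cnj (?\<psi> i \<xi>))" for i
    proof -
      have "integrable lborel (\<lambda>\<xi>. cnj (?\<psi> i \<xi>))" using i\<psi>[of i] by (simp only: integrable_cnj)
      then have "sq_integrable (\<lambda>\<xi>. cnj (?\<psi> i \<xi>))"
        by (rule sq_integrable_bounded(1)[where M="real n * real n"]) (use b\<psi> in \<open>simp only: complex_mod_cnj\<close>)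
      then show ?thesis using ft[of i] by (intro sq_integrable_mult) (auto simp: is_FT_def L2fun_iff)
    qed
    have "0 = (\<Sum>i\<in>UNIV. (\<integral>\<xi>. g i \<xi> * cnj (?\<psi> i \<xi>) \<partial>lborel) / (2 * pi) ^ 3)"
      using orth[OF _ cb] P by (simp add: Bochner_Integration.integral_sum)
    also have "\<dots> = (\<integral>\<xi>. (\<Sum>i\<in>UNIV. g i \<xi> * cnj (?\<psi> i \<xi>)) \<partial>lborel) / (2 * pi) ^ 3"
      using sg by (simp only: sum_divide_distrib[symmetric] Bochner_Integration.integral_sum)
    also have "(\<integral>\<xi>. (\<Sum>i\<in>UNIV. g i \<xi> * cnj (?\<psi> i \<xi>)) \<partial>lborel) = (\<integral>\<xi>. complex_of_real ((cmod (cutoff n p \<xi>))\<^sup>2) \<partial>lborel)"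
    proof (rule Bochner_Integration.integral_cong[OF refl])
      fix \<xi>
      have "(\<Sum>i\<in>UNIV. g i \<xi> * cnj (?\<psi> i \<xi>)) = p \<xi> * cnj (cutoff n p \<xi>)"
        unfolding p_def sum_distrib_right by (intro sum.cong refl) (simp add: mult_ac)
      also have "\<dots> = complex_of_real ((cmod (cutoff n p \<xi>))\<^sup>2)" by (rule cutoff_mult) measurable
      finally show "(\<Sum>i\<in>UNIV. g i \<xi> * cnj (?\<psi> i \<xi>)) = complex_of_real ((cmod (cutoff n p \<xi>))\<^sup>2)" .
    qed
    also have "\<dots> = complex_of_real (sqint (cutoff n p))"
      unfolding sqint_def by (rule integral_complex_of_real)
    finally have "sqint (cutoff n p) = 0" by simp
    moreover have "sq_integrable (cutoff n p)"
      by (rule sq_integrable_bounded(1)[OF integrable_cutoff cutoff_le]) measurable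
    ultimately have "AE \<xi> in lborel. (cmod (cutoff n p \<xi>))\<^sup>2 = 0"
      unfolding sqint_def by (subst (asm) integral_nonneg_eq_0_iff_AE) (auto simp: sq_integrable_def)
    then show ?thesis by simp
  qed
  then have "AE \<xi> in lborel. \<forall>n. cutoff n p \<xi> = 0" by (simp add: AE_all_countable)
  then show ?thesis
  proof (rule AE_mp, intro AE_I2 impI)
    fix \<xi> assume z: "\<forall>n. cutoff n p \<xi> = 0"
    obtain N where "max (norm \<xi>) (cmod (p \<xi>)) \<le> real N" using real_arch_simple by blast
    then have "cutoff N p \<xi> = p \<xi>" by (simp add: cutoff_def)
    with z show "(\<Sum>i\<in>UNIV. complex_of_real (\<xi>$i) * g i \<xi>) = 0" by (simp add: p_def)
  qed
qed

lemma is_FT_longitudinal: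
  assumes [measurable]: "q \<in> borel_measurable borel" and b: "\<And>\<xi>. cmod (q \<xi>) \<le> M * indicator (cball 0 R) \<xi>"
  shows "is_FT (\<lambda>x. FT1 (\<lambda>\<xi>. q \<xi> * complex_of_real (\<xi>$i)) (- x) / (2 * pi) ^ 3) (\<lambda>\<xi>. q \<xi> * complex_of_real (\<xi>$i))"
proof -
  have bs: "cmod (q \<xi> * complex_of_real (\<xi>$i)) \<le> (M * R) * indicator (cball 0 R) \<xi>" for \<xi>
  proof (cases "\<xi> \<in> cball 0 R")
    case True
    then have "\<bar>\<xi>$i\<bar> \<le> R" using component_le_norm_cart[of \<xi> i] by simp
    moreover have "0 \<le> M" using order_trans[OF norm_ge_zero b[of \<xi>]] True by simp
    ultimately show ?thesis using b[of \<xi>] True by (auto simp: norm_mult intro!: mult_mono)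
  qed (use b[of \<xi>] in auto)
  have "integrable lborel (\<lambda>\<xi>. q \<xi> * complex_of_real (\<xi>$i))"
    by (rule integrable_bounded_support[OF _ bs]) measurable
  moreover have "cmod (q \<xi> * complex_of_real (\<xi>$i)) \<le> \<bar>M * R\<bar>" for \<xi>
    using bs[of \<xi>] by (cases "\<xi> \<in> cball 0 R") auto
  ultimately show ?thesis by (rule is_FT_inverse)
qed

text \<open>Kernel elements with amplitudes \<open>q\<close> and \<open>r\<close> along
  \<open>\<xi>\<close> are built by Fourier inversion; setting one of them to 0 separates the
  electric from the magnetic condition.\<close>

lemma transversal:
  assumes P: "in_range_I_minus_P u0" and ft: "is_FT6 u0 g"
  shows "AE \<xi> in lborel. longE \<xi> (g \<xi>) = 0" and "AE \<xi> in lborel. longB \<xi> (g \<xi>) = 0"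
proof -
  let ?w = "\<lambda>q i x. FT1 (\<lambda>\<xi>. q \<xi> * complex_of_real (\<xi>$i)) (- x) / (2 * pi) ^ 3"
  have orth: "(\<integral>x. cinner6 (u0 x) (\<chi> i. ?w q i x, \<chi> i. ?w r i x) \<partial>lborel) = 0"
    if q: "q \<in> borel_measurable borel" "\<And>\<xi>. cmod (q \<xi>) \<le> M * indicator (cball 0 R) \<xi>"
      and r: "r \<in> borel_measurable borel" "\<And>\<xi>. cmod (r \<xi>) \<le> N * indicator (cball 0 R) \<xi>" for q r M N R
  proof -
    have "is_FT6 (\<lambda>x. (\<chi> i. ?w q i x, \<chi> i. ?w r i x))
        (\<lambda>\<xi>. (\<chi> i. q \<xi> * complex_of_real (\<xi>$i), \<chi> i. r \<xi> * complex_of_real (\<xi>$i)))"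
      unfolding is_FT6_def using is_FT_longitudinal[OF q] is_FT_longitudinal[OF r] by simp
    then have "in_ker_maxwell (\<lambda>x. (\<chi> i. ?w q i x, \<chi> i. ?w r i x))"
      unfolding in_ker_maxwell_def by (intro exI conjI AE_I2) auto
    then show ?thesis using P by (simp add: in_range_I_minus_P_def)
  qed
  have z: "(\<lambda>\<xi>. 0) \<in> borel_measurable borel" "\<And>\<xi>. cmod 0 \<le> 0 * indicator (cball 0 R) \<xi>" for R :: real
    by simp_all
  have w0: "?w (\<lambda>\<xi>. 0) i x = 0" for i x by (simp add: FT1_def)
  show "AE \<xi> in lborel. longE \<xi> (g \<xi>) = 0"
    unfolding longE_def
  proof (rule longitudinal_test[where U="\<lambda>i x. fst (u0 x) $ i"])
    show "is_FT (\<lambda>x. fst (u0 x) $ i) (\<lambda>\<xi>. fst (g \<xi>) $ i)" for i using ft by (simp add: is_FT6_def)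
    show "(\<integral>x. (\<Sum>i\<in>UNIV. fst (u0 x) $ i * cnj (?w q i x)) \<partial>lborel) = 0"
      if q: "q \<in> borel_measurable borel" "\<And>\<xi>. cmod (q \<xi>) \<le> M * indicator (cball 0 R) \<xi>" for q M R
      using orth[OF q z] unfolding w0 by (simp add: cinner6_def)
  qed
  show "AE \<xi> in lborel. longB \<xi> (g \<xi>) = 0"
    unfolding longB_def
  proof (rule longitudinal_test[where U="\<lambda>i x. snd (u0 x) $ i"])
    show "is_FT (\<lambda>x. snd (u0 x) $ i) (\<lambda>\<xi>. snd (g \<xi>) $ i)" for i using ft by (simp add: is_FT6_def)
    show "(\<integral>x. (\<Sum>i\<in>UNIV. snd (u0 x) $ i * cnj (?w q i x)) \<partial>lborel) = 0"
      if q: "q \<in> borel_measurable borel" "\<And>\<xi>. cmod (q \<xi>) \<le> M * indicator (cball 0 R) \<xi>" for q M R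
      using orth[OF z q] unfolding w0 by (simp add: cinner6_def)
  qed
qed

section \<open>The estimate for truncated data\<close>

lemma (in maxwell_solution) measurable_weighted_energy:
  "(\<lambda>x. ennreal (bracket x powr (-s) * energy x t)) \<in> borel_measurable lborel"
  "(\<lambda>t. indicator {-T..T} t * (\<integral>\<^sup>+x. ennreal (bracket x powr (-s) * energy x t) \<partial>lborel)) \<in> borel_measurable lborel"
proof -
  have [measurable]: "bracket \<in> borel_measurable borel" using continuous_bracket by (rule borel_measurable_continuous_onI)
  show "(\<lambda>x. ennreal (bracket x powr (-s) * energy x t)) \<in> borel_measurable lborel"
    unfolding energy_def by measurable
  have "(\<lambda>p. bracket (snd p) powr (-s) * energy (snd p) (fst p)) \<in> borel_measurable (borel \<Otimes>\<^sub>M borel)"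
    unfolding energy_def by measurable
  then have "(\<lambda>(t, x). ennreal (bracket x powr (-s) * energy x t)) \<in> borel_measurable (borel \<Otimes>\<^sub>M lborel)"
    by (simp add: case_prod_beta' cong: measurable_cong_sets)
  from lborel.borel_measurable_nn_integral[OF this]
  show "(\<lambda>t. indicator {-T..T} t * (\<integral>\<^sup>+x. ennreal (bracket x powr (-s) * energy x t) \<partial>lborel)) \<in> borel_measurable lborel"
    by measurable
qed

context truncated_flow
begin

definition intensity :: "real^3 \<Rightarrow> real \<Rightarrow> real" where
  "intensity x t = (\<Sum>i\<in>UNIV. (cmod (synth (aE i) x t))\<^sup>2 + (cmod (synth (aB i) x t))\<^sup>2)"

text \<open>Plancherel transfers the total energy at time t to frequency space, where pointwise
  conservation of the norm moves it to time 0.\<close>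

lemma integral_intensity:
  "(\<integral>x. intensity x t \<partial>lborel) = (\<Sum>i\<in>UNIV. sqint (\<lambda>\<xi>. aE i \<xi> 0) + sqint (\<lambda>\<xi>. aB i \<xi> 0)) / (2 * pi) ^ 3"
proof -
  have sqa: "sq_integrable (\<lambda>\<xi>. aE i \<xi> t)" "sq_integrable (\<lambda>\<xi>. aB i \<xi> t)" for i t
    by (rule sq_integrable_bounded(1)[OF band_limitedD(5,4)[OF bl_amplitudes(1)]] sq_integrable_bounded(1)[OF band_limitedD(5,4)[OF bl_amplitudes(2)]])+
  have sum: "(\<Sum>i\<in>UNIV. sqint (\<lambda>\<xi>. aE i \<xi> t) + sqint (\<lambda>\<xi>. aB i \<xi> t)) = (\<integral>\<xi>. indicator S \<xi> * (norm (v \<xi> 0))\<^sup>2 \<partial>lborel)" for t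
  proof -
    have "(\<Sum>i\<in>UNIV. sqint (\<lambda>\<xi>. aE i \<xi> t) + sqint (\<lambda>\<xi>. aB i \<xi> t)) = (\<integral>\<xi>. (\<Sum>i\<in>UNIV. (cmod (aE i \<xi> t))\<^sup>2 + (cmod (aB i \<xi> t))\<^sup>2) \<partial>lborel)"
      unfolding sqint_def using sqa[THEN sq_integrableD(2)] by simp
    also have "\<dots> = (\<integral>\<xi>. indicator S \<xi> * (norm (v \<xi> 0))\<^sup>2 \<partial>lborel)"
    proof (rule Bochner_Integration.integral_cong[OF refl])
      fix \<xi>
      have "(norm (v \<xi> 0))\<^sup>2 = (norm (v \<xi> t))\<^sup>2" using flow_norm[OF flow, of \<xi> t] by simp
      then show "(\<Sum>i\<in>UNIV. (cmod (aE i \<xi> t))\<^sup>2 + (cmod (aB i \<xi> t))\<^sup>2) = indicator S \<xi> * (norm (v \<xi> 0))\<^sup>2"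
        unfolding norm_field6[of "v \<xi> t"] by (cases "\<xi> \<in> S") (simp_all add: aE_def aB_def)
    qed
    finally show ?thesis .
  qed
  have "(\<integral>x. intensity x t \<partial>lborel) = (\<Sum>i\<in>UNIV. sqint (\<lambda>x. synth (aE i) x t) + sqint (\<lambda>x. synth (aB i) x t))"
    unfolding intensity_def sqint_def
    using sq_integrableD(2)[OF sq_integrable_synth[OF bl_amplitudes(1)]] sq_integrableD(2)[OF sq_integrable_synth[OF bl_amplitudes(2)]] by simp
  also have "\<dots> = (\<Sum>i\<in>UNIV. sqint (\<lambda>\<xi>. aE i \<xi> t) + sqint (\<lambda>\<xi>. aB i \<xi> t)) / (2 * pi) ^ 3"
    unfolding sqint_synth[OF bl_amplitudes(1)] sqint_synth[OF bl_amplitudes(2)] by (simp only: sum_divide_distrib add_divide_distrib)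
  finally show ?thesis unfolding sum .
qed

text \<open>The intensity is the sum of the energies of the real and imaginary parts. Each obeys the
  Morawetz bound, and the two end times carry the same total energy, so \<open>2 * s\<close> becomes
  \<open>4 * s\<close>.\<close>

lemma truncated_morawetz:
  assumes s: "s > 1/2" and T: "0 \<le> T"
  shows "(\<integral>\<^sup>+t. indicator {-T..T} t * (\<integral>\<^sup>+x. ennreal (bracket x powr (-s) * intensity x t) \<partial>lborel) \<partial>lborel)
    \<le> ennreal (4 * s / (2 * s - 1) * ((\<Sum>i\<in>UNIV. sqint (\<lambda>\<xi>. aE i \<xi> 0) + sqint (\<lambda>\<xi>. aB i \<xi> 0)) / (2 * pi) ^ 3))" (is "?L \<le> ?R")
    and "(\<lambda>t. indicator {-T..T} t * (\<integral>\<^sup>+x. ennreal (bracket x powr (-s) * intensity x t) \<partial>lborel)) \<in> borel_measurable lborel"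
proof -
  interpret re: maxwell_solution "\<lambda>i x t. Re (synth (aE i) x t)" "\<lambda>i x t. Re (synth (aB i) x t)"
    "\<lambda>i j x t. Re (synth (D j (aE i)) x t)" "\<lambda>i j x t. Re (synth (D j (aB i)) x t)" L2_bound
    by (rule maxwell_solution_part[OF bounded_linear_Re abs_Re_le_cmod])
  interpret im: maxwell_solution "\<lambda>i x t. Im (synth (aE i) x t)" "\<lambda>i x t. Im (synth (aB i) x t)"
    "\<lambda>i j x t. Im (synth (D j (aE i)) x t)" "\<lambda>i j x t. Im (synth (D j (aB i)) x t)" L2_bound
    by (rule maxwell_solution_part[OF bounded_linear_Im abs_Im_le_cmod])
  have dens: "intensity x t = re.energy x t + im.energy x t" for x t
    by (simp add: intensity_def re.energy_def im.energy_def cmod_power2 sum.distrib)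
  let ?r = "\<lambda>t. indicator {-T..T} t * (\<integral>\<^sup>+x. ennreal (bracket x powr (-s) * re.energy x t) \<partial>lborel)"
  let ?i = "\<lambda>t. indicator {-T..T} t * (\<integral>\<^sup>+x. ennreal (bracket x powr (-s) * im.energy x t) \<partial>lborel)"
  have split: "indicator {-T..T} t * (\<integral>\<^sup>+x. ennreal (bracket x powr (-s) * intensity x t) \<partial>lborel) = ?r t + ?i t" for t
  proof -
    have "(\<integral>\<^sup>+x. ennreal (bracket x powr (-s) * intensity x t) \<partial>lborel)
       = (\<integral>\<^sup>+x. ennreal (bracket x powr (-s) * re.energy x t) + ennreal (bracket x powr (-s) * im.energy x t) \<partial>lborel)"
      by (intro nn_integral_cong) (simp add: dens distrib_left ennreal_plus re.energy_nonneg im.energy_nonneg)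
    also have "\<dots> = (\<integral>\<^sup>+x. ennreal (bracket x powr (-s) * re.energy x t) \<partial>lborel) + (\<integral>\<^sup>+x. ennreal (bracket x powr (-s) * im.energy x t) \<partial>lborel)"
      by (rule nn_integral_add[OF re.measurable_weighted_energy(1) im.measurable_weighted_energy(1)])
    finally show ?thesis by (simp add: distrib_left)
  qed
  show "(\<lambda>t. indicator {-T..T} t * (\<integral>\<^sup>+x. ennreal (bracket x powr (-s) * intensity x t) \<partial>lborel)) \<in> borel_measurable lborel"
    unfolding split by (intro borel_measurable_add re.measurable_weighted_energy(2) im.measurable_weighted_energy(2))
  have tot: "(\<integral>x. re.energy x t \<partial>lborel) + (\<integral>x. im.energy x t \<partial>lborel)
     = (\<Sum>i\<in>UNIV. sqint (\<lambda>\<xi>. aE i \<xi> 0) + sqint (\<lambda>\<xi>. aB i \<xi> 0)) / (2 * pi) ^ 3" for t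
    unfolding integral_intensity[of t, symmetric] dens
    by (simp add: re.energy_integrable im.energy_integrable)
  have nn: "0 \<le> (\<integral>x. re.energy x t \<partial>lborel)" "0 \<le> (\<integral>x. im.energy x t \<partial>lborel)" for t
    by (auto intro!: integral_nonneg_AE simp: re.energy_nonneg im.energy_nonneg)
  let ?c = "2 * s / (2 * s - 1)"
  have c: "0 \<le> ?c" using s by simp
  have "?L = (\<integral>\<^sup>+t. ?r t \<partial>lborel) + (\<integral>\<^sup>+t. ?i t \<partial>lborel)"
    unfolding split by (rule nn_integral_add[OF re.measurable_weighted_energy(2) im.measurable_weighted_energy(2)])
  also have "\<dots> \<le> ennreal (?c * ((\<integral>x. re.energy x T \<partial>lborel) + (\<integral>x. re.energy x (-T) \<partial>lborel)))
      + ennreal (?c * ((\<integral>x. im.energy x T \<partial>lborel) + (\<integral>x. im.energy x (-T) \<partial>lborel)))"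
    by (intro add_mono re.morawetz im.morawetz s T)
  also have "\<dots> = ennreal (?c * ((\<integral>x. re.energy x T \<partial>lborel) + (\<integral>x. re.energy x (-T) \<partial>lborel))
      + ?c * ((\<integral>x. im.energy x T \<partial>lborel) + (\<integral>x. im.energy x (-T) \<partial>lborel)))"
    using c nn by (intro ennreal_plus[symmetric] mult_nonneg_nonneg add_nonneg_nonneg)
  also have "?c * ((\<integral>x. re.energy x T \<partial>lborel) + (\<integral>x. re.energy x (-T) \<partial>lborel))
      + ?c * ((\<integral>x. im.energy x T \<partial>lborel) + (\<integral>x. im.energy x (-T) \<partial>lborel))
    = ?c * (((\<integral>x. re.energy x T \<partial>lborel) + (\<integral>x. im.energy x T \<partial>lborel)) + ((\<integral>x. re.energy x (-T) \<partial>lborel) + (\<integral>x. im.energy x (-T) \<partial>lborel)))"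
    by (simp only: distrib_left add_ac)
  also have "\<dots> = 4 * s / (2 * s - 1) * ((\<Sum>i\<in>UNIV. sqint (\<lambda>\<xi>. aE i \<xi> 0) + sqint (\<lambda>\<xi>. aB i \<xi> 0)) / (2 * pi) ^ 3)"
    unfolding tot by simp
  finally show "?L \<le> ?R" .
qed

end

section \<open>Passage to the limit\<close>

text \<open>The error is moved to the left by subtraction in \<open>ennreal\<close>, which is
  continuous here because \<open>F\<close> is finite.\<close>

lemma ennreal_le_liminf_perturbed:
  fixes F :: ennreal and G e :: "nat \<Rightarrow> ennreal"
  assumes fin: "F \<noteq> top" and le: "eventually (\<lambda>n. F \<le> G n + e n) sequentially" and e: "e \<longlonglongrightarrow> 0"
  shows "F \<le> liminf G"
  unfolding le_Liminf_iff
proof (intro allI impI)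
  fix y assume y: "y < F"
  have "(\<lambda>n. F - e n) \<longlonglongrightarrow> F - 0"
    using fin by (intro tendsto_diff_ennreal tendsto_const e) auto
  then have "eventually (\<lambda>n. y < F - e n) sequentially" using y by (auto dest: order_tendstoD)
  with le show "eventually (\<lambda>n. y < G n) sequentially"
  proof eventually_elim
    case (elim n)
    then have "F - e n \<le> G n" using fin by (simp add: ennreal_minus_le_iff add.commute)
    with elim show ?case by (simp add: less_le_trans)
  qed
qed

lemma nn_integral_field6:
  assumes "\<And>i. sq_integrable (\<lambda>x. fst (f x) $ i)" "\<And>i. sq_integrable (\<lambda>x. snd (f x) $ i)"
  shows "(\<integral>\<^sup>+x. ennreal ((norm (f x))\<^sup>2) \<partial>lborel)
    = ennreal (\<Sum>i\<in>(UNIV :: 3 set). sqint (\<lambda>x. fst (f x) $ i) + sqint (\<lambda>x. snd (f x) $ i))"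
proof -
  have i: "integrable lborel (\<lambda>x. (\<Sum>i\<in>UNIV. (cmod (fst (f x) $ i))\<^sup>2 + (cmod (snd (f x) $ i))\<^sup>2))"
    by (intro Bochner_Integration.integrable_sum Bochner_Integration.integrable_add assms[THEN sq_integrableD(2)])
  show ?thesis
    unfolding norm_field6
    by (subst nn_integral_eq_integral[OF i])
       (auto intro!: sum_nonneg simp: sqint_def assms[THEN sq_integrableD(2)])
qed

lemma bracket_powr_le_1: "0 \<le> s \<Longrightarrow> bracket x powr (-s) \<le> 1"
  using powr_mono[of "-s" 0 "bracket x"] bracket_ge_1[of x] by simp

text \<open>Costs a factor 2 in the final constant, but makes any further discussion of convergence of the
  weighted norms unnecessary.\<close>
lemma norm_sq_le_twice: "(norm (x::'a::real_normed_vector))\<^sup>2 \<le> 2 * (norm y)\<^sup>2 + 2 * (norm (x - y))\<^sup>2"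
proof -
  have "(norm x)\<^sup>2 \<le> (norm y + norm (x - y))\<^sup>2"
    by (intro power_mono norm_triangle_sub) simp
  also have "\<dots> \<le> 2 * (norm y)\<^sup>2 + 2 * (norm (x - y))\<^sup>2"
    using two_mult_le_squares[of "norm y" "norm (x - y)"] by (simp add: power2_sum)
  finally show ?thesis .
qed

text \<open>The function of t under the outer integral is not known to be measurable. It is
  therefore compared, for each single t, with the lower limit of measurable functions
  \<open>G n\<close>; monotonicity of the integral requires no measurability, and Fatou's lemma is
  applied to \<open>G n\<close> alone.\<close>

lemma kato_smoothing:
  fixes u0 :: "real^3 \<Rightarrow> field6" and u :: "real^3 \<Rightarrow> real \<Rightarrow> field6"
  assumes s: "s > 1/2" and P: "in_range_I_minus_P u0" and ft0: "is_FT6 u0 u0hat"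
    and fl: "maxwell_fourier_flow u0hat v" and ft: "\<And>t. is_FT6 (\<lambda>x. u x t) (\<lambda>\<xi>. v \<xi> t)"
  shows "(\<integral>\<^sup>+t. (\<integral>\<^sup>+x. ennreal (bracket x powr (-s) * (norm (u x t))\<^sup>2) \<partial>lborel) \<partial>lborel)
    \<le> ennreal (8 * s / (2 * s - 1)) * (\<integral>\<^sup>+x. ennreal ((norm (u0 x))\<^sup>2) \<partial>lborel)"
proof -
  have v0: "v \<xi> 0 = u0hat \<xi>" and flow: "(v \<xi> has_vector_derivative cscale6 (- \<i>) (maxwell_symbol \<xi> (v \<xi> t))) (at t)" for \<xi> t
    using fl by (auto simp: maxwell_fourier_flow_def)
  have ftE: "is_FT (\<lambda>x. fst (u x t) $ i) (\<lambda>\<xi>. fst (v \<xi> t) $ i)"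
    and ftB: "is_FT (\<lambda>x. snd (u x t) $ i) (\<lambda>\<xi>. snd (v \<xi> t) $ i)" for t i
    using ft[of t] by (auto simp: is_FT6_def)
  have ftE0: "is_FT (\<lambda>x. fst (u0 x) $ i) (\<lambda>\<xi>. fst (v \<xi> 0) $ i)"
    and ftB0: "is_FT (\<lambda>x. snd (u0 x) $ i) (\<lambda>\<xi>. snd (v \<xi> 0) $ i)" for i
    using ft0 by (auto simp: is_FT6_def v0)
  have sqv: "sq_integrable (\<lambda>\<xi>. fst (v \<xi> t) $ i)" "sq_integrable (\<lambda>\<xi>. snd (v \<xi> t) $ i)"
    and squ: "sq_integrable (\<lambda>x. fst (u x t) $ i)" "sq_integrable (\<lambda>x. snd (u x t) $ i)" for t i
    using ftE[where t=t and i=i] ftB[where t=t and i=i] by (auto simp: is_FT_def L2fun_iff)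
  have squ0: "sq_integrable (\<lambda>x. fst (u0 x) $ i)" "sq_integrable (\<lambda>x. snd (u0 x) $ i)" for i
    using ftE0[where i=i] ftB0[where i=i] by (auto simp: is_FT_def L2fun_iff)
  have vm[measurable]: "(\<lambda>\<xi>. fst (v \<xi> t) $ i) \<in> borel_measurable borel" "(\<lambda>\<xi>. snd (v \<xi> t) $ i) \<in> borel_measurable borel" for t i
    using sqv[THEN sq_integrableD(1)] by auto
  have [measurable]: "bracket \<in> borel_measurable borel" using continuous_bracket by (rule borel_measurable_continuous_onI)
  define Q where "Q = (\<Sum>i\<in>(UNIV :: 3 set). sqint (\<lambda>x. fst (u0 x) $ i) + sqint (\<lambda>x. snd (u0 x) $ i))"
  have Q: "(\<integral>\<^sup>+x. ennreal ((norm (u0 x))\<^sup>2) \<partial>lborel) = ennreal Q"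
    unfolding Q_def by (rule nn_integral_field6[OF squ0])
  have Q0: "0 \<le> Q" unfolding Q_def by (intro sum_nonneg add_nonneg_nonneg sqint_nonneg)

  define S where "S n = {\<xi>. norm \<xi> \<le> real n \<and> norm (v \<xi> 0) \<le> real n \<and> longE \<xi> (v \<xi> 0) = 0 \<and> longB \<xi> (v \<xi> 0) = 0}" for n
  \<comment> \<open>Measurability of \<open>v\<close> is known only for its components, so the norm
    is expressed through them.\<close>
  have normv: "norm (v \<xi> 0) = sqrt (\<Sum>i\<in>UNIV. (cmod (fst (v \<xi> 0) $ i))\<^sup>2 + (cmod (snd (v \<xi> 0) $ i))\<^sup>2)" for \<xi>
    unfolding norm_field6[symmetric] by simp
  have S_meas: "S n \<in> sets borel" for n
    unfolding S_def longE_def longB_def normv by measurable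
  interpret tf: truncated_flow v "S n" "real n" for n
    by unfold_locales (use S_meas vm flow in \<open>auto simp: S_def\<close>)
  \<comment> \<open>The orthogonality of the data to the kernel enters here: outside a null set,
    every frequency is eventually kept, so the truncation loses nothing in the limit.\<close>
  have AE_S: "AE \<xi> in lborel. eventually (\<lambda>n. \<xi> \<in> S n) sequentially"
    using transversal[OF P ft0]
  proof eventually_elim
    case (elim \<xi>)
    obtain N where "max (norm \<xi>) (norm (v \<xi> 0)) \<le> real N" using real_arch_simple by blast
    then show ?case
      using elim by (intro eventually_sequentiallyI[of N]) (auto simp: S_def v0)
  qed

  have le_Q: "(\<Sum>i\<in>UNIV. sqint (\<lambda>\<xi>. tf.aE n i \<xi> 0) + sqint (\<lambda>\<xi>. tf.aB n i \<xi> 0)) / (2 * pi) ^ 3 \<le> Q" for n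
  proof -
    have *: "sqint (\<lambda>\<xi>. indicator (S n) \<xi> * g \<xi>) \<le> (2 * pi) ^ 3 * sqint f" if "is_FT f g" for f g
    proof -
      have g: "sq_integrable g" using that by (simp add: is_FT_def L2fun_iff)
      have [measurable]: "g \<in> borel_measurable borel" "S n \<in> sets borel" using g S_meas by (auto simp: sq_integrable_def)
      have le: "(cmod (indicator (S n) \<xi> * g \<xi>))\<^sup>2 \<le> (cmod (g \<xi>))\<^sup>2" for \<xi> by (auto simp: indicator_def)
      have "integrable lborel (\<lambda>\<xi>. (cmod (indicator (S n) \<xi> * g \<xi>))\<^sup>2)"
        by (rule Bochner_Integration.integrable_bound[OF sq_integrableD(2)[OF g]]) (use le in auto)
      then have "sqint (\<lambda>\<xi>. indicator (S n) \<xi> * g \<xi>) \<le> sqint g"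
        unfolding sqint_def by (rule integral_mono[OF _ sq_integrableD(2)[OF g] le])
      also have "\<dots> \<le> (2 * pi) ^ 3 * sqint f" by (rule is_FT_sqint_le[OF that])
      finally show ?thesis .
    qed
    have "(\<Sum>i\<in>UNIV. sqint (\<lambda>\<xi>. tf.aE n i \<xi> 0) + sqint (\<lambda>\<xi>. tf.aB n i \<xi> 0)) \<le> (2 * pi) ^ 3 * Q"
      unfolding Q_def sum_distrib_left distrib_left tf.aE_def tf.aB_def
      by (intro sum_mono add_mono * ftE0 ftB0)
    then show ?thesis by (simp add: field_simps)
  qed

  define c where "c = 4 * s / (2 * s - 1)"
  have c: "0 \<le> c" using s by (simp add: c_def)
  \<comment> \<open>The time window grows together with the truncation, so one lower limit exhausts
    both. The factor 2 is the price of splitting the square of the norm.\<close>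
  define G where "G n t = 2 * (indicator {- real n..real n} t * (\<integral>\<^sup>+x. ennreal (bracket x powr (-s) * tf.intensity n x t) \<partial>lborel))" for n t
  have Gm: "G n \<in> borel_measurable lborel" for n
    unfolding G_def[abs_def] using tf.truncated_morawetz(2)[OF s, of "real n" n] by measurable
  have Gle: "(\<integral>\<^sup>+t. G n t \<partial>lborel) \<le> ennreal (2 * (c * Q))" for n
  proof -
    have "(\<integral>\<^sup>+t. G n t \<partial>lborel) = 2 * (\<integral>\<^sup>+t. indicator {- real n..real n} t * (\<integral>\<^sup>+x. ennreal (bracket x powr (-s) * tf.intensity n x t) \<partial>lborel) \<partial>lborel)"
      unfolding G_def by (rule nn_integral_cmult[OF tf.truncated_morawetz(2)[OF s]]) simp
    also have "\<dots> \<le> 2 * ennreal (c * Q)"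
      using order_trans[OF tf.truncated_morawetz(1)[OF s, of "real n" n] ennreal_leI[OF mult_left_mono[OF le_Q[of n] c, unfolded c_def]]]
      by (intro mult_left_mono) (simp_all add: c_def)
    also have "\<dots> = ennreal (2 * (c * Q))"
      using ennreal_mult[of 2 "c * Q"] c Q0 by simp
    finally show ?thesis .
  qed

  \<comment> \<open>The truncation error at a fixed time in the unweighted norm; this suffices
    because the weight is at most 1.\<close>
  define e where "e n t = (\<Sum>i\<in>UNIV. sqint (\<lambda>x. fst (u x t) $ i - synth (tf.aE n i) x t) + sqint (\<lambda>x. snd (u x t) $ i - synth (tf.aB n i) x t))" for n t
  have e_lim: "(\<lambda>n. e n t) \<longlonglongrightarrow> 0" for t
  proof -
    have *: "(\<lambda>n. sqint (\<lambda>\<xi>. g \<xi> - indicator (S n) \<xi> * g \<xi>)) \<longlonglongrightarrow> 0" if g: "sq_integrable g" for g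
    proof -
      have [measurable]: "g \<in> borel_measurable borel" "S n \<in> sets borel" for n using g S_meas by (auto simp: sq_integrable_def)
      have "(\<lambda>n. sqint (\<lambda>\<xi>. g \<xi> - indicator (S n) \<xi> * g \<xi>)) \<longlonglongrightarrow> (\<integral>\<xi>. 0 \<partial>(lborel :: (real^3) measure))"
        unfolding sqint_def
      proof (rule integral_dominated_convergence[OF _ _ sq_integrableD(2)[OF g]])
        show "AE \<xi> in lborel. (\<lambda>n. (cmod (g \<xi> - indicator (S n) \<xi> * g \<xi>))\<^sup>2) \<longlonglongrightarrow> 0"
          using AE_S
        proof eventually_elim
          case (elim \<xi>)
          then have "eventually (\<lambda>n. (cmod (g \<xi> - indicator (S n) \<xi> * g \<xi>))\<^sup>2 = 0) sequentially"
            by (rule eventually_mono) simp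
          then show ?case by (rule tendsto_eventually)
        qed
        show "AE \<xi> in lborel. norm ((cmod (g \<xi> - indicator (S n) \<xi> * g \<xi>))\<^sup>2) \<le> (cmod (g \<xi>))\<^sup>2" for n
          by (intro AE_I2) (auto simp: indicator_def)
      qed measurable
      then show ?thesis by simp
    qed
    have E: "sqint (\<lambda>x. fst (u x t) $ i - synth (tf.aE n i) x t) = sqint (\<lambda>\<xi>. fst (v \<xi> t) $ i - indicator (S n) \<xi> * fst (v \<xi> t) $ i) / (2 * pi) ^ 3" for n i
      using is_FT_sqint_eq[OF is_FT_diff[OF ftE is_FT_synth[OF tf.bl_amplitudes(1)]]] by (simp add: tf.aE_def)
    have B: "sqint (\<lambda>x. snd (u x t) $ i - synth (tf.aB n i) x t) = sqint (\<lambda>\<xi>. snd (v \<xi> t) $ i - indicator (S n) \<xi> * snd (v \<xi> t) $ i) / (2 * pi) ^ 3" for n i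
      using is_FT_sqint_eq[OF is_FT_diff[OF ftB is_FT_synth[OF tf.bl_amplitudes(2)]]] by (simp add: tf.aB_def)
    have "(\<lambda>n. e n t) \<longlonglongrightarrow> (\<Sum>i\<in>(UNIV :: 3 set). 0 / (2 * pi) ^ 3 + 0 / (2 * pi) ^ 3)"
      unfolding e_def E B by (intro tendsto_sum tendsto_add tendsto_divide * sqv tendsto_const) auto
    then show ?thesis by simp
  qed

  let ?F = "\<lambda>t. \<integral>\<^sup>+x. ennreal (bracket x powr (-s) * (norm (u x t))\<^sup>2) \<partial>lborel"
  have F_le: "?F t \<le> liminf (\<lambda>n. G n t)" for t
  proof (rule ennreal_le_liminf_perturbed[where e="\<lambda>n. ennreal (2 * e n t)"])
    have w1: "bracket x powr (-s) \<le> 1" for x using s by (intro bracket_powr_le_1) simp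
    have "?F t \<le> (\<integral>\<^sup>+x. ennreal ((norm (u x t))\<^sup>2) \<partial>lborel)"
      by (intro nn_integral_mono ennreal_leI mult_left_le_one_le w1) auto
    also have "\<dots> < top" unfolding nn_integral_field6[OF squ] by simp
    finally show "?F t \<noteq> top" by simp
    have "(\<lambda>n. ennreal (2 * e n t)) \<longlonglongrightarrow> ennreal (2 * 0)"
      by (intro tendsto_ennrealI tendsto_intros e_lim)
    then show "(\<lambda>n. ennreal (2 * e n t)) \<longlonglongrightarrow> 0" by simp
    \<comment> \<open>From this index on the window contains t, so the indicator in
      \<open>G n t\<close> equals 1.\<close>
    obtain N where N: "\<bar>t\<bar> \<le> real N" using real_arch_simple by blast
    show "eventually (\<lambda>n. ?F t \<le> G n t + ennreal (2 * e n t)) sequentially"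
    proof (rule eventually_sequentiallyI[of N])
      fix n assume n: "N \<le> n"
      define d where "d x = (\<Sum>i\<in>UNIV. (cmod (fst (u x t) $ i - synth (tf.aE n i) x t))\<^sup>2 + (cmod (snd (u x t) $ i - synth (tf.aB n i) x t))\<^sup>2)" for x
      have sd: "sq_integrable (\<lambda>x. fst (u x t) $ i - synth (tf.aE n i) x t)" "sq_integrable (\<lambda>x. snd (u x t) $ i - synth (tf.aB n i) x t)" for i
        by (intro sq_integrable_diff squ sq_integrable_synth[OF tf.bl_amplitudes(1)] sq_integrable_synth[OF tf.bl_amplitudes(2)])+
      have id: "integrable lborel d" and ed: "(\<integral>x. d x \<partial>lborel) = e n t"
        unfolding d_def e_def sqint_def using sd[THEN sq_integrableD(2)] by simp_all
      have [measurable]: "d \<in> borel_measurable borel" using id by auto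
      have d0: "0 \<le> d x" for x unfolding d_def by (intro sum_nonneg) auto
      have dens0: "0 \<le> tf.intensity n x t" for x unfolding tf.intensity_def by (intro sum_nonneg) auto
      have [measurable]: "(\<lambda>x. tf.intensity n x t) \<in> borel_measurable borel"
        unfolding tf.intensity_def
        using sq_integrableD(1)[OF sq_integrable_synth[OF tf.bl_amplitudes(1)]] sq_integrableD(1)[OF sq_integrable_synth[OF tf.bl_amplitudes(2)]]
        by measurable
      have pt: "(norm (u x t))\<^sup>2 \<le> 2 * tf.intensity n x t + 2 * d x" for x
      proof -
        have "(norm (u x t))\<^sup>2 \<le> (\<Sum>i\<in>UNIV. (2 * (cmod (synth (tf.aE n i) x t))\<^sup>2 + 2 * (cmod (fst (u x t) $ i - synth (tf.aE n i) x t))\<^sup>2)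
          + (2 * (cmod (synth (tf.aB n i) x t))\<^sup>2 + 2 * (cmod (snd (u x t) $ i - synth (tf.aB n i) x t))\<^sup>2))"
          unfolding norm_field6 by (intro sum_mono add_mono norm_sq_le_twice)
        also have "\<dots> = 2 * tf.intensity n x t + 2 * d x"
          unfolding tf.intensity_def d_def by (simp add: sum.distrib sum_distrib_left algebra_simps)
        finally show ?thesis .
      qed
      have "?F t \<le> (\<integral>\<^sup>+x. 2 * ennreal (bracket x powr (-s) * tf.intensity n x t) + ennreal (2 * d x) \<partial>lborel)"
      proof (rule nn_integral_mono)
        fix x
        have "bracket x powr (-s) * (norm (u x t))\<^sup>2 \<le> bracket x powr (-s) * (2 * tf.intensity n x t + 2 * d x)"
          by (intro mult_left_mono pt) simp
        also have "\<dots> \<le> 2 * (bracket x powr (-s) * tf.intensity n x t) + 2 * d x"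
          using mult_right_mono[OF w1[of x], of "2 * d x"] d0[of x] by (simp add: algebra_simps)
        finally have "ennreal (bracket x powr (-s) * (norm (u x t))\<^sup>2) \<le> ennreal (2 * (bracket x powr (-s) * tf.intensity n x t) + 2 * d x)"
          by (rule ennreal_leI)
        also have "\<dots> = ennreal (2 * (bracket x powr (-s) * tf.intensity n x t)) + ennreal (2 * d x)"
          using dens0 d0 by (intro ennreal_plus) auto
        also have "ennreal (2 * (bracket x powr (-s) * tf.intensity n x t)) = 2 * ennreal (bracket x powr (-s) * tf.intensity n x t)"
          using ennreal_mult'[of 2 "bracket x powr (-s) * tf.intensity n x t"] by simp
        finally show "ennreal (bracket x powr (-s) * (norm (u x t))\<^sup>2) \<le> 2 * ennreal (bracket x powr (-s) * tf.intensity n x t) + ennreal (2 * d x)" .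
      qed
      also have "\<dots> = (\<integral>\<^sup>+x. 2 * ennreal (bracket x powr (-s) * tf.intensity n x t) \<partial>lborel) + (\<integral>\<^sup>+x. ennreal (2 * d x) \<partial>lborel)"
        by (rule nn_integral_add) measurable
      also have "(\<integral>\<^sup>+x. 2 * ennreal (bracket x powr (-s) * tf.intensity n x t) \<partial>lborel) = 2 * (\<integral>\<^sup>+x. ennreal (bracket x powr (-s) * tf.intensity n x t) \<partial>lborel)"
        by (rule nn_integral_cmult) measurable
      also have "\<dots> = G n t"
        using N n unfolding G_def by (auto simp: indicator_def abs_le_iff)
      also have "(\<integral>\<^sup>+x. ennreal (2 * d x) \<partial>lborel) = ennreal (2 * e n t)"
        using id d0 by (subst nn_integral_eq_integral) (auto simp: ed)
      finally show "?F t \<le> G n t + ennreal (2 * e n t)" .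
    qed
  qed
  have "(\<integral>\<^sup>+t. ?F t \<partial>lborel) \<le> (\<integral>\<^sup>+t. liminf (\<lambda>n. G n t) \<partial>lborel)"
    by (intro nn_integral_mono F_le)
  also have "\<dots> \<le> liminf (\<lambda>n. \<integral>\<^sup>+t. G n t \<partial>lborel)"
    by (rule nn_integral_liminf[OF Gm])
  also have "\<dots> \<le> liminf (\<lambda>n::nat. ennreal (2 * (c * Q)))"
    by (intro Liminf_mono always_eventually allI Gle)
  also have "\<dots> = ennreal (2 * (c * Q))" by (simp add: Liminf_const)
  \<comment> \<open>Here \<open>2 * c\<close> is \<open>8 * s / (2 * s - 1)\<close>: the constant
    for truncated data, doubled.\<close>
  also have "\<dots> = ennreal (8 * s / (2 * s - 1)) * ennreal Q"
    using Q0 by (subst ennreal_mult''[symmetric]) (simp_all add: c_def mult.assoc)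
  finally show ?thesis unfolding Q .
qed

theorem theorem7p3:
  fixes s :: real
  assumes "s > 1/2"
  shows "\<exists>C>0. \<forall>(u0 :: real^3 \<Rightarrow> field6) u0hat v (u :: real^3 \<Rightarrow> real \<Rightarrow> field6).
     in_range_I_minus_P u0 \<and> is_FT6 u0 u0hat \<and> maxwell_fourier_flow u0hat v \<and>
     (\<forall>t. is_FT6 (\<lambda>x. u x t) (\<lambda>\<xi>. v \<xi> t)) \<longrightarrow>
     (\<integral>\<^sup>+ t. (\<integral>\<^sup>+ x. ennreal ((1 + (norm x)^2) powr (- s) * (norm (u x t))^2) \<partial>lborel) \<partial>(lborel :: real measure))
       \<le> ennreal C * (\<integral>\<^sup>+ x. ennreal ((norm (u0 x))^2) \<partial>lborel)"
proof (intro exI[of _ "8 * s / (2 * s - 1)"] conjI allI impI, goal_cases)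
  case 1
  then show ?case using assms by simp
next
  case (2 u0 u0hat v u)
  then show ?case
    using kato_smoothing[OF assms, of u0 u0hat v u] by (simp add: bracket_def)
qed

end
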